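(* Let $\Theta=\theta_1^2$ be a degree $(2,2)$ rational inner function, where $\theta_1=\tilde p/p$ for a polynomial $p(z)=a-z_1+cz_2$ with no zeros on $\mathbb{D}^2$, a zero on $\mathbb{T}^2$, and $a,c>0$. Let $\mathcal{K}_\Theta=\mathcal{S}_1\oplus\mathcal{S}_2$ be an orthogonal decomposition into closed subspaces with $\mathcal{S}_1$ invariant under $M_{z_1}$ and $\mathcal{S}_2$ invariant under $M_{z_2}$, and let $S^1_\Theta=P_{\mathcal{S}_2}M_{z_1}|_{\mathcal{S}_2}$. Then the boundary of $\mathcal{W}(S^1_\Theta)$ is the curve $E=\{(x(\theta),y(\theta)):\theta\in[0,2\pi)\}$, where \[x(\theta)=\frac{a+c\cos\theta}{a+c}+\frac{ac(1-\cos\theta)}{(a+c)^2}\cos\Big(\theta-\arcsin\Big(\frac{a}{a+c}\sin\theta\Big)\Big),\] \[y(\theta)=\frac{c\sin\theta}{a+c}+\frac{ac(1-\cos\theta)}{(a+c)^2}\sin\Big(\theta-\arcsin\Big(\frac{a}{a+c}\sin\theta\Big)\Big).\]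
   Context: $\mathbb{D}$ is the open unit disk, $\mathbb{T}$ the unit circle, $H^2(\mathbb{D}^2)$ the Hardy space of the bidisk. $\tilde p(z)=z_1z_2\overline{p(1/\bar z_1,1/\bar z_2)}$, so $\theta_1=\tilde p/p$ is a rational inner function of degree $(1,1)$. $\mathcal{K}_\Theta=H^2(\mathbb{D}^2)\ominus\Theta H^2(\mathbb{D}^2)$. $\mathcal{W}(T)=\{\langle Th,h\rangle:\|h\|=1\}$ is the numerical range; the complex plane is identified with $\mathbb{R}^2$. *)

theory Defs
  imports "HOL-Analysis.Analysis"
begin

text \<open>Elements of the Hardy space of the bidisk are modelled as functions
  on complex * complex that are given on the open bidisk by a power series
  with square-summable coefficients and vanish outside the bidisk.\<close>

definition bidisk :: "(complex \<times> complex) set" where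
  "bidisk = {z. cmod (fst z) < 1 \<and> cmod (snd z) < 1}"

definition sq_summable_coef :: "(nat \<times> nat \<Rightarrow> complex) \<Rightarrow> bool" where
  "sq_summable_coef c \<longleftrightarrow> (\<lambda>k. (cmod (c k))\<^sup>2) summable_on UNIV"

definition has_H2_coef :: "(complex \<times> complex \<Rightarrow> complex) \<Rightarrow> (nat \<times> nat \<Rightarrow> complex) \<Rightarrow> bool" where
  "has_H2_coef f c \<longleftrightarrow> sq_summable_coef c \<and>
     (\<forall>z\<in>bidisk. f z = (\<Sum>\<^sub>\<infinity>k. c k * fst z ^ fst k * snd z ^ snd k)) \<and>
     (\<forall>z. z \<notin> bidisk \<longrightarrow> f z = 0)"

definition H2 :: "(complex \<times> complex \<Rightarrow> complex) set" where
  "H2 = {f. \<exists>c. has_H2_coef f c}"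

definition H2_coef :: "(complex \<times> complex \<Rightarrow> complex) \<Rightarrow> nat \<times> nat \<Rightarrow> complex" where
  "H2_coef f = (SOME c. has_H2_coef f c)"

definition H2_inner :: "(complex \<times> complex \<Rightarrow> complex) \<Rightarrow> (complex \<times> complex \<Rightarrow> complex) \<Rightarrow> complex" where
  "H2_inner f g = (\<Sum>\<^sub>\<infinity>k. H2_coef f k * cnj (H2_coef g k))"

definition H2_norm :: "(complex \<times> complex \<Rightarrow> complex) \<Rightarrow> real" where
  "H2_norm f = sqrt (Re (H2_inner f f))"

definition closed_subspace_H2 :: "(complex \<times> complex \<Rightarrow> complex) set \<Rightarrow> bool" where
  "closed_subspace_H2 S \<longleftrightarrow> S \<subseteq> H2 \<and> (\<lambda>z. 0) \<in> S \<and>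
     (\<forall>f\<in>S. \<forall>g\<in>S. (\<lambda>z. f z + g z) \<in> S) \<and>
     (\<forall>f\<in>S. \<forall>k::complex. (\<lambda>z. k * f z) \<in> S) \<and>
     (\<forall>u f. (\<forall>n::nat. u n \<in> S) \<and> f \<in> H2 \<and>
        (\<lambda>n. H2_norm (\<lambda>z. u n z - f z)) \<longlonglongrightarrow> 0 \<longrightarrow> f \<in> S)"

definition Mz1 :: "(complex \<times> complex \<Rightarrow> complex) \<Rightarrow> complex \<times> complex \<Rightarrow> complex" where
  "Mz1 f = (\<lambda>z. fst z * f z)"

definition Mz2 :: "(complex \<times> complex \<Rightarrow> complex) \<Rightarrow> complex \<times> complex \<Rightarrow> complex" where
  "Mz2 f = (\<lambda>z. snd z * f z)"

definition mult_H2 :: "(complex \<times> complex \<Rightarrow> complex) \<Rightarrow> (complex \<times> complex \<Rightarrow> complex) \<Rightarrow> complex \<times> complex \<Rightarrow> complex" where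
  "mult_H2 \<Theta> g = (\<lambda>z. if z \<in> bidisk then \<Theta> z * g z else 0)"

definition model_space :: "(complex \<times> complex \<Rightarrow> complex) \<Rightarrow> (complex \<times> complex \<Rightarrow> complex) set" where
  "model_space \<Theta> = {f \<in> H2. \<forall>g\<in>H2. H2_inner f (mult_H2 \<Theta> g) = 0}"

definition orth_proj :: "(complex \<times> complex \<Rightarrow> complex) set \<Rightarrow> (complex \<times> complex \<Rightarrow> complex) \<Rightarrow> complex \<times> complex \<Rightarrow> complex" where
  "orth_proj S f = (THE g. g \<in> S \<and> (\<forall>s\<in>S. H2_inner (\<lambda>z. f z - g z) s = 0))"

definition numerical_range :: "(complex \<times> complex \<Rightarrow> complex) set \<Rightarrow> ((complex \<times> complex \<Rightarrow> complex) \<Rightarrow> complex \<times> complex \<Rightarrow> complex) \<Rightarrow> complex set" where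
  "numerical_range S T = {H2_inner (T h) h | h. h \<in> S \<and> H2_norm h = 1}"

text \<open>The polynomial p, its reflection tilde p (computed from
  z1 z2 conj(p(1/conj z1, 1/conj z2)) for real a, c), theta_1 and Theta.\<close>
definition p_poly :: "real \<Rightarrow> real \<Rightarrow> complex \<times> complex \<Rightarrow> complex" where
  "p_poly a c z = of_real a - fst z + of_real c * snd z"

definition p_tilde :: "real \<Rightarrow> real \<Rightarrow> complex \<times> complex \<Rightarrow> complex" where
  "p_tilde a c z = of_real a * fst z * snd z - snd z + of_real c * fst z"

definition theta1 :: "real \<Rightarrow> real \<Rightarrow> complex \<times> complex \<Rightarrow> complex" where
  "theta1 a c z = p_tilde a c z / p_poly a c z"

definition Theta :: "real \<Rightarrow> real \<Rightarrow> complex \<times> complex \<Rightarrow> complex" where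
  "Theta a c z = (theta1 a c z)\<^sup>2"

definition xE :: "real \<Rightarrow> real \<Rightarrow> real \<Rightarrow> real" where
  "xE a c t = (a + c * cos t) / (a + c)
     + a * c * (1 - cos t) / (a + c)\<^sup>2 * cos (t - arcsin (a / (a + c) * sin t))"

definition yE :: "real \<Rightarrow> real \<Rightarrow> real \<Rightarrow> real" where
  "yE a c t = c * sin t / (a + c)
     + a * c * (1 - cos t) / (a + c)\<^sup>2 * sin (t - arcsin (a / (a + c) * sin t))"

definition curveE :: "real \<Rightarrow> real \<Rightarrow> complex set" where
  "curveE a c = {Complex (xE a c t) (yE a c t) | t. t \<in> {0..<2*pi}}"

end

theory Submission
  imports Defs
begin

text \<open>
  The hypotheses force \<open>a = 1 + c\<close>. Since \<open>p_poly\<close> is cyclic, a function belongs to the model space of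
  \<open>Theta = theta1\<^sup>2\<close> iff its product with \<open>p_poly\<^sup>2\<close> has no coefficient of index \<open>(i, j)\<close> with \<open>i, j \<ge> 2\<close>. For
  \<open>h\<close> in \<open>S2\<close>, invariance under \<open>Mz2\<close> removes all coefficients with \<open>i \<ge> 2\<close>, so that for fixed \<open>z2\<close> the
  function \<open>h\<close> lies in the two-dimensional model space of the square of the Blaschke factor with zero
  \<open>\<lambda>(z2) = cnj (1 / (a + c z2))\<close>, on which \<open>\<zeta> - z1\<close> is bounded below by \<open>\<bar>\<zeta> - \<lambda>(z2)\<bar>\<close>. The zeros \<open>\<lambda>(z2)\<close> fill the
  disc with centre \<open>A = a / (a + c)\<close> and radius \<open>C = c / (a + c)\<close>; integrating over \<open>z2\<close> gives
  \<open>norm ((\<zeta> - z1) h) \<ge> (\<bar>\<zeta> - A\<bar> - C) norm h\<close> whenever \<open>\<bar>\<zeta>\<bar> = 1\<close>, and this is a bound on the support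
  function of the numerical range. It is sharp: a function whose fibres are extremal at one boundary point
  can be multiplied by polynomials in \<open>z2\<close> that concentrate there; one further nonzero polynomial factor moves
  it into \<open>S2\<close>, because its component in \<open>S1\<close> lives in a four-dimensional space. By the Toeplitz-Hausdorff
  theorem the numerical range is convex, so its boundary is the envelope of the supporting lines with
  support function \<open>1 - (\<bar>\<zeta> - A\<bar> - C)\<^sup>2 / 2\<close>, which is the curve \<open>curveE\<close>.
\<close>

section \<open>The Hilbert space of square-summable families\<close>

text \<open>The difficulties come from the zero (1, -1) of \<open>p_poly\<close> on the torus.
  Division by \<open>p_poly\<close> is not bounded there, so multiplication by \<open>theta1\<close>
  is obtained from an energy balance for a realization of \<open>theta1\<close>, and density of the
  multiples of \<open>p_poly\<close> stands in for invertibility. Over z2 = -1 the double zero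
  \<lambda>(z2) reaches the unit circle, and the squared fibre norms can grow like |1 + z2| to the
  power -6. The test functions therefore carry the factor (1 + z2)^4, and the direction \<zeta> = 1,
  whose nearest zero is the one over z2 = -1, is reached only as a limit. The support function comes
  from |\<zeta> h - z1 h|^2 = 2 - 2 Re (cnj \<zeta> <z1 h, h>) for unit vectors h. Geometrically,
  the compressed shift with a double zero \<lambda> has as numerical range the disc about \<lambda>
  of radius (1 - |\<lambda>|^2)/2, and the curve is the outer envelope of these discs as \<lambda>
  runs through the boundary of the disc of zeros.\<close>

typedef 'a ell2 = "{x :: 'a \<Rightarrow> complex. (\<lambda>k. (cmod (x k))\<^sup>2) summable_on UNIV}"
  morphisms coord Abs_ell2
  by (rule exI[of _ "\<lambda>_. 0"]) simp

setup_lifting type_definition_ell2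

lemma ell2_eqI: "(\<And>k. coord x k = coord y k) \<Longrightarrow> x = y"
  by (simp add: coord_inject[symmetric] fun_eq_iff)

lemma sq_summable_coord: "(\<lambda>k. (cmod (coord x k))\<^sup>2) summable_on A"
  using coord[of x] summable_on_subset[of _ UNIV A] by auto

lemma cmod_add_sq_le: "(cmod (u + v))\<^sup>2 \<le> 2 * (cmod u)\<^sup>2 + 2 * (cmod v)\<^sup>2"
proof -
  have "(cmod (u + v))\<^sup>2 \<le> (cmod u + cmod v)\<^sup>2"
    by (intro power_mono norm_triangle_ineq) auto
  also have "\<dots> \<le> 2 * (cmod u)\<^sup>2 + 2 * (cmod v)\<^sup>2"
    using sum_squares_ge_zero[of "cmod u - cmod v" 0] by (simp add: power2_eq_square algebra_simps)
  finally show ?thesis .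
qed

lemma sq_summable_add:
  assumes "(\<lambda>k. (cmod (x k))\<^sup>2) summable_on A" "(\<lambda>k. (cmod (y k))\<^sup>2) summable_on A"
  shows "(\<lambda>k. (cmod (x k + y k))\<^sup>2) summable_on A"
  by (rule summable_on_comparison_test[where f = "\<lambda>k. 2 * (cmod (x k))\<^sup>2 + 2 * (cmod (y k))\<^sup>2"])
     (use assms cmod_add_sq_le in \<open>auto intro!: summable_on_add summable_on_cmult_right\<close>)

lemma sq_summable_cmult:
  assumes "(\<lambda>k. (cmod (x k))\<^sup>2) summable_on A"
  shows "(\<lambda>k. (cmod (c * x k))\<^sup>2) summable_on A"
  using summable_on_cmult_right[OF assms, of "(cmod c)\<^sup>2"] by (simp add: norm_mult power_mult_distrib)

lemma sq_summable_diff: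
  assumes "(\<lambda>k. (cmod (x k))\<^sup>2) summable_on A" "(\<lambda>k. (cmod (y k))\<^sup>2) summable_on A"
  shows "(\<lambda>k. (cmod (x k - y k))\<^sup>2) summable_on A"
  using sq_summable_add[of x A "\<lambda>k. - y k"] assms by simp

lemma abs_summable_coord_mult: "(\<lambda>k. norm (coord x k * cnj (coord y k))) summable_on A"
  by (rule Infinite_Sum.abs_summable_product)
     (use sq_summable_coord[of _ A] in \<open>simp_all add: norm_mult power2_eq_square\<close>)

lemma summable_coord_mult: "(\<lambda>k. coord x k * cnj (coord y k)) summable_on A"
  by (rule Infinite_Sum.abs_summable_summable[OF abs_summable_coord_mult])

text \<open>The class \<open>real_inner\<close> carries only a real inner product, while the
  numerical range needs the complex one; \<open>inner\<close> will be its real part.\<close>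

definition cinner :: "'a ell2 \<Rightarrow> 'a ell2 \<Rightarrow> complex" where
  "cinner x y = (\<Sum>\<^sub>\<infinity>k. coord x k * cnj (coord y k))"

lift_definition scaleC :: "complex \<Rightarrow> 'a ell2 \<Rightarrow> 'a ell2" (infixr "*\<^sub>C" 75) is
  "\<lambda>c x k. c * x k"
  by (auto intro: sq_summable_cmult)

instantiation ell2 :: (type) real_inner
begin

lift_definition zero_ell2 :: "'a ell2" is "\<lambda>_. 0" by simp
lift_definition plus_ell2 :: "'a ell2 \<Rightarrow> 'a ell2 \<Rightarrow> 'a ell2" is "\<lambda>x y k. x k + y k"
  by (auto intro: sq_summable_add)
lift_definition uminus_ell2 :: "'a ell2 \<Rightarrow> 'a ell2" is "\<lambda>x k. - x k" by simp
lift_definition minus_ell2 :: "'a ell2 \<Rightarrow> 'a ell2 \<Rightarrow> 'a ell2" is "\<lambda>x y k. x k - y k"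
  by (auto intro: sq_summable_diff)
lift_definition scaleR_ell2 :: "real \<Rightarrow> 'a ell2 \<Rightarrow> 'a ell2" is "\<lambda>c x k. of_real c * x k"
  by (auto intro: sq_summable_cmult)

definition inner_ell2 :: "'a ell2 \<Rightarrow> 'a ell2 \<Rightarrow> real" where "inner_ell2 x y = Re (cinner x y)"
definition norm_ell2 :: "'a ell2 \<Rightarrow> real" where "norm_ell2 x = sqrt (inner x x)"
definition sgn_ell2 :: "'a ell2 \<Rightarrow> 'a ell2" where "sgn_ell2 x = scaleR (inverse (norm x)) x"
definition dist_ell2 :: "'a ell2 \<Rightarrow> 'a ell2 \<Rightarrow> real" where "dist_ell2 x y = norm (x - y)"
definition uniformity_ell2 :: "('a ell2 \<times> 'a ell2) filter" where
  "uniformity_ell2 = (INF e\<in>{0<..}. principal {(x, y). dist x y < e})"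
definition open_ell2 :: "'a ell2 set \<Rightarrow> bool" where
  "open_ell2 U \<longleftrightarrow> (\<forall>x\<in>U. eventually (\<lambda>(x', y). x' = x \<longrightarrow> y \<in> U) uniformity)"

lemma cinner_self: "cinner x x = of_real (\<Sum>\<^sub>\<infinity>k. (cmod (coord x k))\<^sup>2)"
proof -
  have "cinner x x = (\<Sum>\<^sub>\<infinity>k. of_real ((cmod (coord x k))\<^sup>2))"
    unfolding cinner_def by (intro infsum_cong) (simp add: complex_mult_cnj cmod_power2)
  then show ?thesis
    using infsumI[OF has_sum_of_real[OF has_sum_infsum[OF sq_summable_coord[of x UNIV]], where 'a = complex]]
    by simp
qed

lemma cinner_commute: "cinner x y = cnj (cinner y x)"
  unfolding cinner_def infsum_cnj[symmetric] by (simp add: mult.commute)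

lemma cinner_add_left: "cinner (x + y) z = cinner x z + cinner y z"
  unfolding cinner_def plus_ell2.rep_eq
  by (simp add: distrib_right infsum_add summable_coord_mult)

lemma cinner_scaleC_left: "cinner (c *\<^sub>C x) z = c * cinner x z"
  unfolding cinner_def scaleC.rep_eq
  by (simp add: mult.assoc infsum_cmult_right summable_coord_mult)

lemma scaleR_eq_scaleC: "r *\<^sub>R x = of_real r *\<^sub>C (x :: 'a ell2)"
  by (intro ell2_eqI) (simp add: scaleR_ell2.rep_eq scaleC.rep_eq)

instance
proof
  fix x y z :: "'a ell2" and r s :: real
  show "dist x y = norm (x - y)" by (fact dist_ell2_def)
  show "x + y + z = x + (y + z)" "x + y = y + x" "0 + x = x" "- x + x = 0" "x - y = x + - y"
    by (transfer; simp add: algebra_simps)+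
  show "r *\<^sub>R (x + y) = r *\<^sub>R x + r *\<^sub>R y" "(r + s) *\<^sub>R x = r *\<^sub>R x + s *\<^sub>R x"
    "r *\<^sub>R s *\<^sub>R x = (r * s) *\<^sub>R x" "1 *\<^sub>R x = x"
    by (transfer; simp add: algebra_simps)+
  show "sgn x = scaleR (inverse (norm x)) x" by (fact sgn_ell2_def)
  show "uniformity = (INF e\<in>{0<..}. principal {(x, y :: 'a ell2). dist x y < e})"
    by (fact uniformity_ell2_def)
  show "open U = (\<forall>x\<in>U. eventually (\<lambda>(x', y). x' = x \<longrightarrow> y \<in> U) uniformity)" for U :: "'a ell2 set"
    by (fact open_ell2_def)
  show "inner x y = inner y x"
    by (simp add: inner_ell2_def cinner_commute[of x y])
  show "inner (x + y) z = inner x z + inner y z"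
    by (simp add: inner_ell2_def cinner_add_left)
  show "inner (r *\<^sub>R x) y = r * inner x y"
    by (simp add: inner_ell2_def scaleR_eq_scaleC cinner_scaleC_left)
  show "0 \<le> inner x x"
    by (simp add: inner_ell2_def cinner_self infsum_nonneg)
  show "inner x x = 0 \<longleftrightarrow> x = 0"
  proof
    assume "inner x x = 0"
    then have "(cmod (coord x k))\<^sup>2 = 0" for k
      by (intro nonneg_infsum_le_0D[where A = UNIV])
         (auto simp: inner_ell2_def cinner_self sq_summable_coord)
    then show "x = 0" by (intro ell2_eqI) (simp add: zero_ell2.rep_eq)
  qed (simp add: inner_ell2_def cinner_def zero_ell2.rep_eq)
  show "norm x = sqrt (inner x x)" by (fact norm_ell2_def)
qed

end

lemmas coord_simps [simp] =
  zero_ell2.rep_eq plus_ell2.rep_eq uminus_ell2.rep_eq minus_ell2.rep_eq scaleR_ell2.rep_eq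
  scaleC.rep_eq

lemma cinner_self_norm: "cinner x x = of_real ((norm x)\<^sup>2)"
  by (simp add: norm_ell2_def inner_ell2_def cinner_self infsum_nonneg)

lemma norm_sq_ell2: "(norm x)\<^sup>2 = (\<Sum>\<^sub>\<infinity>k. (cmod (coord x k))\<^sup>2)"
  by (simp add: norm_ell2_def inner_ell2_def cinner_self infsum_nonneg)

lemma inner_eq_Re_cinner: "inner x y = Re (cinner x y)" for x y :: "'a ell2"
  by (fact inner_ell2_def)

lemma cinner_0 [simp]: "cinner 0 x = 0" "cinner x 0 = 0"
  by (simp_all add: cinner_def)

lemma cinner_uminus_left: "cinner (- x) z = - cinner x z"
  using cinner_add_left[of x "- x" z] by (simp add: add_eq_0_iff)

lemma cinner_diff_left: "cinner (x - y) z = cinner x z - cinner y z"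
  using cinner_add_left[of x "- y" z] by (simp add: cinner_uminus_left)

lemma cinner_add_right: "cinner z (x + y) = cinner z x + cinner z y"
  by (subst (1 2 3) cinner_commute) (simp add: cinner_add_left)

lemma cinner_diff_right: "cinner z (x - y) = cinner z x - cinner z y"
  by (subst (1 2 3) cinner_commute) (simp add: cinner_diff_left)

lemma cinner_scaleC_right: "cinner z (c *\<^sub>C x) = cnj c * cinner z x"
  by (subst (1 2) cinner_commute) (simp add: cinner_scaleC_left)

lemmas cinner_simps = cinner_add_left cinner_diff_left cinner_scaleC_left
  cinner_add_right cinner_diff_right cinner_scaleC_right

lemma norm_scaleC [simp]: "norm (c *\<^sub>C x) = cmod c * norm x"
proof -
  have "(norm (c *\<^sub>C x))\<^sup>2 = (cmod c * norm x)\<^sup>2"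
    unfolding norm_sq_ell2 power_mult_distrib
    by (simp add: norm_mult power_mult_distrib infsum_cmult_right sq_summable_coord)
  then show ?thesis by simp
qed

lemma cmod_cinner_le: "cmod (cinner x y) \<le> norm x * norm y"
proof (cases "cinner x y = 0")
  case False
  \<comment> \<open>The unimodular factor rotates \<open>cinner x y\<close> onto the positive axis,
    where it agrees with the real inner product.\<close>
  define u where "u = cnj (cinner x y) / cmod (cinner x y)"
  have "cmod u = 1" using False by (simp add: u_def norm_divide)
  have "of_real (cmod (cinner x y)) = cinner (u *\<^sub>C x) y"
    using False complex_norm_square[of "cinner x y"]
    by (simp add: cinner_scaleC_left u_def power2_eq_square field_simps)
  then have "cmod (cinner x y) = inner (u *\<^sub>C x) y"
    by (metis Re_complex_of_real inner_ell2_def)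
  also have "\<dots> \<le> norm (u *\<^sub>C x) * norm y" by (rule norm_cauchy_schwarz)
  finally show ?thesis using \<open>cmod u = 1\<close> by simp
qed simp

lemma scaleC_simps [simp]: "0 *\<^sub>C x = 0" "c *\<^sub>C 0 = 0" "1 *\<^sub>C x = x" "a *\<^sub>C b *\<^sub>C x = (a * b) *\<^sub>C x"
  by (auto intro!: ell2_eqI)

lemma scaleC_distrib: "c *\<^sub>C (x + y) = c *\<^sub>C x + c *\<^sub>C y" "c *\<^sub>C (x - y) = c *\<^sub>C x - c *\<^sub>C y"
  "(c + d) *\<^sub>C x = c *\<^sub>C x + d *\<^sub>C x"
  by (auto intro!: ell2_eqI simp: algebra_simps)

lemma norm_coord_le: "cmod (coord x k) \<le> norm x"
proof -
  have "(cmod (coord x k))\<^sup>2 \<le> (norm x)\<^sup>2"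
    unfolding norm_sq_ell2
    using finite_sum_le_infsum[of "\<lambda>k. (cmod (coord x k))\<^sup>2" UNIV "{k}"] by (simp add: sq_summable_coord)
  then show ?thesis by (rule power2_le_imp_le) simp
qed

text \<open>Bounds on finite partial sums survive coordinatewise limits and can be checked on
  rectangles; the completeness proof and the output of \<open>theta1\<close> both use this.\<close>

lemma ell2_of_bounded_sums:
  assumes "\<And>F. finite F \<Longrightarrow> (\<Sum>k\<in>F. (cmod (x k))\<^sup>2) \<le> B\<^sup>2" and "0 \<le> B"
  obtains y where "coord y = x" "norm y \<le> B"
proof -
  have s: "(\<lambda>k. (cmod (x k))\<^sup>2) summable_on UNIV"
    by (rule nonneg_bdd_above_summable_on) (auto intro!: bdd_aboveI2[where M = "B\<^sup>2"] assms)
  then have c: "coord (Abs_ell2 x) = x" by (simp add: Abs_ell2_inverse)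
  have "(norm (Abs_ell2 x))\<^sup>2 \<le> B\<^sup>2"
    unfolding norm_sq_ell2 c by (rule infsum_le_finite_sums[OF s]) (auto intro: assms)
  then show ?thesis by (intro that[OF c] power2_le_imp_le[OF _ assms(2)])
qed

instance ell2 :: (type) complete_space
proof
  fix X :: "nat \<Rightarrow> 'a ell2"
  assume X: "Cauchy X"
  have "Cauchy (\<lambda>n. coord (X n) k)" for k
  proof (rule CauchyI)
    fix e :: real assume "0 < e"
    then obtain M where "\<forall>m\<ge>M. \<forall>n\<ge>M. norm (X m - X n) < e" using CauchyD[OF X] by blast
    moreover have "norm (coord (X m) k - coord (X n) k) \<le> norm (X m - X n)" for m n
      using norm_coord_le[of "X m - X n" k] by simp
    ultimately have "\<forall>m\<ge>M. \<forall>n\<ge>M. norm (coord (X m) k - coord (X n) k) < e"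
      using le_less_trans by blast
    then show "\<exists>M. \<forall>m\<ge>M. \<forall>n\<ge>M. norm (coord (X m) k - coord (X n) k) < e" ..
  qed
  then have "\<exists>l. (\<lambda>n. coord (X n) k) \<longlonglongrightarrow> l" for k
    by (simp add: Cauchy_convergent_iff convergent_def)
  then obtain l where l: "\<And>k. (\<lambda>n. coord (X n) k) \<longlonglongrightarrow> l k" by metis
  \<comment> \<open>The Cauchy bound passes to the limit on each finite index set first; the limit
    then differs from \<open>X m\<close> by a square-summable family of norm at most
    \<open>e\<close>.\<close>
  have close: "\<exists>y. coord y = (\<lambda>k. l k - coord (X m) k) \<and> norm y \<le> e"
    if "0 < e" and e: "\<forall>n\<ge>M. norm (X n - X m) < e" for m M e
  proof -
    have "(\<Sum>k\<in>F. (cmod (l k - coord (X m) k))\<^sup>2) \<le> e\<^sup>2" if "finite F" for F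
    proof (rule LIMSEQ_le_const2)
      show "(\<lambda>n. \<Sum>k\<in>F. (cmod (coord (X n) k - coord (X m) k))\<^sup>2)
              \<longlonglongrightarrow> (\<Sum>k\<in>F. (cmod (l k - coord (X m) k))\<^sup>2)"
        by (intro tendsto_intros l)
      have "(\<Sum>k\<in>F. (cmod (coord (X n) k - coord (X m) k))\<^sup>2) \<le> e\<^sup>2" if "n \<ge> M" for n
      proof -
        have "(\<Sum>k\<in>F. (cmod (coord (X n - X m) k))\<^sup>2) \<le> (norm (X n - X m))\<^sup>2"
          unfolding norm_sq_ell2 by (rule finite_sum_le_infsum) (auto simp: sq_summable_coord \<open>finite F\<close> simp del: coord_simps)
        also have "\<dots> \<le> e\<^sup>2" using e \<open>n \<ge> M\<close> by (intro power_mono) (auto intro: less_imp_le)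
        finally show ?thesis by simp
      qed
      then show "\<exists>M. \<forall>n\<ge>M. (\<Sum>k\<in>F. (cmod (coord (X n) k - coord (X m) k))\<^sup>2) \<le> e\<^sup>2" by blast
    qed
    from ell2_of_bounded_sums[of "\<lambda>k. l k - coord (X m) k" e, OF this] \<open>0 < e\<close>
    obtain y where "coord y = (\<lambda>k. l k - coord (X m) k)" "norm y \<le> e" by auto
    then show ?thesis by blast
  qed
  obtain M where M: "\<forall>m\<ge>M. \<forall>n\<ge>M. norm (X m - X n) < 1" using CauchyD[OF X, of 1] by auto
  obtain y where y: "coord y = (\<lambda>k. l k - coord (X M) k)" using close[of 1 M M] M by auto
  have "X \<longlonglongrightarrow> y + X M"
  proof (rule LIMSEQ_I)
    fix r :: real assume "0 < r"
    then obtain N where N: "\<forall>m\<ge>N. \<forall>n\<ge>N. norm (X m - X n) < r / 2" using CauchyD[OF X, of "r / 2"] by auto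
    have "norm (X m - (y + X M)) < r" if "m \<ge> N" for m
    proof -
      obtain w where w: "coord w = (\<lambda>k. l k - coord (X m) k)" "norm w \<le> r / 2"
        using close[of "r / 2" N m] N \<open>0 < r\<close> \<open>m \<ge> N\<close> by auto
      have "X m - (y + X M) = - w" by (rule ell2_eqI) (simp add: y w)
      then show ?thesis using w \<open>0 < r\<close> by simp
    qed
    then show "\<exists>no. \<forall>n\<ge>no. norm (X n - (y + X M)) < r" by blast
  qed
  then show "convergent X" by (auto simp: convergent_def)
qed

text \<open>A minimizing sequence is Cauchy by the parallelogram law, and minimality along every
  line through the limit forces orthogonality.\<close>

lemma projection_exists:
  fixes V :: "'a::{real_inner,complete_space} set"
  assumes "closed V" "subspace V"
  shows "\<exists>y\<in>V. \<forall>v\<in>V. inner (x - y) v = 0"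
proof -
  define d where "d = infdist x V"
  have ne: "V \<noteq> {}" using assms(2) subspace_0 by auto
  have d0: "0 \<le> d" by (simp add: d_def infdist_nonneg)
  have dle: "d \<le> norm (x - v)" if "v \<in> V" for v
    using infdist_le[OF that, of x] by (simp add: d_def dist_norm)
  have "\<exists>v\<in>V. norm (x - v) < d + inverse (Suc n)" for n :: nat
  proof (rule ccontr)
    assume "\<not> ?thesis"
    then have "d + inverse (Suc n) \<le> infdist x V"
      using ne by (auto simp: infdist_def dist_norm not_less intro!: cINF_greatest)
    then show False by (simp add: d_def)
  qed
  then obtain v where v: "\<And>n. v n \<in> V" "\<And>n::nat. norm (x - v n) < d + inverse (Suc n)" by metis
  have lim: "(\<lambda>n. norm (x - v n)) \<longlonglongrightarrow> d"
  proof (rule tendsto_sandwich[of "\<lambda>_. d" _ _ "\<lambda>n. d + inverse (Suc n)"])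
    show "(\<lambda>n. d + inverse (Suc n)) \<longlonglongrightarrow> d"
      using tendsto_add[OF tendsto_const LIMSEQ_inverse_real_of_nat] by simp
  qed (use dle v in \<open>auto intro!: always_eventually less_imp_le\<close>)
  have par: "(norm (v m - v n))\<^sup>2 \<le> 2 * (norm (x - v m))\<^sup>2 + 2 * (norm (x - v n))\<^sup>2 - 4 * d\<^sup>2" for m n
  proof -
    have "d \<le> norm (x - (1/2) *\<^sub>R (v m + v n))"
      by (intro dle subspace_scale[OF assms(2)] subspace_add[OF assms(2)] v)
    then have "d\<^sup>2 \<le> (norm (x - (1/2) *\<^sub>R (v m + v n)))\<^sup>2" using d0 by (intro power_mono)
    then show ?thesis
      by (simp add: power2_norm_eq_inner inner_diff_left inner_diff_right inner_add_left inner_add_right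
           inner_commute algebra_simps)
  qed
  have "Cauchy v"
  proof (rule CauchyI)
    fix e :: real assume "0 < e"
    have "(\<lambda>n. (norm (x - v n))\<^sup>2) \<longlonglongrightarrow> d\<^sup>2" by (intro tendsto_intros lim)
    moreover have "d\<^sup>2 < d\<^sup>2 + e\<^sup>2 / 4" using \<open>0 < e\<close> by simp
    ultimately have "eventually (\<lambda>n. (norm (x - v n))\<^sup>2 < d\<^sup>2 + e\<^sup>2 / 4) sequentially"
      by (rule order_tendstoD)
    then obtain M where M: "\<And>n. n \<ge> M \<Longrightarrow> (norm (x - v n))\<^sup>2 < d\<^sup>2 + e\<^sup>2 / 4"
      by (auto simp: eventually_sequentially)
    have "norm (v m - v n) < e" if "m \<ge> M" "n \<ge> M" for m n
    proof -
      have "(norm (v m - v n))\<^sup>2 < e\<^sup>2" using par[of m n] M[OF that(1)] M[OF that(2)] by linarith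
      then show ?thesis by (rule power2_less_imp_less) (use \<open>0 < e\<close> in simp)
    qed
    then show "\<exists>M. \<forall>m\<ge>M. \<forall>n\<ge>M. norm (v m - v n) < e" by blast
  qed
  then obtain y where y: "v \<longlonglongrightarrow> y" using Cauchy_convergent_iff convergent_def by blast
  then have yV: "y \<in> V" using assms(1) v(1) closed_sequentially by blast
  have "(\<lambda>n. norm (x - v n)) \<longlonglongrightarrow> norm (x - y)" by (intro tendsto_intros y)
  then have dy: "norm (x - y) = d" using lim LIMSEQ_unique by blast
  have "inner (x - y) w = 0" if "w \<in> V" for w
  proof (rule ccontr)
    assume nz: "inner (x - y) w \<noteq> 0"
    then have w0: "inner w w > 0" by (metis inner_gt_zero_iff inner_zero_right)
    \<comment> \<open>\<open>t *\<^sub>R w\<close> is the point of the line through \<open>w\<close>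
      nearest to \<open>x - y\<close>; a nonzero product would beat the infimum.\<close>
    define t where "t = inner (x - y) w / inner w w"
    have "d \<le> norm (x - (y + t *\<^sub>R w))"
      by (intro dle subspace_add[OF assms(2)] subspace_scale[OF assms(2)] yV that)
    then have "d\<^sup>2 \<le> (norm ((x - y) - t *\<^sub>R w))\<^sup>2" using d0 by (intro power_mono) (auto simp: algebra_simps)
    also have "\<dots> = (norm (x - y))\<^sup>2 - 2 * t * inner (x - y) w + t\<^sup>2 * inner w w"
      unfolding power2_norm_eq_inner
      by (simp add: inner_diff_left inner_diff_right inner_commute algebra_simps power2_eq_square)
    also have "\<dots> = d\<^sup>2 - (inner (x - y) w)\<^sup>2 / inner w w"
      using w0 by (simp add: dy t_def power2_eq_square field_simps)
    also have "\<dots> < d\<^sup>2" using nz w0 by simp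
    finally show False by simp
  qed
  then show ?thesis using yV by blast
qed

section \<open>Double power series and shifts\<close>

type_synonym coeffs = "(nat \<times> nat) ell2"

lemma summable_on_injective_support:
  assumes "inj h" "\<And>k. k \<notin> range h \<Longrightarrow> f k = 0"
  shows "f summable_on UNIV \<longleftrightarrow> (\<lambda>k. f (h k)) summable_on UNIV"
  using summable_on_cong_neutral[of "range h" UNIV f f] summable_on_reindex[OF assms(1), of f] assms(2)
  by (simp add: comp_def)

lemma infsum_injective_support:
  fixes f :: "'a \<Rightarrow> 'b::{comm_monoid_add, t2_space}"
  assumes "inj h" "\<And>k. k \<notin> range h \<Longrightarrow> f k = 0"
  shows "infsum f UNIV = infsum (\<lambda>k. f (h k)) UNIV"
  using infsum_cong_neutral[of "range h" UNIV f f] infsum_reindex[OF assms(1), of f] assms(2)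
  by (simp add: comp_def)

definition suc1 :: "nat \<times> nat \<Rightarrow> nat \<times> nat" where "suc1 k = (Suc (fst k), snd k)"
definition suc2 :: "nat \<times> nat \<Rightarrow> nat \<times> nat" where "suc2 k = (fst k, Suc (snd k))"

lemma inj_suc: "inj suc1" "inj suc2"
  by (auto simp: suc1_def suc2_def inj_def prod_eq_iff)

definition rsh1 :: "(nat \<times> nat \<Rightarrow> complex) \<Rightarrow> nat \<times> nat \<Rightarrow> complex" where
  "rsh1 c k = (case fst k of 0 \<Rightarrow> 0 | Suc i \<Rightarrow> c (i, snd k))"
definition rsh2 :: "(nat \<times> nat \<Rightarrow> complex) \<Rightarrow> nat \<times> nat \<Rightarrow> complex" where
  "rsh2 c k = (case snd k of 0 \<Rightarrow> 0 | Suc j \<Rightarrow> c (fst k, j))"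

lemma rsh_simps [simp]:
  "rsh1 c (0, j) = 0" "rsh1 c (Suc i, j) = c (i, j)" "rsh2 c (i, 0) = 0" "rsh2 c (i, Suc j) = c (i, j)"
  "rsh1 c (suc1 k) = c k" "rsh2 c (suc2 k) = c k"
  by (simp_all add: rsh1_def rsh2_def suc1_def suc2_def)

lemma rsh_outside: "k \<notin> range suc1 \<Longrightarrow> rsh1 c k = 0" "k \<notin> range suc2 \<Longrightarrow> rsh2 c k = 0"
  by (cases k; force simp: rsh1_def rsh2_def suc1_def suc2_def image_iff split: nat.splits)+

definition pval :: "(nat \<times> nat \<Rightarrow> complex) \<Rightarrow> complex \<times> complex \<Rightarrow> complex" where
  "pval c z = (\<Sum>\<^sub>\<infinity>k. c k * fst z ^ fst k * snd z ^ snd k)"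

lemma geometric_summable_on:
  assumes "0 \<le> s" "s < 1" "0 \<le> t" "t < (1::real)"
  shows "(\<lambda>k. s ^ fst k * t ^ snd k) summable_on (UNIV :: (nat \<times> nat) set)"
proof -
  have geo: "((\<lambda>i. r ^ i) has_sum (1 / (1 - r))) UNIV" if "0 \<le> r" "r < 1" for r :: real
    using that by (intro sums_nonneg_imp_has_sum geometric_sums) auto
  have "((\<lambda>j. s ^ fst (i, j) * t ^ snd (i, j)) has_sum (s ^ i * (1 / (1 - t)))) UNIV" for i :: nat
    using has_sum_cmult_right[OF geo[OF assms(3,4)]] by simp
  moreover have "(\<lambda>i. s ^ i * (1 / (1 - t))) summable_on UNIV"
    by (intro summable_on_cmult_left has_sum_imp_summable[OF geo[OF assms(1,2)]])
  ultimately have "(\<lambda>k. s ^ fst k * t ^ snd k) summable_on Sigma UNIV (\<lambda>_. UNIV)"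
    by (rule summable_on_SigmaI) (use assms in auto)
  then show ?thesis by simp
qed

text \<open>The hypothesis is boundedness rather than square-summability because the state sequences
  in \<open>theta1_multiplier_contraction\<close> are only shown to be bounded.\<close>

lemma pval_abs_summable:
  assumes "\<And>k. cmod (c k) \<le> B" "z \<in> bidisk"
  shows "(\<lambda>k. norm (c k * fst z ^ fst k * snd z ^ snd k)) summable_on UNIV"
proof (rule Infinite_Sum.abs_summable_on_comparison_test')
  show "(\<lambda>k. B * (cmod (fst z) ^ fst k * cmod (snd z) ^ snd k)) summable_on UNIV"
    using assms(2) by (intro summable_on_cmult_right geometric_summable_on) (auto simp: bidisk_def)
  show "cmod (c k * fst z ^ fst k * snd z ^ snd k) \<le> B * (cmod (fst z) ^ fst k * cmod (snd z) ^ snd k)" for k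
    using assms(1)[of k] by (simp add: norm_mult norm_power mult.assoc mult_right_mono)
qed

lemma pval_has_sum:
  assumes "\<And>k. cmod (c k) \<le> B" "z \<in> bidisk"
  shows "((\<lambda>k. c k * fst z ^ fst k * snd z ^ snd k) has_sum pval c z) UNIV"
  unfolding pval_def
  by (rule has_sum_infsum[OF Infinite_Sum.abs_summable_summable[OF pval_abs_summable[OF assms]]])

lemma pval_add:
  assumes "\<And>k. cmod (c k) \<le> B" "\<And>k. cmod (d k) \<le> D" "z \<in> bidisk"
  shows "pval (\<lambda>k. c k + d k) z = pval c z + pval d z"
  using infsumI[OF has_sum_add[OF pval_has_sum[OF assms(1,3)] pval_has_sum[OF assms(2,3)]]]
  by (simp add: pval_def algebra_simps)

lemma pval_cmult:
  assumes "\<And>k. cmod (c k) \<le> B" "z \<in> bidisk"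
  shows "pval (\<lambda>k. s * c k) z = s * pval c z"
  using infsumI[OF has_sum_cmult_right[OF pval_has_sum[OF assms(1,2)], of s]]
  by (simp add: pval_def algebra_simps)

lemma pval_rsh:
  assumes "\<And>k. cmod (c k) \<le> B" "z \<in> bidisk"
  shows "pval (rsh1 c) z = fst z * pval c z" "pval (rsh2 c) z = snd z * pval c z"
proof -
  have "pval (rsh1 c) z = (\<Sum>\<^sub>\<infinity>k. rsh1 c (suc1 k) * fst z ^ fst (suc1 k) * snd z ^ snd (suc1 k))"
    unfolding pval_def by (rule infsum_injective_support[OF inj_suc(1)]) (simp add: rsh_outside)
  also have "\<dots> = pval (\<lambda>k. fst z * c k) z"
    unfolding pval_def by (rule infsum_cong) (simp add: suc1_def)
  finally show "pval (rsh1 c) z = fst z * pval c z" using pval_cmult[OF assms] by simp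
  have "pval (rsh2 c) z = (\<Sum>\<^sub>\<infinity>k. rsh2 c (suc2 k) * fst z ^ fst (suc2 k) * snd z ^ snd (suc2 k))"
    unfolding pval_def by (rule infsum_injective_support[OF inj_suc(2)]) (simp add: rsh_outside)
  also have "\<dots> = pval (\<lambda>k. snd z * c k) z"
    unfolding pval_def by (rule infsum_cong) (simp add: suc2_def)
  finally show "pval (rsh2 c) z = snd z * pval c z" using pval_cmult[OF assms] by simp
qed

section \<open>Uniqueness of the coefficients of a power series\<close>

lemma summable_norm_powser_bounded:
  fixes c :: "nat \<Rightarrow> complex"
  assumes "\<And>n. cmod (c n) \<le> B" "cmod z < 1"
  shows "summable (\<lambda>n. norm (c n * z ^ n))"
proof (rule summable_comparison_test')
  show "summable (\<lambda>n. B * cmod z ^ n)"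
    using assms(2) by (intro summable_mult summable_geometric) auto
  show "norm (norm (c n * z ^ n)) \<le> B * cmod z ^ n" for n
    using assms(1)[of n] by (simp add: norm_mult norm_power mult_right_mono)
qed

text \<open>Bounded coefficients give radius of convergence at least 1, so the identity principle
  for formal power series applies near 0.\<close>

lemma bounded_powser_zero_imp_zero:
  fixes c :: "nat \<Rightarrow> complex"
  assumes "\<And>n. cmod (c n) \<le> B" "\<And>z. cmod z < 1 \<Longrightarrow> (\<Sum>n. c n * z ^ n) = 0"
  shows "c n = 0"
proof -
  have "conv_radius c \<ge> 1"
    using summable_norm_cancel[OF summable_norm_powser_bounded[OF assms(1)]]
    by (intro conv_radius_geI_ex') (auto simp: one_ereal_def)
  then have r: "fps_conv_radius (Abs_fps c) > 0"
    by (auto simp: fps_conv_radius_def intro: less_le_trans[of 0 1])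
  have "eventually (\<lambda>z. eval_fps (Abs_fps c) z = eval_fps 0 z) (nhds 0)"
    using eventually_nhds_in_open[of "ball 0 1" "0 :: complex"]
    by (rule eventually_mono) (auto simp: eval_fps_def assms(2))
  then have "Abs_fps c = 0" using r by (intro eval_fps_eqD) auto
  then show ?thesis by (metis fps_nth_Abs_fps fps_zero_nth)
qed

text \<open>One variable at a time: for fixed z2 the row sums are the coefficients of a vanishing
  series in z1, so each row vanishes as a series in z2.\<close>

lemma pval_inject:
  assumes "\<And>k. cmod (c k) \<le> B" "\<And>z. z \<in> bidisk \<Longrightarrow> pval c z = 0"
  shows "c k = 0"
proof -
  define row where "row i w = (\<Sum>j. c (i, j) * w ^ j)" for i w
  have B0: "0 \<le> B" using assms(1)[of undefined] norm_ge_zero order_trans by blast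
  have row_sum: "((\<lambda>j. c (i, j) * w ^ j) has_sum row i w) UNIV" if "cmod w < 1" for i w
  proof (rule norm_summable_imp_has_sum)
    show s: "summable (\<lambda>j. norm (c (i, j) * w ^ j))"
      by (rule summable_norm_powser_bounded[OF assms(1) that])
    show "(\<lambda>j. c (i, j) * w ^ j) sums row i w"
      unfolding row_def by (rule summable_sums[OF summable_norm_cancel[OF s]])
  qed
  have row0: "row i w = 0" if w: "cmod w < 1" for i w
  proof (rule bounded_powser_zero_imp_zero)
    show "cmod (row i w) \<le> B / (1 - cmod w)" for i
    proof -
      have "cmod (row i w) \<le> (\<Sum>j. norm (c (i, j) * w ^ j))"
        unfolding row_def by (rule summable_norm[OF summable_norm_powser_bounded[OF assms(1) w]])
      also have "\<dots> \<le> (\<Sum>j. B * cmod w ^ j)"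
        using w by (intro suminf_le summable_norm_powser_bounded[OF assms(1)] summable_mult summable_geometric)
          (auto simp: norm_mult norm_power intro!: mult_right_mono assms)
      also have "\<dots> = B / (1 - cmod w)" using w by (simp add: suminf_mult suminf_geometric summable_geometric)
      finally show ?thesis .
    qed
    fix z :: complex assume z: "cmod z < 1"
    have zw: "(z, w) \<in> bidisk" using z w by (simp add: bidisk_def)
    have "((\<lambda>k. c k * z ^ fst k * w ^ snd k) has_sum 0) (UNIV \<times> UNIV)"
      using pval_has_sum[of c B "(z, w)", OF assms(1) zw] unfolding assms(2)[OF zw] by simp
    moreover have "((\<lambda>j. c (i, j) * z ^ fst (i, j) * w ^ snd (i, j)) has_sum (row i w * z ^ i)) UNIV" for i
      using has_sum_cmult_left[OF row_sum[OF w], of i "z ^ i"] by (simp add: algebra_simps)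
    ultimately have "((\<lambda>i. row i w * z ^ i) has_sum 0) UNIV"
      by (rule has_sum_Sigma')
    then show "(\<Sum>i. row i w * z ^ i) = 0" by (intro sums_unique[symmetric] has_sum_imp_sums)
  qed
  have "c (i, j) = 0" for i j
    by (rule bounded_powser_zero_imp_zero[where c = "\<lambda>j. c (i, j)", OF assms(1)])
       (use row0[unfolded row_def] in blast)
  then show ?thesis by (cases k) simp
qed

section \<open>Shifts and their adjoints, the backward shifts\<close>

lift_definition sh1 :: "coeffs \<Rightarrow> coeffs" is rsh1
  by (subst summable_on_injective_support[OF inj_suc(1)]) (auto simp: rsh_outside)
lift_definition sh2 :: "coeffs \<Rightarrow> coeffs" is rsh2
  by (subst summable_on_injective_support[OF inj_suc(2)]) (auto simp: rsh_outside)
lift_definition bs1 :: "coeffs \<Rightarrow> coeffs" is "\<lambda>c k. c (suc1 k)"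
proof -
  fix c :: "nat \<times> nat \<Rightarrow> complex"
  assume c: "(\<lambda>k. (cmod (c k))\<^sup>2) summable_on UNIV"
  show "(\<lambda>k. (cmod (c (suc1 k)))\<^sup>2) summable_on UNIV"
    using summable_on_reindex[OF inj_suc(1), of "\<lambda>k. (cmod (c k))\<^sup>2"] summable_on_subset[OF c, of "range suc1"]
    by (simp add: comp_def)
qed
lift_definition bs2 :: "coeffs \<Rightarrow> coeffs" is "\<lambda>c k. c (suc2 k)"
proof -
  fix c :: "nat \<times> nat \<Rightarrow> complex"
  assume c: "(\<lambda>k. (cmod (c k))\<^sup>2) summable_on UNIV"
  show "(\<lambda>k. (cmod (c (suc2 k)))\<^sup>2) summable_on UNIV"
    using summable_on_reindex[OF inj_suc(2), of "\<lambda>k. (cmod (c k))\<^sup>2"] summable_on_subset[OF c, of "range suc2"]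
    by (simp add: comp_def)
qed

lemmas shift_rep = sh1.rep_eq sh2.rep_eq bs1.rep_eq bs2.rep_eq

lemma coord_shift [simp]:
  "coord (sh1 x) (0, j) = 0" "coord (sh1 x) (Suc i, j) = coord x (i, j)"
  "coord (sh2 x) (i, 0) = 0" "coord (sh2 x) (i, Suc j) = coord x (i, j)"
  "coord (bs1 x) (i, j) = coord x (Suc i, j)" "coord (bs2 x) (i, j) = coord x (i, Suc j)"
  by (simp_all add: shift_rep suc1_def suc2_def)

lemma ell2_prod_eqI: "(\<And>i j. coord x (i, j) = coord y (i, j)) \<Longrightarrow> x = y"
  by (rule ell2_eqI) auto

lemma rsh_linear:
  "rsh1 (\<lambda>k. f k + g k) k = rsh1 f k + rsh1 g k" "rsh2 (\<lambda>k. f k + g k) k = rsh2 f k + rsh2 g k"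
  "rsh1 (\<lambda>k. f k - g k) k = rsh1 f k - rsh1 g k" "rsh2 (\<lambda>k. f k - g k) k = rsh2 f k - rsh2 g k"
  "rsh1 (\<lambda>k. c * f k) k = c * rsh1 f k" "rsh2 (\<lambda>k. c * f k) k = c * rsh2 f k"
  by (simp_all add: rsh1_def rsh2_def split: nat.splits)

lemma shift_linear:
  "sh1 (x + y) = sh1 x + sh1 y" "sh2 (x + y) = sh2 x + sh2 y"
  "bs1 (x + y) = bs1 x + bs1 y" "bs2 (x + y) = bs2 x + bs2 y"
  "sh1 (x - y) = sh1 x - sh1 y" "sh2 (x - y) = sh2 x - sh2 y"
  "bs1 (x - y) = bs1 x - bs1 y" "bs2 (x - y) = bs2 x - bs2 y"
  "sh1 (c *\<^sub>C x) = c *\<^sub>C sh1 x" "sh2 (c *\<^sub>C x) = c *\<^sub>C sh2 x"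
  "bs1 (c *\<^sub>C x) = c *\<^sub>C bs1 x" "bs2 (c *\<^sub>C x) = c *\<^sub>C bs2 x"
  by (auto intro!: ell2_eqI simp: shift_rep rsh_linear)

lemma shift_0 [simp]: "sh1 0 = 0" "sh2 0 = 0" "bs1 0 = 0" "bs2 0 = 0"
  using shift_linear(5-8)[of 0 0] by simp_all

lemma cinner_sh1: "cinner (sh1 x) y = cinner x (bs1 y)"
  unfolding cinner_def
  by (subst infsum_injective_support[OF inj_suc(1)]) (auto simp: shift_rep rsh_outside)

lemma cinner_sh2: "cinner (sh2 x) y = cinner x (bs2 y)"
  unfolding cinner_def
  by (subst infsum_injective_support[OF inj_suc(2)]) (auto simp: shift_rep rsh_outside)

lemma cinner_sh_right: "cinner x (sh1 y) = cinner (bs1 x) y" "cinner x (sh2 y) = cinner (bs2 x) y"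
  by (metis cinner_commute cinner_sh1, metis cinner_commute cinner_sh2)

lemma bs_sh [simp]: "bs1 (sh1 x) = x" "bs2 (sh2 x) = x"
  by (auto intro!: ell2_prod_eqI)

lemma shift_commute: "bs1 (bs2 x) = bs2 (bs1 x)" "bs1 (sh2 x) = sh2 (bs1 x)" "bs2 (sh1 x) = sh1 (bs2 x)"
  "sh1 (sh2 x) = sh2 (sh1 x)"
  by (auto intro!: ell2_prod_eqI simp: shift_rep rsh1_def rsh2_def suc1_def suc2_def split: nat.splits)

lemma norm_sh [simp]: "norm (sh1 x) = norm x" "norm (sh2 x) = norm x"
  by (simp_all add: norm_eq_sqrt_inner inner_eq_Re_cinner cinner_sh1 cinner_sh2)

lemma norm_bs_le: "norm (bs1 x) \<le> norm x" "norm (bs2 x) \<le> norm x"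
proof -
  have "(norm (bs1 x))\<^sup>2 = inner (sh1 (bs1 x)) x"
    by (simp add: power2_norm_eq_inner inner_eq_Re_cinner cinner_sh1)
  also have "\<dots> \<le> norm (bs1 x) * norm x" using norm_cauchy_schwarz[of "sh1 (bs1 x)" x] by simp
  finally show "norm (bs1 x) \<le> norm x" by (cases "norm (bs1 x) = 0") (simp_all add: power2_eq_square)
  have "(norm (bs2 x))\<^sup>2 = inner (sh2 (bs2 x)) x"
    by (simp add: power2_norm_eq_inner inner_eq_Re_cinner cinner_sh2)
  also have "\<dots> \<le> norm (bs2 x) * norm x" using norm_cauchy_schwarz[of "sh2 (bs2 x)" x] by simp
  finally show "norm (bs2 x) \<le> norm x" by (cases "norm (bs2 x) = 0") (simp_all add: power2_eq_square)
qed

text \<open>\<open>sh1 (bs1 x)\<close> is the orthogonal projection of \<open>x\<close> onto the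
  rows of index at least 1, so the squared norm lost under \<open>bs1\<close> is that of row
  0.\<close>

lemma norm_bs1_eq_imp_row0: 
  assumes "norm x \<le> norm (bs1 x)"
  shows "coord x (0, j) = 0"
proof -
  have "(norm (x - sh1 (bs1 x)))\<^sup>2 = (norm x)\<^sup>2 - (norm (bs1 x))\<^sup>2"
    by (simp add: power2_norm_eq_inner inner_eq_Re_cinner cinner_diff_left cinner_diff_right cinner_sh1
        cinner_sh_right shift_linear)
  also have "\<dots> \<le> 0" using assms by (simp add: power_mono)
  finally have "x = sh1 (bs1 x)" by simp
  then show ?thesis by (metis coord_shift(1))
qed

section \<open>The Hardy space as square-summable double sequences\<close>

definition fn_of :: "coeffs \<Rightarrow> complex \<times> complex \<Rightarrow> complex" where
  "fn_of x z = (if z \<in> bidisk then pval (coord x) z else 0)"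

text \<open>Injectivity identifies the coefficients chosen in \<open>H2_coef\<close> with the
  coordinates, so that all Hardy space notions transfer to \<open>coeffs\<close>.\<close>

lemma fn_of_inject: "fn_of x = fn_of y \<longleftrightarrow> x = y"
proof
  assume eq: "fn_of x = fn_of y"
  have "coord (x - y) k = 0" for k
  proof (rule pval_inject)
    show "cmod (coord (x - y) k) \<le> norm (x - y)" for k by (rule norm_coord_le)
    fix z assume z: "z \<in> bidisk"
    have "pval (coord (x - y)) z = pval (\<lambda>k. coord x k + (-1) * coord y k) z" by (simp add: pval_def)
    also have "\<dots> = pval (coord x) z + pval (\<lambda>k. (-1) * coord y k) z"
      by (rule pval_add[of "coord x" "norm x" _ "norm y", OF norm_coord_le _ z]) (simp add: norm_coord_le)
    also have "\<dots> = pval (coord x) z - pval (coord y) z"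
      using pval_cmult[of "coord y" "norm y" z "-1", OF norm_coord_le z] by simp
    also have "\<dots> = 0" using fun_cong[OF eq, of z] z by (simp add: fn_of_def)
    finally show "pval (coord (x - y)) z = 0" .
  qed
  then show "x = y" by (intro ell2_eqI) simp
qed simp

lemma has_H2_coef_iff: "has_H2_coef f c \<longleftrightarrow> (\<exists>x. c = coord x \<and> f = fn_of x)"
proof
  assume h: "has_H2_coef f c"
  then have "coord (Abs_ell2 c) = c" by (simp add: has_H2_coef_def sq_summable_coef_def Abs_ell2_inverse)
  moreover from this have "f = fn_of (Abs_ell2 c)"
    using h by (auto simp: has_H2_coef_def fn_of_def pval_def)
  ultimately show "\<exists>x. c = coord x \<and> f = fn_of x" by metis
qed (auto simp: has_H2_coef_def sq_summable_coef_def sq_summable_coord fn_of_def pval_def)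

lemma H2_eq_range: "H2 = range fn_of"
  by (auto simp: H2_def has_H2_coef_iff)

lemma H2_coef_fn_of [simp]: "H2_coef (fn_of x) = coord x"
  unfolding H2_coef_def by (rule some_equality) (auto simp: has_H2_coef_iff fn_of_inject)

lemma H2_inner_fn_of [simp]: "H2_inner (fn_of x) (fn_of y) = cinner x y"
  by (simp add: H2_inner_def cinner_def)

lemma H2_norm_fn_of [simp]: "H2_norm (fn_of x) = norm x"
  by (simp add: H2_norm_def cinner_self_norm)

lemma fn_of_add: "fn_of (x + y) = (\<lambda>z. fn_of x z + fn_of y z)"
  using pval_add[of "coord x" "norm x" "coord y" "norm y", OF norm_coord_le norm_coord_le]
  by (auto simp: fn_of_def plus_ell2.rep_eq)

lemma fn_of_scaleC: "fn_of (c *\<^sub>C x) = (\<lambda>z. c * fn_of x z)"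
  using pval_cmult[of "coord x" "norm x", OF norm_coord_le] by (auto simp: fn_of_def scaleC.rep_eq)

lemma fn_of_diff: "fn_of (x - y) = (\<lambda>z. fn_of x z - fn_of y z)"
proof -
  have eq: "x - y = x + (-1) *\<^sub>C y" by (rule ell2_eqI) simp
  show ?thesis unfolding eq fn_of_add fn_of_scaleC by simp
qed

lemma fn_of_0: "fn_of 0 = (\<lambda>z. 0)"
  using fn_of_scaleC[of 0 0] by simp

lemma fn_of_sh1: "fn_of (sh1 x) = Mz1 (fn_of x)"
  using pval_rsh(1)[of "coord x" "norm x", OF norm_coord_le] by (auto simp: fn_of_def sh1.rep_eq Mz1_def)

lemma fn_of_sh2: "fn_of (sh2 x) = Mz2 (fn_of x)"
  using pval_rsh(2)[of "coord x" "norm x", OF norm_coord_le] by (auto simp: fn_of_def sh2.rep_eq Mz2_def)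

section \<open>Complex subspaces and orthogonal projections\<close>

definition csubspace2 :: "'a ell2 set \<Rightarrow> bool" where
  "csubspace2 V \<longleftrightarrow> 0 \<in> V \<and> (\<forall>x\<in>V. \<forall>y\<in>V. x + y \<in> V) \<and> (\<forall>x\<in>V. \<forall>c. c *\<^sub>C x \<in> V)"

lemma csubspace2D:
  assumes "csubspace2 V"
  shows "0 \<in> V" "x \<in> V \<Longrightarrow> y \<in> V \<Longrightarrow> x + y \<in> V" "x \<in> V \<Longrightarrow> c *\<^sub>C x \<in> V"
    "x \<in> V \<Longrightarrow> y \<in> V \<Longrightarrow> x - y \<in> V"
proof -
  show "x \<in> V \<Longrightarrow> y \<in> V \<Longrightarrow> x + y \<in> V" for x y using assms by (auto simp: csubspace2_def)
  then have "x \<in> V \<Longrightarrow> y \<in> V \<Longrightarrow> x + (-1) *\<^sub>C y \<in> V" using assms by (auto simp: csubspace2_def)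
  moreover have "x + (-1) *\<^sub>C y = x - y" by (rule ell2_eqI) simp
  ultimately show "x \<in> V \<Longrightarrow> y \<in> V \<Longrightarrow> x - y \<in> V" by simp
qed (use assms in \<open>auto simp: csubspace2_def\<close>)

lemma cprojection_exists:
  assumes "closed V" "csubspace2 V"
  shows "\<exists>y\<in>V. \<forall>v\<in>V. cinner (x - y) v = 0"
proof -
  have "subspace V"
    using csubspace2D[OF assms(2)] by (auto simp: subspace_def scaleR_eq_scaleC)
  then obtain y where y: "y \<in> V" "\<forall>v\<in>V. inner (x - y) v = 0"
    using projection_exists[OF assms(1)] by blast
  have "cinner (x - y) v = 0" if "v \<in> V" for v
  proof (rule complex_eqI)
    show "Re (cinner (x - y) v) = Re 0" using y that by (simp add: inner_eq_Re_cinner)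
    \<comment> \<open>Real orthogonality to \<i> v gives the imaginary part.\<close>
    have "inner (x - y) (\<i> *\<^sub>C v) = 0" using y csubspace2D[OF assms(2)] that by blast
    then show "Im (cinner (x - y) v) = Im 0" by (simp add: inner_eq_Re_cinner cinner_scaleC_right)
  qed
  then show ?thesis using y by blast
qed

lemma closed_subspace_H2D:
  assumes "closed_subspace_H2 S"
  obtains V where "S = fn_of ` V" "closed V" "csubspace2 V"
proof
  define V where "V = {x. fn_of x \<in> S}"
  show "S = fn_of ` V" using assms by (auto simp: closed_subspace_H2_def H2_eq_range V_def)
  show "csubspace2 V"
    using assms by (auto simp: closed_subspace_H2_def csubspace2_def V_def fn_of_0 fn_of_add fn_of_scaleC)
  show "closed V"
    unfolding closed_sequential_limits
  proof safe
    fix u l assume u: "\<forall>n. u n \<in> V" "u \<longlonglongrightarrow> l"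
    have "(\<lambda>n. norm (u n - l)) \<longlonglongrightarrow> 0" using u(2) by (simp add: LIM_zero tendsto_norm_zero)
    then have "(\<lambda>n. H2_norm (\<lambda>z. fn_of (u n) z - fn_of l z)) \<longlonglongrightarrow> 0" by (simp flip: fn_of_diff)
    moreover have "\<forall>n. fn_of (u n) \<in> S" "fn_of l \<in> H2" using u by (auto simp: V_def H2_eq_range)
    moreover have "\<forall>u f. (\<forall>n::nat. u n \<in> S) \<and> f \<in> H2 \<and>
        (\<lambda>n. H2_norm (\<lambda>z. u n z - f z)) \<longlonglongrightarrow> 0 \<longrightarrow> f \<in> S"
      using assms unfolding closed_subspace_H2_def by (elim conjE)
    ultimately have "fn_of l \<in> S" by (elim allE[of _ "\<lambda>n. fn_of (u n)"] allE[of _ "fn_of l"]) simp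
    then show "l \<in> V" by (simp add: V_def)
  qed
qed

text \<open>The remainder of the projection is orthogonal to \<open>h\<close>, so the projection
  disappears from the quadratic form: the numerical range of the compression is that of the shift on
  unit vectors of \<open>V\<close>.\<close>

lemma H2_inner_orth_proj:
  assumes "closed V" "csubspace2 V" "h \<in> V"
  shows "H2_inner (orth_proj (fn_of ` V) (fn_of x)) (fn_of h) = cinner x h"
proof -
  obtain y where y: "y \<in> V" "\<forall>v\<in>V. cinner (x - y) v = 0"
    using cprojection_exists[OF assms(1,2)] by blast
  have "orth_proj (fn_of ` V) (fn_of x) = fn_of y"
    unfolding orth_proj_def
  proof (rule the_equality)
    show "fn_of y \<in> fn_of ` V \<and> (\<forall>s\<in>fn_of ` V. H2_inner (\<lambda>z. fn_of x z - fn_of y z) s = 0)"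
      using y by (simp flip: fn_of_diff)
    fix g assume "g \<in> fn_of ` V \<and> (\<forall>s\<in>fn_of ` V. H2_inner (\<lambda>z. fn_of x z - g z) s = 0)"
    then obtain w where w: "g = fn_of w" "w \<in> V" "\<forall>v\<in>V. cinner (x - w) v = 0"
      by (auto simp flip: fn_of_diff)
    have "cinner (y - w) (y - w) = cinner (x - w) (y - w) - cinner (x - y) (y - w)"
      by (simp add: cinner_diff_left)
    also have "\<dots> = 0" using y w csubspace2D(4)[OF assms(2)] by simp
    finally show "g = fn_of y" using w by (simp add: cinner_self_norm)
  qed
  moreover have "cinner x h = cinner y h" using y assms(3) by (simp add: cinner_diff_left)
  ultimately show ?thesis by simp
qed

section \<open>The model space\<close>

text \<open>State sequence of the unitary realization of \<open>theta1\<close>, rescaled to avoid square roots: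
  the outgoing states are \<open>u(i+1,j) = (c/a) G(i,j) + w(i,j)\<close> and \<open>v(i,j+1) = w(i,j) - G(i,j)/a\<close>
  with \<open>w = (u - c v)/a\<close>, and the output is \<open>u + v\<close>.\<close>

fun wseq :: "complex \<Rightarrow> complex \<Rightarrow> (nat \<times> nat \<Rightarrow> complex) \<Rightarrow> nat \<Rightarrow> nat \<Rightarrow> complex" where
  "wseq a c G 0 0 = 0"
| "wseq a c G (Suc i) 0 = (c / a * G (i, 0) + wseq a c G i 0) / a"
| "wseq a c G 0 (Suc j) = - c * (wseq a c G 0 j - G (0, j) / a) / a"
| "wseq a c G (Suc i) (Suc j) =
     (c / a * G (i, Suc j) + wseq a c G i (Suc j) - c * (wseq a c G (Suc i) j - G (Suc i, j) / a)) / a"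

definition useq where
  "useq a c G = rsh1 (\<lambda>k. c / a * G k + wseq a c G (fst k) (snd k))"
definition vseq where
  "vseq a c G = rsh2 (\<lambda>k. wseq a c G (fst k) (snd k) - G k / a)"

lemma wseq_eq: "wseq a c G i j = (useq a c G (i, j) - c * vseq a c G (i, j)) / a"
  by (cases i; cases j) (simp_all add: useq_def vseq_def)

lemma sum_telescope_prod:
  fixes f :: "nat \<times> nat \<Rightarrow> real"
  shows "(\<Sum>k\<in>{..<M} \<times> {..<N}. f (suc1 k) - f k) = (\<Sum>j<N. f (M, j) - f (0, j))"
    "(\<Sum>k\<in>{..<M} \<times> {..<N}. f (suc2 k) - f k) = (\<Sum>i<M. f (i, N) - f (i, 0))"
proof -
  have "(\<Sum>k\<in>{..<M} \<times> {..<N}. f (suc1 k) - f k) = (\<Sum>i<M. \<Sum>j<N. f (Suc i, j) - f (i, j))"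
    by (simp add: sum.cartesian_product suc1_def case_prod_unfold)
  also have "\<dots> = (\<Sum>j<N. \<Sum>i<M. f (Suc i, j) - f (i, j))" by (rule sum.swap)
  also have "\<dots> = (\<Sum>j<N. f (M, j) - f (0, j))" by (simp add: sum_lessThan_telescope[of "\<lambda>i. f (i, _)"])
  finally show "(\<Sum>k\<in>{..<M} \<times> {..<N}. f (suc1 k) - f k) = (\<Sum>j<N. f (M, j) - f (0, j))" .
  have "(\<Sum>k\<in>{..<M} \<times> {..<N}. f (suc2 k) - f k) = (\<Sum>i<M. \<Sum>j<N. f (i, Suc j) - f (i, j))"
    by (simp add: sum.cartesian_product suc2_def case_prod_unfold)
  also have "\<dots> = (\<Sum>i<M. f (i, N) - f (i, 0))" by (simp add: sum_lessThan_telescope[of "\<lambda>j. f (_, j)"])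
  finally show "(\<Sum>k\<in>{..<M} \<times> {..<N}. f (suc2 k) - f k) = (\<Sum>i<M. f (i, N) - f (i, 0))" .
qed

definition Pop :: "real \<Rightarrow> real \<Rightarrow> coeffs \<Rightarrow> coeffs" where
  "Pop a c y = of_real a *\<^sub>C y - sh1 y + of_real c *\<^sub>C sh2 y"
definition Ptop :: "real \<Rightarrow> real \<Rightarrow> coeffs \<Rightarrow> coeffs" where
  "Ptop a c y = of_real a *\<^sub>C sh1 (sh2 y) - sh2 y + of_real c *\<^sub>C sh1 y"
text \<open>This is the adjoint of \<open>Ptop\<close>, and at the same time its entry (i, j) is the
  coefficient of index (i + 1, j + 1) of \<open>p_poly\<close> times \<open>x\<close>. The
  coincidence turns orthogonality to multiples of \<open>p_tilde\<close> into vanishing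
  coefficients.\<close>

definition Qop :: "real \<Rightarrow> real \<Rightarrow> coeffs \<Rightarrow> coeffs" where
  "Qop a c x = of_real a *\<^sub>C bs1 (bs2 x) - bs2 x + of_real c *\<^sub>C bs1 x"

lemma cinner_Ptop: "cinner x (Ptop a c y) = cinner (Qop a c x) y"
  by (simp add: Ptop_def Qop_def cinner_simps cinner_sh_right shift_commute)

lemma fn_of_Pop: "fn_of (Pop a c y) z = p_poly a c z * fn_of y z"
  by (simp add: Pop_def fn_of_add fn_of_diff fn_of_scaleC fn_of_sh1 fn_of_sh2 Mz1_def Mz2_def p_poly_def
      algebra_simps)

lemma fn_of_Ptop: "fn_of (Ptop a c y) z = p_tilde a c z * fn_of y z"
  by (simp add: Ptop_def fn_of_add fn_of_diff fn_of_scaleC fn_of_sh1 fn_of_sh2 Mz1_def Mz2_def p_tilde_def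
      algebra_simps)

lemma bounded_linear_Pop:
  assumes "0 \<le> a" "0 \<le> c"
  shows "bounded_linear (Pop a c)"
proof (rule bounded_linear_intro[where K = "a + 1 + c"])
  fix x y :: "coeffs" and r :: real
  show "Pop a c (x + y) = Pop a c x + Pop a c y"
    by (simp add: Pop_def shift_linear scaleC_distrib)
  show "Pop a c (r *\<^sub>R x) = r *\<^sub>R Pop a c x"
    by (simp add: Pop_def shift_linear scaleC_distrib scaleR_eq_scaleC mult.commute)
  have "norm (Pop a c x) \<le> norm (of_real a *\<^sub>C x) + norm (sh1 x) + norm (of_real c *\<^sub>C sh2 x)"
    unfolding Pop_def by norm
  then show "norm (Pop a c x) \<le> norm x * (a + 1 + c)" using assms by (simp add: algebra_simps)
qed

lemma Pop_linear: "Pop a c (x + y) = Pop a c x + Pop a c y" "Pop a c (s *\<^sub>C x) = s *\<^sub>C Pop a c x"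
  by (simp_all add: Pop_def shift_linear scaleC_distrib mult.commute)

context
  fixes a c :: real
  assumes c_pos: "0 < c" and a_eq: "a = 1 + c"
begin

lemma a_pos: "0 < a" using c_pos a_eq by simp

section \<open>Multiplication by \<open>theta1\<close> as a contraction\<close>

lemma p_poly_nonzero:
  assumes "z \<in> bidisk" shows "p_poly a c z \<noteq> 0"
proof
  assume "p_poly a c z = 0"
  then have "of_real a = fst z - of_real c * snd z" by (simp add: p_poly_def algebra_simps)
  then have "a = cmod (fst z - of_real c * snd z)" using a_pos by (metis abs_of_pos norm_of_real)
  also have "\<dots> \<le> cmod (fst z) + c * cmod (snd z)"
    using norm_triangle_ineq4[of "fst z" "of_real c * snd z"] c_pos by (simp add: norm_mult)
  also have "\<dots> < 1 + c * 1"
    using assms c_pos by (intro add_less_le_mono mult_left_mono) (auto simp: bidisk_def)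
  finally show False using a_eq by simp
qed

text \<open>One step of the realization is isometric once the two states are weighted by a/c and a,
  the price of rescaling them. The terms balance because a = 1 + c.\<close>

lemma energy_identity:
  fixes g u v :: complex
  defines "w \<equiv> (u - of_real c * v) / of_real a"
  shows "(cmod (u + v))\<^sup>2 + a / c * (cmod (of_real c / of_real a * g + w))\<^sup>2 + a * (cmod (w - g / of_real a))\<^sup>2
    = (cmod g)\<^sup>2 + a / c * (cmod u)\<^sup>2 + a * (cmod v)\<^sup>2"
proof -
  \<comment> \<open>Writing g = a g' and u = a w + c v leaves a polynomial identity after
    multiplication by c.\<close>
  define g' where "g' = g / of_real a"
  have g: "g = of_real a * g'" using a_pos by (simp add: g'_def)
  have u: "u = of_real a * w + of_real c * v" using a_pos by (simp add: w_def)
  have 1: "of_real c / of_real a * g + w = of_real c * g' + w" by (simp add: g'_def)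
  have "c * ((cmod (u + v))\<^sup>2 + a / c * (cmod (of_real c * g' + w))\<^sup>2 + a * (cmod (w - g'))\<^sup>2)
    = c * ((cmod g)\<^sup>2 + a / c * (cmod u)\<^sup>2 + a * (cmod v)\<^sup>2)"
    unfolding g u cmod_power2 a_eq using c_pos
    by (simp add: distrib_left) (simp add: power2_eq_square algebra_simps)
  then show ?thesis using c_pos unfolding 1 by (simp add: g'_def)
qed

text \<open>Feed the coefficients of \<open>G\<close> into the realization. The energy identity
  telescopes over rectangles and bounds the output by \<open>norm G\<close>; read as power series,
  the recursions let the states be eliminated, which leaves the quotient
  \<open>p_tilde / p_poly\<close>.\<close>

lemma theta1_multiplier_contraction:
  "\<exists>F. norm F \<le> norm G \<and> (\<forall>z\<in>bidisk. p_poly a c z * fn_of F z = p_tilde a c z * fn_of G z)"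
proof -
  define g where "g = coord G"
  define u where "u = useq (of_real a) (of_real c) g"
  define v where "v = vseq (of_real a) (of_real c) g"
  define w where "w k = wseq (of_real a) (of_real c) g (fst k) (snd k)" for k
  have u: "u = rsh1 (\<lambda>k. of_real c / of_real a * g k + w k)" by (simp add: u_def useq_def w_def)
  have v: "v = rsh2 (\<lambda>k. w k - g k / of_real a)" by (simp add: v_def vseq_def w_def)
  have w: "w k = (u k - of_real c * v k) / of_real a" for k
    by (simp add: w_def wseq_eq u_def v_def)
  have loc: "(cmod (u k + v k))\<^sup>2 = (cmod (g k))\<^sup>2
      - a / c * ((cmod (u (suc1 k)))\<^sup>2 - (cmod (u k))\<^sup>2) - a * ((cmod (v (suc2 k)))\<^sup>2 - (cmod (v k))\<^sup>2)" for k
  proof -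
    have us: "u (suc1 k) = of_real c / of_real a * g k + w k" "v (suc2 k) = w k - g k / of_real a"
      by (simp_all add: u v)
    show ?thesis using energy_identity[of "u k" "v k" "g k"] unfolding us w[symmetric] by (simp add: right_diff_distrib)
  qed
  \<comment> \<open>The incoming states on the edges i = 0 and j = 0 are zero, so the telescoped
    sums leave only nonnegative outgoing terms.\<close>
  have rect: "(\<Sum>k\<in>{..<M} \<times> {..<N}. (cmod (u k + v k))\<^sup>2) + a / c * (\<Sum>j<N. (cmod (u (M, j)))\<^sup>2)
      + a * (\<Sum>i<M. (cmod (v (i, N)))\<^sup>2) = (\<Sum>k\<in>{..<M} \<times> {..<N}. (cmod (g k))\<^sup>2)" for M N
  proof -
    have "(\<Sum>k\<in>{..<M} \<times> {..<N}. (cmod (u k + v k))\<^sup>2) = (\<Sum>k\<in>{..<M} \<times> {..<N}. (cmod (g k))\<^sup>2)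
      - a / c * (\<Sum>k\<in>{..<M} \<times> {..<N}. (cmod (u (suc1 k)))\<^sup>2 - (cmod (u k))\<^sup>2)
      - a * (\<Sum>k\<in>{..<M} \<times> {..<N}. (cmod (v (suc2 k)))\<^sup>2 - (cmod (v k))\<^sup>2)"
      unfolding loc sum_subtractf sum_distrib_left by (simp add: sum_subtractf sum_distrib_left algebra_simps)
    also have "\<dots> = (\<Sum>k\<in>{..<M} \<times> {..<N}. (cmod (g k))\<^sup>2)
      - a / c * (\<Sum>j<N. (cmod (u (M, j)))\<^sup>2) - a * (\<Sum>i<M. (cmod (v (i, N)))\<^sup>2)"
      unfolding sum_telescope_prod[of "\<lambda>k. (cmod (u k))\<^sup>2"] sum_telescope_prod[of "\<lambda>k. (cmod (v k))\<^sup>2"]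
      by (simp add: u v)
    finally show ?thesis by simp
  qed
  have g_le: "(\<Sum>k\<in>A. (cmod (g k))\<^sup>2) \<le> (norm G)\<^sup>2" if "finite A" for A
    unfolding norm_sq_ell2 g_def by (rule finite_sum_le_infsum) (auto simp: sq_summable_coord that)
  have ac: "0 < a / c" using a_pos c_pos by simp
  have pos: "0 \<le> (\<Sum>j<N. (cmod (u (M, j)))\<^sup>2)" "0 \<le> (\<Sum>i<M. (cmod (v (i, N)))\<^sup>2)"
    "0 \<le> (\<Sum>k\<in>{..<M} \<times> {..<N}. (cmod (u k + v k))\<^sup>2)" for M N
    by (auto intro: sum_nonneg)
  have F_le: "(\<Sum>k\<in>{..<M} \<times> {..<N}. (cmod (u k + v k))\<^sup>2) \<le> (norm G)\<^sup>2" for M N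
    using rect[of M N] g_le[of "{..<M} \<times> {..<N}"] mult_nonneg_nonneg[OF less_imp_le[OF ac] pos(1)[of M N]]
      mult_nonneg_nonneg[OF less_imp_le[OF a_pos] pos(2)[of N M]] by simp
  obtain F where F: "coord F = (\<lambda>k. u k + v k)" "norm F \<le> norm G"
  proof (rule ell2_of_bounded_sums)
    fix A :: "(nat \<times> nat) set" assume "finite A"
    then obtain M where "A \<subseteq> {..<M} \<times> {..<M}"
    proof -
      have "finite (fst ` A \<union> snd ` A)" using \<open>finite A\<close> by simp
      then obtain M where "\<forall>n\<in>fst ` A \<union> snd ` A. n < M" using finite_nat_bounded by (metis lessThan_iff subset_iff)
      then have "A \<subseteq> {..<M} \<times> {..<M}" by force
      then show ?thesis by (rule that)
    qed
    then have "(\<Sum>k\<in>A. (cmod (u k + v k))\<^sup>2) \<le> (\<Sum>k\<in>{..<M} \<times> {..<M}. (cmod (u k + v k))\<^sup>2)"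
      by (intro sum_mono2) auto
    also have "\<dots> \<le> (norm G)\<^sup>2" by (rule F_le)
    finally show "(\<Sum>k\<in>A. (cmod (u k + v k))\<^sup>2) \<le> (norm G)\<^sup>2" .
  qed auto
  \<comment> \<open>The outgoing terms of \<open>rect\<close> bound \<open>u\<close> pointwise;
    \<open>v\<close> is then the output minus \<open>u\<close>.\<close>
  have u_bd: "cmod (u k) \<le> sqrt (c / a) * norm G" for k
  proof (cases k)
    case (Pair M j)
    have "a / c * (cmod (u (M, j)))\<^sup>2 \<le> a / c * (\<Sum>j<Suc j. (cmod (u (M, j)))\<^sup>2)"
      using ac by (intro mult_left_mono) (auto intro: sum_nonneg)
    also have "\<dots> \<le> (norm G)\<^sup>2"
      using rect[of M "Suc j"] g_le[of "{..<M} \<times> {..<Suc j}"] pos(3)[of M "Suc j"]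
        mult_nonneg_nonneg[OF less_imp_le[OF a_pos] pos(2)[of "Suc j" M]] by simp
    finally have "(cmod (u (M, j)))\<^sup>2 \<le> (sqrt (c / a) * norm G)\<^sup>2"
      using a_pos c_pos by (simp add: power_mult_distrib field_simps)
    then have "cmod (u (M, j)) \<le> sqrt (c / a) * norm G"
      by (rule power2_le_imp_le) (use a_pos c_pos in simp)
    then show ?thesis by (simp add: Pair)
  qed
  have v_bd: "cmod (v k) \<le> norm G + sqrt (c / a) * norm G" for k
    using norm_triangle_ineq4[of "u k + v k" "u k"] norm_coord_le[of F k] F u_bd[of k] by simp
  have w_bd: "\<exists>B. \<forall>k. cmod (w k) \<le> B"
  proof (intro exI allI)
    fix k
    have "cmod (w k) \<le> (cmod (u k) + c * cmod (v k)) / a"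
      using norm_triangle_ineq4[of "u k" "of_real c * v k"] a_pos c_pos
      by (simp add: w norm_divide norm_mult divide_right_mono)
    also have "\<dots> \<le> (sqrt (c / a) * norm G + c * (norm G + sqrt (c / a) * norm G)) / a"
      using u_bd[of k] v_bd[of k] a_pos c_pos by (intro divide_right_mono add_mono mult_left_mono) auto
    finally show "cmod (w k) \<le> (sqrt (c / a) * norm G + c * (norm G + sqrt (c / a) * norm G)) / a" .
  qed
  then obtain B where B: "\<And>k. cmod (w k) \<le> B" by blast
  have g_bd: "cmod (g k) \<le> norm G" for k by (simp add: g_def norm_coord_le)
  have "p_poly a c z * fn_of F z = p_tilde a c z * fn_of G z" if z: "z \<in> bidisk" for z
  proof -
    define g' where "g' = pval g z / of_real a"
    have gz: "pval g z = of_real a * g'" using a_pos by (simp add: g'_def)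
    have cg: "cmod (s * g k) \<le> cmod s * norm G" for s k by (simp add: norm_mult mult_left_mono g_bd)
    have cv: "cmod (s * v k) \<le> cmod s * (norm G + sqrt (c / a) * norm G)" for s k
      by (simp add: norm_mult mult_left_mono v_bd)
    have Fz: "fn_of F z = pval u z + pval v z"
      using z pval_add[of u _ v _ z, OF u_bd v_bd z] by (simp add: fn_of_def F)
    have cgw: "cmod (s * g k + w k) \<le> cmod s * norm G + B" for s k
      by (rule norm_triangle_le[OF add_mono[OF cg B]])
    have "pval (\<lambda>k. of_real c / of_real a * g k + w k) z = of_real c / of_real a * pval g z + pval w z"
      unfolding pval_add[of "\<lambda>k. of_real c / of_real a * g k" _ w, OF cg B z] pval_cmult[of g, OF g_bd z] ..
    then have uz: "pval u z = fst z * (of_real c * g' + pval w z)"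
      unfolding u pval_rsh(1)[of "\<lambda>k. of_real c / of_real a * g k + w k", OF cgw z] by (simp add: g'_def)
    have "pval (\<lambda>k. (- 1 / of_real a) * g k + w k) z = (- 1 / of_real a) * pval g z + pval w z"
      unfolding pval_add[of "\<lambda>k. (- 1 / of_real a) * g k" _ w, OF cg B z] pval_cmult[of g, OF g_bd z] ..
    moreover have v': "v = rsh2 (\<lambda>k. (- 1 / of_real a) * g k + w k)" by (simp add: v)
    ultimately have vz: "pval v z = snd z * (pval w z - g')"
      using pval_rsh(2)[of "\<lambda>k. (- 1 / of_real a) * g k + w k", OF cgw z]
      by (simp add: g'_def)
    have "pval u z = pval (\<lambda>k. of_real a * w k + of_real c * v k) z"
      using a_pos by (simp add: w)
    also have "\<dots> = of_real a * pval w z + of_real c * pval v z"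
    proof -
      have "cmod (of_real a * w k) \<le> a * B" for k using a_pos B[of k] by (simp add: norm_mult mult_left_mono)
      from pval_add[of "\<lambda>k. of_real a * w k" _ "\<lambda>k. of_real c * v k", OF this cv z]
      show ?thesis using pval_cmult[of w, OF B z] pval_cmult[of v, OF v_bd z] by simp
    qed
    finally have wz: "of_real a * pval w z = pval u z - of_real c * pval v z" by simp
    \<comment> \<open>The formulas for \<open>u\<close> and \<open>v\<close>, inserted into a w = u
      - c v, solve for the state.\<close>
    then have pw: "p_poly a c z * pval w z = of_real c * (fst z + snd z) * g'"
      unfolding uz vz by (simp add: p_poly_def algebra_simps)
    have "p_poly a c z * fn_of F z
        = p_poly a c z * (of_real c * fst z - snd z) * g' + (fst z + snd z) * (p_poly a c z * pval w z)"
      unfolding Fz uz vz by (simp add: algebra_simps)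
    also have "\<dots> = p_tilde a c z * (of_real a * g')"
      unfolding pw by (simp add: p_poly_def p_tilde_def a_eq algebra_simps)
    also have "of_real a * g' = fn_of G z" using z gz by (simp add: fn_of_def g_def)
    finally show ?thesis .
  qed
  then show ?thesis using F by blast
qed

text \<open>Multiplication by \<open>theta1\<close>. The choice is forced because
  \<open>p_poly\<close> has no zero in the bidisk, and linearity can be read off from function
  values.\<close>

definition Tm :: "coeffs \<Rightarrow> coeffs" where
  "Tm G = (SOME F. norm F \<le> norm G \<and> (\<forall>z\<in>bidisk. p_poly a c z * fn_of F z = p_tilde a c z * fn_of G z))"

lemma norm_Tm: "norm (Tm G) \<le> norm G"
  and p_Tm: "z \<in> bidisk \<Longrightarrow> p_poly a c z * fn_of (Tm G) z = p_tilde a c z * fn_of G z"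
  unfolding Tm_def using someI_ex[OF theta1_multiplier_contraction[of G]] by auto

lemma fn_of_eqI:
  assumes "\<And>z. z \<in> bidisk \<Longrightarrow> fn_of x z = fn_of y z" shows "x = y"
  using assms fn_of_inject[of x y] by (auto simp: fn_of_def fun_eq_iff)

lemma fn_of_Tm: "z \<in> bidisk \<Longrightarrow> fn_of (Tm G) z = theta1 a c z * fn_of G z"
  using p_Tm[of z G] p_poly_nonzero[of z] by (simp add: theta1_def field_simps)

lemma mult_Theta_fn_of: "mult_H2 (Theta a c) (fn_of G) = fn_of (Tm (Tm G))"
proof
  show "mult_H2 (Theta a c) (fn_of G) z = fn_of (Tm (Tm G)) z" for z
    by (cases "z \<in> bidisk")
       (simp_all add: mult_H2_def fn_of_Tm Theta_def power2_eq_square, simp add: fn_of_def)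
qed

lemma Tm_linear: "Tm (x + y) = Tm x + Tm y" "Tm (s *\<^sub>C x) = s *\<^sub>C Tm x"
  by (auto intro!: fn_of_eqI simp: fn_of_Tm fn_of_add fn_of_scaleC algebra_simps)

text \<open>On multiples of \<open>p_poly\<close> squared, \<open>theta1\<close> squared acts
  without denominators.\<close>

lemma Tm_Pop: "Tm (Tm (Pop a c (Pop a c y))) = Ptop a c (Ptop a c y)"
  by (rule fn_of_eqI) (use p_poly_nonzero in \<open>simp add: fn_of_Tm fn_of_Pop fn_of_Ptop theta1_def\<close>)

text \<open>In other words, \<open>p_poly\<close> is cyclic. A vector \<open>\<psi>\<close> orthogonal to its multiples satisfies
  \<open>a \<psi> = bs1 \<psi> - c bs2 \<psi>\<close>, and comparing norms forces \<open>norm (bs1 \<psi>) = norm \<psi>\<close>.\<close>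
lemma closed_subspace_Pop_UNIV:
  assumes "closed V" "csubspace2 V" "\<And>y. Pop a c y \<in> V"
  shows "x \<in> V"
proof -
  obtain y where y: "y \<in> V" "\<forall>v\<in>V. cinner (x - y) v = 0"
    using cprojection_exists[OF assms(1,2)] by blast
  define \<psi> where "\<psi> = x - y"
  have "cinner (of_real a *\<^sub>C \<psi> - bs1 \<psi> + of_real c *\<^sub>C bs2 \<psi>) v = cinner \<psi> (Pop a c v)" for v
    by (simp add: Pop_def cinner_simps cinner_sh_right)
  also have "\<dots>v = 0" for v using y assms(3) by (simp add: \<psi>_def)
  finally have "cinner (of_real a *\<^sub>C \<psi> - bs1 \<psi> + of_real c *\<^sub>C bs2 \<psi>) v = 0" for v .
  from this[of "of_real a *\<^sub>C \<psi> - bs1 \<psi> + of_real c *\<^sub>C bs2 \<psi>"]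
  have eq0: "of_real a *\<^sub>C \<psi> - bs1 \<psi> + of_real c *\<^sub>C bs2 \<psi> = 0" by (simp add: cinner_self_norm)
  then have eq: "of_real a *\<^sub>C \<psi> = bs1 \<psi> - of_real c *\<^sub>C bs2 \<psi>" by (simp add: algebra_simps eq_neg_iff_add_eq_0)
  have "a * norm \<psi> = norm (of_real a *\<^sub>C \<psi>)" using a_pos by simp
  also have "\<dots> \<le> norm (bs1 \<psi>) + norm (of_real c *\<^sub>C bs2 \<psi>)" unfolding eq by (rule norm_triangle_ineq4)
  also have "\<dots> \<le> norm (bs1 \<psi>) + c * norm \<psi>" using c_pos norm_bs_le(2)[of \<psi>] by simp
  finally have "norm \<psi> \<le> norm (bs1 \<psi>)" using a_eq by (simp add: algebra_simps)
  note row0 = norm_bs1_eq_imp_row0[OF this]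
  \<comment> \<open>Row 0 vanishes, and \<open>eq0\<close> expresses row i + 1 through row
    i.\<close>
  have "coord \<psi> (i, j) = 0" for i j
  proof (induction i arbitrary: j)
    case (Suc i)
    have "coord (of_real a *\<^sub>C \<psi> - bs1 \<psi> + of_real c *\<^sub>C bs2 \<psi>) (i, j) = 0" by (simp only: eq0 coord_simps)
    then show ?case by (simp add: Suc)
  qed (rule row0)
  then have "\<psi> = 0" by (intro ell2_prod_eqI) simp
  then show ?thesis using y by (simp add: \<psi>_def)
qed

text \<open>\<open>Theta\<close> takes multiples of \<open>p_poly\<close> squared to multiples of
  \<open>p_tilde\<close> squared, and orthogonality to the latter is the equation for
  \<open>Qop\<close>. Density of the former, together with the contractivity of \<open>Tm\<close>,
  extends the orthogonality to the whole range of \<open>Theta\<close>.\<close>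

lemma model_space_iff: "fn_of x \<in> model_space (Theta a c) \<longleftrightarrow> Qop a c (Qop a c x) = 0"
proof
  assume "fn_of x \<in> model_space (Theta a c)"
  then have orth: "cinner x (Tm (Tm G)) = 0" for G
    using H2_inner_fn_of[of x "Tm (Tm G)"]
    by (auto simp: model_space_def H2_eq_range mult_Theta_fn_of)
  have "cinner (Qop a c (Qop a c x)) y = 0" for y
    using orth[of "Pop a c (Pop a c y)"] by (simp add: Tm_Pop cinner_Ptop)
  from this[of "Qop a c (Qop a c x)"] show "Qop a c (Qop a c x) = 0" by (simp add: cinner_self_norm)
next
  assume Q: "Qop a c (Qop a c x) = 0"
  define L where "L = {y. cinner x (Tm (Tm y)) = 0}"
  have sub: "csubspace2 L"
    using Tm_linear(2)[of 0 0] by (auto simp: csubspace2_def L_def Tm_linear cinner_simps)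
  have "bounded_linear (\<lambda>y. cinner x (Tm (Tm y)))"
  proof (rule bounded_linear_intro[where K = "norm x"])
    fix y y' and r :: real
    show "cinner x (Tm (Tm (y + y'))) = cinner x (Tm (Tm y)) + cinner x (Tm (Tm y'))"
      by (simp add: Tm_linear cinner_simps)
    show "cinner x (Tm (Tm (r *\<^sub>R y))) = r *\<^sub>R cinner x (Tm (Tm y))"
      by (simp add: Tm_linear cinner_simps scaleR_eq_scaleC scaleR_conv_of_real)
    have "cmod (cinner x (Tm (Tm y))) \<le> norm x * norm (Tm (Tm y))" by (rule cmod_cinner_le)
    also have "\<dots> \<le> norm x * norm y"
      by (intro mult_left_mono order_trans[OF norm_Tm norm_Tm]) simp
    finally show "norm (cinner x (Tm (Tm y))) \<le> norm y * norm x" by (simp add: mult.commute)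
  qed
  then have cl: "closed L"
    unfolding L_def
    by (intro closed_Collect_eq continuous_intros bounded_linear.continuous_on[of "\<lambda>y. cinner x (Tm (Tm y))"])
       auto
  have PP: "Pop a c (Pop a c y) \<in> L" for y by (simp add: L_def Tm_Pop cinner_Ptop Q)
  \<comment> \<open>Cyclicity enters twice: here for the preimage of \<open>L\<close> under
    \<open>Pop\<close>, which strips one factor, and then for \<open>L\<close> itself.\<close>
  have "Pop a c y \<in> L" for y
  proof -
    have "y \<in> Pop a c -` L"
    proof (rule closed_subspace_Pop_UNIV)
      have "continuous_on UNIV (Pop a c)"
        using bounded_linear_Pop[of a c] a_pos c_pos by (simp add: linear_continuous_on)
      then show "closed (Pop a c -` L)" using cl by (simp add: continuous_on_closed_vimage)
      show "csubspace2 (Pop a c -` L)"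
        using sub Pop_linear(2)[of a c 0 0] by (auto simp: csubspace2_def Pop_linear)
    qed (use PP in auto)
    then show ?thesis by simp
  qed
  then have "y \<in> L" for y using closed_subspace_Pop_UNIV[OF cl sub] by blast
  then show "fn_of x \<in> model_space (Theta a c)"
    by (auto simp: model_space_def H2_eq_range mult_Theta_fn_of L_def)
qed

end

section \<open>Parseval's identity and fibres over the circle\<close>

lemma integral_cis_int:
  fixes m :: int
  shows "((\<lambda>t. cis (of_int m * t)) has_integral (if m = 0 then of_real (2 * pi) else 0)) {s..s + 2 * pi}"
proof (cases "m = 0")
  case True
  then show ?thesis using has_integral_const_real[of "1 :: complex" s "s + 2 * pi"] by (simp add: scaleR_conv_of_real)
next
  case False
  have "((\<lambda>t. cis (of_int m * t)) has_integral
      (cis (of_int m * (s + 2 * pi)) / (\<i> * of_int m) - cis (of_int m * s) / (\<i> * of_int m))) {s..s + 2 * pi}"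
  proof (rule fundamental_theorem_of_calculus)
    show "((\<lambda>t. cis (of_int m * t) / (\<i> * of_int m)) has_vector_derivative cis (of_int m * t)) (at t within {s..s + 2 * pi})"
      if "t \<in> {s..s + 2 * pi}" for t
    proof -
      have "((\<lambda>t. exp (\<i> * of_int m * t) / (\<i> * of_int m)) has_field_derivative exp (\<i> * of_int m * of_real t))
          (at (of_real t))"
        using False by (auto intro!: derivative_eq_intros simp: field_simps)
      from has_vector_derivative_real_field[OF this]
      show ?thesis by (simp add: cis_conv_exp mult_ac)
    qed
  qed simp
  moreover have "cis (of_int m * (s + 2 * pi)) = cis (of_int m * s)"
    using cis_multiple_2pi[of "of_int m"] by (simp add: distrib_left cis_mult[symmetric] mult_ac)
  ultimately show ?thesis using False by simp
qed

lemma parseval_finite: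
  "((\<lambda>t. (cmod (\<Sum>j<n. c j * cis t ^ j))\<^sup>2) has_integral (2 * pi * (\<Sum>j<n. (cmod (c j))\<^sup>2))) {s..s + 2 * pi}"
proof -
  have "((\<lambda>t. \<Sum>j<n. \<Sum>k<n. c j * cnj (c k) * cis (of_int (int j - int k) * t)) has_integral
      (\<Sum>j<n. \<Sum>k<n. c j * cnj (c k) * (if int j - int k = 0 then of_real (2 * pi) else 0))) {s..s + 2 * pi}"
    by (intro has_integral_sum has_integral_mult_right integral_cis_int) auto
  also have "(\<lambda>t. \<Sum>j<n. \<Sum>k<n. c j * cnj (c k) * cis (of_int (int j - int k) * t))
      = (\<lambda>t. of_real ((cmod (\<Sum>j<n. c j * cis t ^ j))\<^sup>2))"
  proof -
    have "cis (of_int (int j - int k) * t) = cis t ^ j * cnj (cis t ^ k)" for j k t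
    proof -
      have "cis t ^ j * cnj (cis t ^ k) = cis (real j * t + - (real k * t))"
        by (simp only: Complex.DeMoivre cis_cnj cis_mult)
      moreover have "real j * t + - (real k * t) = of_int (int j - int k) * t" by (simp add: left_diff_distrib)
      ultimately show ?thesis by (simp only:)
    qed
    then show ?thesis
      unfolding complex_norm_square cnj_sum sum_product by (intro ext sum.cong refl) (simp add: mult_ac)
  qed
  also have "(\<Sum>j<n. \<Sum>k<n. c j * cnj (c k) * (if int j - int k = 0 then of_real (2 * pi) else 0))
      = of_real (2 * pi * (\<Sum>j<n. (cmod (c j))\<^sup>2))"
  proof -
    have "(\<Sum>j<n. \<Sum>k<n. c j * cnj (c k) * (if int j - int k = 0 then of_real (2 * pi) else 0))
        = (\<Sum>j<n. c j * cnj (c j) * of_real (2 * pi))"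
      by (intro sum.cong refl) (simp add: if_distrib[of "\<lambda>x. _ * x"] sum.delta cong: if_cong)
    then show ?thesis unfolding of_real_mult of_real_sum complex_norm_square sum_distrib_left
      by (simp add: mult_ac)
  qed
  finally have "((\<lambda>t. complex_of_real ((cmod (\<Sum>j<n. c j * cis t ^ j))\<^sup>2)) has_integral
      of_real (2 * pi * (\<Sum>j<n. (cmod (c j))\<^sup>2))) {s..s + 2 * pi}" .
  from has_integral_Re[OF this] show ?thesis unfolding Re_complex_of_real .
qed

text \<open>Absolute summability bounds the partial sums uniformly, so dominated convergence extends
  the finite identity. Dilated rows and the rows of the test functions have this property.\<close>

lemma parseval:
  fixes c :: "nat \<Rightarrow> complex"
  assumes "summable (\<lambda>j. cmod (c j))"
  shows "(\<integral>\<^sup>+t. ennreal (indicator {s..s + 2 * pi} t * (cmod (\<Sum>j. c j * cis t ^ j))\<^sup>2) \<partial>lborel)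
      = ennreal (2 * pi) * (\<Sum>j. ennreal ((cmod (c j))\<^sup>2))"
proof -
  define M where "M = (\<Sum>j. cmod (c j))"
  define f where "f n t = (\<Sum>j<n. c j * cis t ^ j)" for n t
  have sm: "summable (\<lambda>j. norm (c j * cis t ^ j))" for t using assms by (simp add: norm_mult norm_power)
  have lim: "(\<lambda>n. (cmod (f n t))\<^sup>2) \<longlonglongrightarrow> (cmod (\<Sum>j. c j * cis t ^ j))\<^sup>2" for t
    unfolding f_def by (intro tendsto_intros summable_LIMSEQ summable_norm_cancel[OF sm])
  have bd: "norm ((cmod (f n t))\<^sup>2) \<le> M\<^sup>2" for n t
  proof -
    have "cmod (f n t) \<le> (\<Sum>j<n. cmod (c j))"
      unfolding f_def by (rule order_trans[OF norm_sum]) (simp add: norm_mult norm_power)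
    also have "\<dots> \<le> M" unfolding M_def by (rule sum_le_suminf[OF assms]) auto
    finally show ?thesis by (simp add: power_mono)
  qed
  have int: "(\<lambda>t. (cmod (f n t))\<^sup>2) integrable_on {s..s + 2 * pi}" for n
    unfolding f_def by (rule has_integral_integrable[OF parseval_finite])
  note dc = dominated_convergence[of "\<lambda>n t. (cmod (f n t))\<^sup>2" "{s..s + 2 * pi}" "\<lambda>_. M\<^sup>2"
      "\<lambda>t. (cmod (\<Sum>j. c j * cis t ^ j))\<^sup>2", OF int integrable_const_ivl bd lim]
  have sq: "summable (\<lambda>j. (cmod (c j))\<^sup>2)"
  proof -
    have "eventually (\<lambda>j. cmod (c j) < 1) sequentially"
      using summable_LIMSEQ_zero[OF assms] by (rule order_tendstoD) simp
    then have "eventually (\<lambda>j. norm ((cmod (c j))\<^sup>2) \<le> cmod (c j)) sequentially"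
      by eventually_elim (simp add: power2_eq_square mult_left_le)
    then show ?thesis by (rule summable_comparison_test_ev[OF _ assms])
  qed
  have "(\<lambda>n. 2 * pi * (\<Sum>j<n. (cmod (c j))\<^sup>2)) \<longlonglongrightarrow> integral {s..s + 2 * pi} (\<lambda>t. (cmod (\<Sum>j. c j * cis t ^ j))\<^sup>2)"
    using dc(2) by (simp add: integral_unique[OF parseval_finite] f_def)
  moreover have "(\<lambda>n. 2 * pi * (\<Sum>j<n. (cmod (c j))\<^sup>2)) \<longlonglongrightarrow> 2 * pi * (\<Sum>j. (cmod (c j))\<^sup>2)"
    by (intro tendsto_intros summable_LIMSEQ sq)
  ultimately have "integral {s..s + 2 * pi} (\<lambda>t. (cmod (\<Sum>j. c j * cis t ^ j))\<^sup>2) = 2 * pi * (\<Sum>j. (cmod (c j))\<^sup>2)"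
    using LIMSEQ_unique by blast
  then have "((\<lambda>t. (cmod (\<Sum>j. c j * cis t ^ j))\<^sup>2) has_integral 2 * pi * (\<Sum>j. (cmod (c j))\<^sup>2)) {s..s + 2 * pi}"
    using integrable_integral[OF dc(1)] by simp
  from nn_integral_has_integral_lebesgue[OF _ this]
  have "(\<integral>\<^sup>+t. ennreal (indicator {s..s + 2 * pi} t * (cmod (\<Sum>j. c j * cis t ^ j))\<^sup>2) \<partial>lborel)
      = ennreal (2 * pi * (\<Sum>j. (cmod (c j))\<^sup>2))" by simp
  also have "\<dots> = ennreal (2 * pi) * (\<Sum>j. ennreal ((cmod (c j))\<^sup>2))"
    using sq by (simp add: ennreal_mult' suminf_ennreal2)
  finally show ?thesis .
qed

section \<open>Fibres: power series in z1 over a fixed value of z2\<close>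

definition rowser :: "(nat \<times> nat \<Rightarrow> complex) \<Rightarrow> nat \<Rightarrow> complex \<Rightarrow> complex" where
  "rowser x n z = (\<Sum>j. x (n, j) * z ^ j)"

lemma cis_measurable [measurable]: "cis \<in> borel_measurable borel"
  by (intro borel_measurable_continuous_onI continuous_intros)

lemma rowser_measurable [measurable]: "(\<lambda>t. rowser x n (cis t)) \<in> borel_measurable borel"
  unfolding rowser_def by measurable

abbreviation fibre_sq :: "(nat \<times> nat \<Rightarrow> complex) \<Rightarrow> complex \<Rightarrow> ennreal" where
  "fibre_sq x z \<equiv> (\<Sum>n. ennreal ((cmod (rowser x n z))\<^sup>2))"

text \<open>The squared norm with values in \<open>ennreal\<close> makes sense before
  square-summability is known; \<open>phi_in_ell2\<close> proves the latter with it.\<close>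

definition e2 :: "(nat \<times> nat \<Rightarrow> complex) \<Rightarrow> ennreal" where
  "e2 x = (\<Sum>n. \<Sum>j. ennreal ((cmod (x (n, j)))\<^sup>2))"

lemma e2_coord: "e2 (coord x) = ennreal ((norm x)\<^sup>2)"
proof -
  define r where "r n = (\<Sum>\<^sub>\<infinity>j. (cmod (coord x (n, j)))\<^sup>2)" for n
  have all: "((\<lambda>k. (cmod (coord x k))\<^sup>2) has_sum (norm x)\<^sup>2) (UNIV \<times> UNIV)"
    unfolding norm_sq_ell2 using sq_summable_coord[of x UNIV] by simp
  have rows: "((\<lambda>j. (cmod (coord x (n, j)))\<^sup>2) has_sum r n) UNIV" for n
    unfolding r_def
    using summable_on_SigmaD1[of "\<lambda>n j. (cmod (coord x (n, j)))\<^sup>2" UNIV "\<lambda>_. UNIV" n] sq_summable_coord[of x UNIV]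
    by (simp add: case_prod_unfold)
  have "(r has_sum (norm x)\<^sup>2) UNIV" by (rule has_sum_Sigma'[OF all rows])
  then have s: "r sums (norm x)\<^sup>2" by (rule has_sum_imp_sums)
  have rs: "(\<lambda>j. (cmod (coord x (n, j)))\<^sup>2) sums r n" for n by (rule has_sum_imp_sums[OF rows])
  have "0 \<le> r n" for n unfolding r_def by (rule infsum_nonneg) simp
  then show ?thesis unfolding e2_def suminf_ennreal_eq[OF zero_le_power2 rs] by (rule suminf_ennreal_eq[OF _ s])
qed

lemma ell2_of_e2:
  assumes "e2 x < top"
  obtains y where "coord y = x"
proof -
  have fin: "(\<Sum>n. \<Sum>j. ennreal ((cmod (x (n, j)))\<^sup>2)) \<noteq> top"
    using assms unfolding e2_def by (rule less_imp_neq)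
  have rfin: "(\<Sum>j. ennreal ((cmod (x (n, j)))\<^sup>2)) \<noteq> top" for n
    using ennreal_suminf_lessD[OF assms[unfolded e2_def], of n] by (rule less_imp_neq)
  define r where "r n = (\<Sum>j. (cmod (x (n, j)))\<^sup>2)" for n
  have rs: "summable (\<lambda>j. (cmod (x (n, j)))\<^sup>2)" for n
    by (rule summable_suminf_not_top[OF _ rfin]) simp
  have r0: "0 \<le> r n" for n unfolding r_def by (rule suminf_nonneg[OF rs]) simp
  have "summable r"
    by (rule summable_suminf_not_top[OF r0])
       (use fin in \<open>simp add: r_def suminf_ennreal2[OF zero_le_power2 rs]\<close>)
  then have "r summable_on UNIV" using r0 by (intro summable_nonneg_imp_summable_on)
  moreover have "((\<lambda>j. (cmod (x (n, j)))\<^sup>2) has_sum r n) UNIV" for n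
    unfolding r_def using rs by (intro sums_nonneg_imp_has_sum) auto
  ultimately have "(\<lambda>k. (cmod (x k))\<^sup>2) summable_on Sigma UNIV (\<lambda>_. UNIV)"
    by (intro summable_on_SigmaI) auto
  then have "coord (Abs_ell2 x) = x" by (simp add: Abs_ell2_inverse)
  then show ?thesis by (rule that)
qed

text \<open>Exchanging sum and integral of nonnegative terms reduces this to \<open>parseval\<close>
  for each row. The starting point \<open>s\<close> is free so that the interval can be centred at a
  point of concentration.\<close>

lemma fibre_parseval:
  assumes "\<And>n. summable (\<lambda>j. cmod (x (n, j)))"
  shows "(\<integral>\<^sup>+t. fibre_sq x (cis t) * indicator {s..s + 2 * pi} t \<partial>lborel)
      = ennreal (2 * pi) * e2 x"
proof -
  have "(\<integral>\<^sup>+t. fibre_sq x (cis t) * indicator {s..s + 2 * pi} t \<partial>lborel)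
      = (\<integral>\<^sup>+t. (\<Sum>n. ennreal (indicator {s..s + 2 * pi} t * (cmod (rowser x n (cis t)))\<^sup>2)) \<partial>lborel)"
  proof (rule nn_integral_cong)
    show "fibre_sq x (cis t) * indicator {s..s + 2 * pi} t
        = (\<Sum>n. ennreal (indicator {s..s + 2 * pi} t * (cmod (rowser x n (cis t)))\<^sup>2))" for t
      by (cases "t \<in> {s..s + 2 * pi}") (simp_all only: simp_thms indicator_simps mult_1 mult_1_right mult_zero_left mult_zero_right ennreal_0 suminf_zero)
  qed
  also have "\<dots> = (\<Sum>n. \<integral>\<^sup>+t. ennreal (indicator {s..s + 2 * pi} t * (cmod (rowser x n (cis t)))\<^sup>2) \<partial>lborel)"
    by (rule nn_integral_suminf) (intro measurable_compose[OF _ measurable_ennreal] borel_measurable_times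
      borel_measurable_power borel_measurable_norm; measurable)
  also have "\<dots> = (\<Sum>n. ennreal (2 * pi) * (\<Sum>j. ennreal ((cmod (x (n, j)))\<^sup>2)))"
    unfolding rowser_def parseval[OF assms] ..
  also have "\<dots> = ennreal (2 * pi) * e2 x" unfolding e2_def by (rule ennreal_suminf_cmult)
  finally show ?thesis .
qed

section \<open>Functions with fibres in a two-dimensional model space\<close>

lemma sq_geometric_sums:
  fixes q :: real
  assumes "\<bar>q\<bar> < 1"
  shows "(\<lambda>n. real n * q ^ n) sums (q / (1 - q)\<^sup>2)"
    "(\<lambda>n. (real n)\<^sup>2 * q ^ n) sums (q * (1 + q) / (1 - q) ^ 3)"
proof -
  have q: "1 - q \<noteq> 0" using assms by auto
  have g0: "(\<lambda>n. q ^ n) sums (1 / (1 - q))" using assms by (intro geometric_sums) simp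
  have g1: "(\<lambda>n. real (Suc n) * q ^ n) sums (1 / (1 - q)\<^sup>2)"
    using geometric_deriv_sums[of q] assms by simp
  have "(\<lambda>n. diffs (\<lambda>n. real (Suc n)) n * q ^ n) sums (2 / (1 - q) ^ 3)"
  proof (rule termdiffs_sums_strong)
    fix z :: real assume z: "norm z < 1"
    show "(\<lambda>n. real (Suc n) * z ^ n) sums (1 / (1 - z)\<^sup>2)" using geometric_deriv_sums[of z] z by simp
  next
    have d: "((\<lambda>z. 1 / (1 - z)\<^sup>2) has_field_derivative (2 * (1 - q) / ((1 - q)\<^sup>2 * (1 - q)\<^sup>2))) (at q)"
      using q by (auto intro!: derivative_eq_intros)
    have e: "2 * r / (r\<^sup>2 * r\<^sup>2) = 2 / r ^ 3" if "r \<noteq> 0" for r :: real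
      using that by (simp add: power2_eq_square power3_eq_cube)
    show "((\<lambda>z. 1 / (1 - z)\<^sup>2) has_field_derivative 2 / (1 - q) ^ 3) (at q)"
      using d unfolding e[OF q] .
  qed (use assms in simp)
  then have g2: "(\<lambda>n. real (Suc n) * real (Suc (Suc n)) * q ^ n) sums (2 / (1 - q) ^ 3)"
    by (simp add: diffs_def)
  have "(\<lambda>n. real (Suc n) * q ^ n - q ^ n) sums (1 / (1 - q)\<^sup>2 - 1 / (1 - q))"
    by (rule sums_diff[OF g1 g0])
  moreover have "1 / (1 - q)\<^sup>2 - 1 / (1 - q) = q / (1 - q)\<^sup>2"
  proof -
    have "1 / r\<^sup>2 - 1 / r = (1 - r) / r\<^sup>2" if "r \<noteq> 0" for r :: real
      using that by (simp add: power2_eq_square field_simps)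
    from this[OF q] show ?thesis by simp
  qed
  ultimately show "(\<lambda>n. real n * q ^ n) sums (q / (1 - q)\<^sup>2)" by (simp add: algebra_simps)
  \<comment> \<open>n^2 = (n + 1)(n + 2) - 3 (n + 1) + 1.\<close>
  have "(\<lambda>n. real (Suc n) * real (Suc (Suc n)) * q ^ n - 3 * (real (Suc n) * q ^ n) + q ^ n) sums
      (2 / (1 - q) ^ 3 - 3 * (1 / (1 - q)\<^sup>2) + 1 / (1 - q))"
    by (intro sums_add sums_diff sums_mult g0 g1 g2)
  moreover have "2 / (1 - q) ^ 3 - 3 * (1 / (1 - q)\<^sup>2) + 1 / (1 - q) = q * (1 + q) / (1 - q) ^ 3"
  proof -
    have "2 / r ^ 3 - 3 * (1 / r\<^sup>2) + 1 / r = (1 - r) * (1 + (1 - r)) / r ^ 3" if "r \<noteq> 0" for r :: real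
      using that by (simp add: power2_eq_square power3_eq_cube field_simps)
    from this[OF q] show ?thesis by simp
  qed
  moreover have "real (Suc n) * real (Suc (Suc n)) * q ^ n - 3 * (real (Suc n) * q ^ n) + q ^ n = (real n)\<^sup>2 * q ^ n" for n
    by (simp add: power2_eq_square algebra_simps)
  ultimately show "(\<lambda>n. (real n)\<^sup>2 * q ^ n) sums (q * (1 + q) / (1 - q) ^ 3)" by simp
qed

text \<open>Squared norm of the sequence \<open>(\<alpha> + n \<beta>) \<mu>\<^sup>n\<close>, with \<open>q = \<bar>\<mu>\<bar>\<^sup>2\<close>; the sequences of this form are the fibres.\<close>
definition fibN :: "complex \<Rightarrow> complex \<Rightarrow> complex \<Rightarrow> real" where
  "fibN \<alpha> \<beta> \<mu> = (let q = (cmod \<mu>)\<^sup>2 in (cmod \<alpha>)\<^sup>2 / (1 - q) + 2 * Re (\<alpha> * cnj \<beta>) * (q / (1 - q)\<^sup>2)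
     + (cmod \<beta>)\<^sup>2 * (q * (1 + q) / (1 - q) ^ 3))"

text \<open>The value at cnj \<mu> of the fibre with coefficients (\<alpha> + n \<beta>) \<mu>^n,
  that is, its inner product with the kernel sequence \<mu>^n.\<close>

definition fibU :: "complex \<Rightarrow> complex \<Rightarrow> complex \<Rightarrow> complex" where
  "fibU \<alpha> \<beta> \<mu> = (let q = (cmod \<mu>)\<^sup>2 in \<alpha> / of_real (1 - q) + \<beta> * of_real (q / (1 - q)\<^sup>2))"

text \<open>Squared norm of \<zeta> - z1 times that fibre, as \<open>fibD_sums\<close>
  shows.\<close>

definition fibD :: "complex \<Rightarrow> complex \<Rightarrow> complex \<Rightarrow> complex \<Rightarrow> real" where
  "fibD \<zeta> \<alpha> \<beta> \<mu> = 2 * fibN \<alpha> \<beta> \<mu> - 2 * Re (cnj \<zeta> * cnj \<mu> * (of_real (fibN \<alpha> \<beta> \<mu>) + cnj \<beta> * fibU \<alpha> \<beta> \<mu>))"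

lemma fibN_sums:
  assumes "cmod \<mu> < 1"
  shows "(\<lambda>n. (cmod ((\<alpha> + of_nat n * \<beta>) * \<mu> ^ n))\<^sup>2) sums fibN \<alpha> \<beta> \<mu>"
proof -
  define q where "q = (cmod \<mu>)\<^sup>2"
  have q: "\<bar>q\<bar> < 1" using assms by (simp add: q_def power_less_one_iff abs_square_less_1)
  have "(\<lambda>n. (cmod \<alpha>)\<^sup>2 * q ^ n + 2 * Re (\<alpha> * cnj \<beta>) * (real n * q ^ n) + (cmod \<beta>)\<^sup>2 * ((real n)\<^sup>2 * q ^ n)) sums
     ((cmod \<alpha>)\<^sup>2 * (1 / (1 - q)) + 2 * Re (\<alpha> * cnj \<beta>) * (q / (1 - q)\<^sup>2) + (cmod \<beta>)\<^sup>2 * (q * (1 + q) / (1 - q) ^ 3))"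
    using q by (intro sums_add sums_mult sq_geometric_sums geometric_sums) auto
  moreover have "(cmod ((\<alpha> + of_nat n * \<beta>) * \<mu> ^ n))\<^sup>2
      = (cmod \<alpha>)\<^sup>2 * q ^ n + 2 * Re (\<alpha> * cnj \<beta>) * (real n * q ^ n) + (cmod \<beta>)\<^sup>2 * ((real n)\<^sup>2 * q ^ n)" for n
  proof -
    have "(cmod ((\<alpha> + of_nat n * \<beta>) * \<mu> ^ n))\<^sup>2 = (cmod (\<alpha> + of_nat n * \<beta>))\<^sup>2 * q ^ n"
      by (simp add: norm_mult norm_power power_mult_distrib q_def power_mult[symmetric] mult.commute)
    also have "(cmod (\<alpha> + of_nat n * \<beta>))\<^sup>2 = (cmod \<alpha>)\<^sup>2 + 2 * Re (\<alpha> * cnj \<beta>) * real n + (cmod \<beta>)\<^sup>2 * (real n)\<^sup>2"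
      unfolding cmod_power2 by (simp add: power2_eq_square algebra_simps)
    finally show ?thesis by (simp add: algebra_simps)
  qed
  ultimately show ?thesis by (simp add: fibN_def q_def Let_def)
qed

abbreviation prev :: "(nat \<Rightarrow> complex) \<Rightarrow> nat \<Rightarrow> complex" where
  "prev f n \<equiv> (case n of 0 \<Rightarrow> 0 | Suc m \<Rightarrow> f m)"

text \<open>Expand the square. The cross terms pair neighbouring entries, and f(n + 1) = \<mu> (f(n)
  + \<beta> \<mu>^n) expresses their sum through \<open>fibN\<close> and
  \<open>fibU\<close>.\<close>

lemma fibD_sums:
  fixes \<alpha> \<beta> \<mu> \<zeta> :: complex
  assumes "cmod \<mu> < 1" "cmod \<zeta> = 1"
  defines "f \<equiv> \<lambda>n. (\<alpha> + of_nat n * \<beta>) * \<mu> ^ n"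
  shows "(\<lambda>n. (cmod (\<zeta> * f n - prev f n))\<^sup>2) sums fibD \<zeta> \<alpha> \<beta> \<mu>"
proof -
  define q where "q = (cmod \<mu>)\<^sup>2"
  have q: "\<bar>q\<bar> < 1" using assms by (simp add: q_def power_less_one_iff abs_square_less_1)
  have N: "(\<lambda>n. (cmod (f n))\<^sup>2) sums fibN \<alpha> \<beta> \<mu>" unfolding f_def by (rule fibN_sums[OF assms(1)])
  then have N': "(\<lambda>n. (cmod (f (Suc n)))\<^sup>2) sums (fibN \<alpha> \<beta> \<mu> - (cmod (f 0))\<^sup>2)"
    using sums_Suc_iff[of "\<lambda>n. (cmod (f n))\<^sup>2"] by simp
  have "(\<lambda>n. \<alpha> * of_real (q ^ n) + \<beta> * of_real (real n * q ^ n)) sums (\<alpha> * of_real (1 / (1 - q)) + \<beta> * of_real (q / (1 - q)\<^sup>2))"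
    using q by (intro sums_add sums_mult sums_of_real sq_geometric_sums geometric_sums) auto
  then have U: "(\<lambda>n. (\<alpha> + of_nat n * \<beta>) * of_real (q ^ n)) sums fibU \<alpha> \<beta> \<mu>"
    by (simp add: fibU_def q_def Let_def algebra_simps)
  have cross: "f n * cnj (f (Suc n)) = cnj \<mu> * (of_real ((cmod (f n))\<^sup>2) + cnj \<beta> * ((\<alpha> + of_nat n * \<beta>) * of_real (q ^ n)))" for n
  proof -
    have qn: "of_real (q ^ n) = \<mu> ^ n * cnj \<mu> ^ n"
    proof -
      have "complex_of_real q = \<mu> * cnj \<mu>" unfolding q_def by (rule complex_norm_square)
      then show ?thesis by (simp add: power_mult_distrib)
    qed
    have s: "cnj (f (Suc n)) = cnj \<mu> * (cnj (f n) + cnj \<beta> * cnj \<mu> ^ n)" by (simp add: f_def algebra_simps)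
    show ?thesis unfolding s complex_norm_square qn by (simp add: f_def algebra_simps)
  qed
  have "(\<lambda>n. (cmod (f (Suc n)))\<^sup>2 + (cmod (f n))\<^sup>2 - 2 * Re (cnj \<zeta> * (f n * cnj (f (Suc n))))) sums
      ((fibN \<alpha> \<beta> \<mu> - (cmod (f 0))\<^sup>2) + fibN \<alpha> \<beta> \<mu>
        - 2 * Re (cnj \<zeta> * (cnj \<mu> * (of_real (fibN \<alpha> \<beta> \<mu>) + cnj \<beta> * fibU \<alpha> \<beta> \<mu>))))"
    unfolding cross by (intro sums_add sums_diff sums_mult sums_Re sums_of_real N N' U)
  moreover have "(cmod (f (Suc n)))\<^sup>2 + (cmod (f n))\<^sup>2 - 2 * Re (cnj \<zeta> * (f n * cnj (f (Suc n))))
      = (cmod (\<zeta> * f (Suc n) - f n))\<^sup>2" for n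
  proof -
    have "(cmod (\<zeta> * f (Suc n) - f n))\<^sup>2 = (cmod (\<zeta> * f (Suc n)))\<^sup>2 + (cmod (f n))\<^sup>2 - 2 * Re (cnj (\<zeta> * f (Suc n)) * f n)"
      unfolding cmod_power2 by (simp add: power2_eq_square algebra_simps)
    then show ?thesis using assms(2) by (simp add: norm_mult mult_ac)
  qed
  moreover have "(fibN \<alpha> \<beta> \<mu> - (cmod (f 0))\<^sup>2) + fibN \<alpha> \<beta> \<mu>
        - 2 * Re (cnj \<zeta> * (cnj \<mu> * (of_real (fibN \<alpha> \<beta> \<mu>) + cnj \<beta> * fibU \<alpha> \<beta> \<mu>)))
      = fibD \<zeta> \<alpha> \<beta> \<mu> - (cmod (f 0))\<^sup>2"
    unfolding fibD_def mult.assoc by linarith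
  ultimately have "(\<lambda>n. (cmod (\<zeta> * f (Suc n) - f n))\<^sup>2) sums (fibD \<zeta> \<alpha> \<beta> \<mu> - (cmod (f 0))\<^sup>2)"
    by (simp only:)
  \<comment> \<open>The term n = 0, where \<open>prev f\<close> is 0, contributes |f 0|^2 and
    completes the shifted sum.\<close>
  then show ?thesis
    using assms(2) sums_Suc_iff[of "\<lambda>n. (cmod (\<zeta> * f n - prev f n))\<^sup>2"]
    by (simp add: norm_mult)
qed

text \<open>Orthogonal splitting of the fibre: the first term is the component along the kernel
  sequence \<mu>^n, whose squared norm is 1/(1 - q), and the second is the remainder, which depends
  on \<beta> alone.\<close>

lemma fibN_eq:
  assumes "cmod \<mu> < 1"
  defines "q \<equiv> (cmod \<mu>)\<^sup>2"
  shows "fibN \<alpha> \<beta> \<mu> = (1 - q) * (cmod (fibU \<alpha> \<beta> \<mu>))\<^sup>2 + q * (cmod \<beta>)\<^sup>2 / (1 - q) ^ 3"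
proof -
  define r where "r = 1 - q"
  have "q < 1" using assms by (simp add: q_def power_less_one_iff abs_square_less_1)
  then have r: "r > 0" by (simp add: r_def)
  have fU: "fibU \<alpha> \<beta> \<mu> = \<alpha> / of_real r + \<beta> * of_real (q / r\<^sup>2)"
    by (simp add: fibU_def Let_def q_def r_def)
  have "(cmod (fibU \<alpha> \<beta> \<mu>))\<^sup>2 = (cmod \<alpha>)\<^sup>2 / r\<^sup>2 + 2 * Re (\<alpha> * cnj \<beta>) * (q / r ^ 3) + (cmod \<beta>)\<^sup>2 * (q\<^sup>2 / r ^ 4)"
    unfolding fU cmod_power2 using r
    by (simp add: power2_eq_square power3_eq_cube power4_eq_xxxx field_simps)
  then have "r * (cmod (fibU \<alpha> \<beta> \<mu>))\<^sup>2 + q * (cmod \<beta>)\<^sup>2 / r ^ 3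
     = (cmod \<alpha>)\<^sup>2 / r + 2 * Re (\<alpha> * cnj \<beta>) * (q / r\<^sup>2) + (cmod \<beta>)\<^sup>2 * ((q + q\<^sup>2) / r ^ 3)"
    using r by (simp add: power2_eq_square power3_eq_cube power4_eq_xxxx field_simps)
  moreover have "fibN \<alpha> \<beta> \<mu> = (cmod \<alpha>)\<^sup>2 / r + 2 * Re (\<alpha> * cnj \<beta>) * (q / r\<^sup>2) + (cmod \<beta>)\<^sup>2 * (q * (1 + q) / r ^ 3)"
    by (simp only: fibN_def Let_def q_def r_def)
  moreover have "q * (1 + q) = q + q\<^sup>2" by (simp add: power2_eq_square algebra_simps)
  ultimately show ?thesis by (simp only: r_def)
qed

lemma fibD_diff:
  assumes "cmod \<zeta> = 1"
  shows "fibD \<zeta> \<alpha> \<beta> \<mu> - (cmod (\<zeta> - cnj \<mu>))\<^sup>2 * fibN \<alpha> \<beta> \<mu>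
      = (1 - (cmod \<mu>)\<^sup>2) * fibN \<alpha> \<beta> \<mu> - 2 * Re (cnj \<zeta> * cnj \<mu> * cnj \<beta> * fibU \<alpha> \<beta> \<mu>)"
proof -
  have "(cmod (\<zeta> - cnj \<mu>))\<^sup>2 = (cmod \<zeta>)\<^sup>2 + (cmod \<mu>)\<^sup>2 - 2 * Re (cnj \<zeta> * cnj \<mu>)"
    unfolding cmod_power2 by (simp add: power2_eq_square algebra_simps)
  then have z: "(cmod (\<zeta> - cnj \<mu>))\<^sup>2 = 1 + (cmod \<mu>)\<^sup>2 - 2 * Re (cnj \<zeta> * cnj \<mu>)" by (simp add: assms)
  show ?thesis unfolding z fibD_def by (simp add: algebra_simps)
qed

text \<open>The excess in \<open>fibD_diff\<close> is nonnegative: by \<open>fibN_eq\<close>, (1 -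
  q) times \<open>fibN\<close> is the sum of the squares of (1 - q) |fibU| and |\<mu>| |\<beta>|/(1
  - q), and twice the product of these dominates the cross term.\<close>

lemma fibD_lower:
  assumes "cmod \<mu> < 1" "cmod \<zeta> = 1"
  shows "(cmod (\<zeta> - cnj \<mu>))\<^sup>2 * fibN \<alpha> \<beta> \<mu> \<le> fibD \<zeta> \<alpha> \<beta> \<mu>"
proof -
  define q where "q = (cmod \<mu>)\<^sup>2"
  define u where "u = fibU \<alpha> \<beta> \<mu>"
  have "q < 1" using assms by (simp add: q_def power_less_one_iff abs_square_less_1)
  then have r: "1 - q > 0" by simp
  have "fibD \<zeta> \<alpha> \<beta> \<mu> - (cmod (\<zeta> - cnj \<mu>))\<^sup>2 * fibN \<alpha> \<beta> \<mu>
      = (1 - q) * fibN \<alpha> \<beta> \<mu> - 2 * Re (cnj \<zeta> * cnj \<mu> * cnj \<beta> * u)"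
    unfolding q_def u_def by (rule fibD_diff[OF assms(2)])
  moreover have "Re (cnj \<zeta> * cnj \<mu> * cnj \<beta> * u) \<le> cmod \<mu> * cmod \<beta> * cmod u"
    using complex_Re_le_cmod[of "cnj \<zeta> * cnj \<mu> * cnj \<beta> * u"] assms by (simp add: norm_mult)
  moreover have "2 * (cmod \<mu> * cmod \<beta> * cmod u) \<le> (1 - q) * fibN \<alpha> \<beta> \<mu>"
  proof -
    have "0 \<le> ((1 - q) * cmod u - cmod \<mu> * cmod \<beta> / (1 - q))\<^sup>2" by simp
    also have "\<dots> = (1 - q) * ((1 - q) * (cmod u)\<^sup>2 + (cmod \<mu>)\<^sup>2 * (cmod \<beta>)\<^sup>2 / (1 - q) ^ 3) - 2 * (cmod \<mu> * cmod \<beta> * cmod u)"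
    proof -
      have "(s * x - m * b / s)\<^sup>2 = s * (s * x\<^sup>2 + m\<^sup>2 * b\<^sup>2 / s ^ 3) - 2 * (m * b * x)" if "s > 0" for s x m b :: real
        using that by (simp add: power2_eq_square power3_eq_cube field_simps)
      from this[OF r] show ?thesis .
    qed
    finally show ?thesis unfolding fibN_eq[OF assms(1)] q_def[symmetric] u_def[symmetric] by simp
  qed
  ultimately show ?thesis by linarith
qed

section \<open>The lower bound on shift-invariant subspaces\<close>

text \<open>\<open>Qop a c (sh2 x)\<close> and \<open>Qop a c (sh1 x)\<close>: the coefficients of \<open>p_poly\<close> times \<open>x\<close> of index
  \<open>(i + 1, j)\<close> and \<open>(i, j + 1)\<close>, respectively.\<close>
definition Rop1 :: "real \<Rightarrow> real \<Rightarrow> coeffs \<Rightarrow> coeffs" where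
  "Rop1 a c x = of_real a *\<^sub>C bs1 x - x + of_real c *\<^sub>C bs1 (sh2 x)"
definition Rop2 :: "real \<Rightarrow> real \<Rightarrow> coeffs \<Rightarrow> coeffs" where
  "Rop2 a c x = of_real a *\<^sub>C bs2 x - bs2 (sh1 x) + of_real c *\<^sub>C x"

lemma Rop1_linear: "Rop1 a c (x + y) = Rop1 a c x + Rop1 a c y" "Rop1 a c (x - y) = Rop1 a c x - Rop1 a c y"
  "Rop1 a c (s *\<^sub>C x) = s *\<^sub>C Rop1 a c x"
  by (simp_all add: Rop1_def shift_linear scaleC_distrib mult.commute)

lemma Rop1_0 [simp]: "Rop1 a c 0 = 0"
  by (simp add: Rop1_def)

text \<open>A \<open>sh2\<close>-invariant subspace of the model space contains the second shift of
  each of its vectors, so those vectors satisfy the stronger \<open>Rop1\<close> condition; likewise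
  for \<open>sh1\<close> and \<open>Rop2\<close>.\<close>

lemma Qop_sh: "Qop a c (Qop a c (sh2 (sh2 x))) = Rop1 a c (Rop1 a c x)"
  "Qop a c (Qop a c (sh1 (sh1 x))) = Rop2 a c (Rop2 a c x)"
proof -
  have "Qop a c (sh2 x) = Rop1 a c x" "Rop1 a c (sh2 x) = sh2 (Rop1 a c x)"
    "Qop a c (sh1 x) = Rop2 a c x" "Rop2 a c (sh1 x) = sh1 (Rop2 a c x)" for x
    by (simp_all add: Qop_def Rop1_def Rop2_def shift_linear shift_commute)
  then show "Qop a c (Qop a c (sh2 (sh2 x))) = Rop1 a c (Rop1 a c x)"
    "Qop a c (Qop a c (sh1 (sh1 x))) = Rop2 a c (Rop2 a c x)" by simp_all
qed

lemma Rop1_sh2: "Rop1 a c (sh2 x) = sh2 (Rop1 a c x)"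
  by (simp add: Rop1_def shift_linear shift_commute)

text \<open>In the other direction, the \<open>Rop1\<close> condition puts a vector into the model
  space.\<close>

lemma Qop_Qop_eq: "Qop a c (Qop a c x) = bs2 (bs2 (Rop1 a c (Rop1 a c x)))"
proof -
  have "Qop a c x = bs2 (Rop1 a c x)" "bs2 (Rop1 a c (bs2 x)) = bs2 (bs2 (Rop1 a c x))" for x
    by (simp_all add: Qop_def Rop1_def shift_linear shift_commute)
  then show ?thesis by simp
qed

lemma coord_Rop:
  "coord (Rop1 a c x) (i, j) = of_real a * coord x (Suc i, j) - coord x (i, j)
     + of_real c * (case j of 0 \<Rightarrow> 0 | Suc k \<Rightarrow> coord x (Suc i, k))"
  "coord (Rop2 a c x) (i, j) = of_real a * coord x (i, Suc j) - (case i of 0 \<Rightarrow> 0 | Suc k \<Rightarrow> coord x (k, Suc j))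
     + of_real c * coord x (i, j)"
proof -
  show "coord (Rop1 a c x) (i, j) = of_real a * coord x (Suc i, j) - coord x (i, j)
     + of_real c * (case j of 0 \<Rightarrow> 0 | Suc k \<Rightarrow> coord x (Suc i, k))"
    by (cases j) (simp_all add: Rop1_def)
  show "coord (Rop2 a c x) (i, j) = of_real a * coord x (i, Suc j) - (case i of 0 \<Rightarrow> 0 | Suc k \<Rightarrow> coord x (k, Suc j))
     + of_real c * coord x (i, j)"
    by (cases i) (simp_all add: Rop2_def)
qed

text \<open>The two conditions solve for x(i + 2, j) and x(i, j + 2), with factor a^2, in terms of
  entries of smaller total degree, so the four entries with i, j < 2 determine
  \<open>x\<close>.\<close>

lemma low_degree_eq_0:
  assumes "a \<noteq> 0" "Rop1 a c (Rop1 a c x) = 0" "Rop2 a c (Rop2 a c x) = 0"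
    and low: "\<And>i j. i < 2 \<Longrightarrow> j < 2 \<Longrightarrow> coord x (i, j) = 0"
  shows "x = 0"
proof -
  have "coord x (i, j) = 0" for i j
  proof (induction "i + j" arbitrary: i j rule: less_induct)
    case less
    consider "i < 2" "j < 2" | "i \<ge> 2" | "j \<ge> 2" by linarith
    then show ?case
    proof cases
      case 1 then show ?thesis by (rule low)
    next
      case 2
      define k where "k = i - 2"
      have i: "i = Suc (Suc k)" using 2 by (simp add: k_def)
      have z: "coord x (i', j') = 0" if "i' + j' < Suc (Suc k) + j" for i' j' using less[of i' j'] that by (simp add: i)
      have "coord (Rop1 a c (Rop1 a c x)) (k, j) = 0" by (simp add: assms)
      then have "of_real a * (of_real a * coord x (i, j)) = 0"
        unfolding coord_Rop i by (simp add: z split: nat.splits)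
      then show ?thesis using assms(1) by simp
    next
      case 3
      define k where "k = j - 2"
      have j: "j = Suc (Suc k)" using 3 by (simp add: k_def)
      have z: "coord x (i', j') = 0" if "i' + j' < i + Suc (Suc k)" for i' j' using less[of i' j'] that by (simp add: j)
      have "coord (Rop2 a c (Rop2 a c x)) (i, k) = 0" by (simp add: assms)
      then have "of_real a * (of_real a * coord x (i, j)) = 0"
        unfolding coord_Rop j by (simp add: z split: nat.splits)
      then show ?thesis using assms(1) by simp
    qed
  qed
  then show ?thesis by (intro ell2_prod_eqI) simp
qed

section \<open>Rows as power series in z2 and their dilations\<close>

lemma rsh2_sums:
  assumes "(\<lambda>j. x (n, j) * z ^ j) sums s"
  shows "(\<lambda>j. rsh2 x (n, j) * z ^ j) sums (z * s)"
proof (rule sums_Suc_imp)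
  show "(\<lambda>j. rsh2 x (n, Suc j) * z ^ Suc j) sums (z * s)"
    using sums_mult[OF assms, of z] by (simp add: mult_ac)
qed simp

lemma coord_row_sums:
  assumes "cmod z < 1"
  shows "(\<lambda>j. coord x (n, j) * z ^ j) sums rowser (coord x) n z"
  unfolding rowser_def
  by (rule summable_sums[OF summable_norm_cancel[OF summable_norm_powser_bounded[of "\<lambda>j. coord x (n, j)", OF norm_coord_le assms]]])

lemma rowser_Rop1:
  assumes "cmod z < 1"
  shows "rowser (coord (Rop1 a c x)) n z
    = (of_real a + of_real c * z) * rowser (coord x) (Suc n) z - rowser (coord x) n z"
proof -
  have "(\<lambda>j. of_real a * (coord x (Suc n, j) * z ^ j) - coord x (n, j) * z ^ j
      + of_real c * (rsh2 (coord x) (Suc n, j) * z ^ j)) sums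
    (of_real a * rowser (coord x) (Suc n) z - rowser (coord x) n z + of_real c * (z * rowser (coord x) (Suc n) z))"
    by (intro sums_add sums_diff sums_mult coord_row_sums rsh2_sums assms)
  moreover have "of_real a * (coord x (Suc n, j) * z ^ j) - coord x (n, j) * z ^ j
      + of_real c * (rsh2 (coord x) (Suc n, j) * z ^ j) = coord (Rop1 a c x) (n, j) * z ^ j" for j
    by (simp add: Rop1_def sh2.rep_eq algebra_simps)
  ultimately have "(\<lambda>j. coord (Rop1 a c x) (n, j) * z ^ j) sums
    (of_real a * rowser (coord x) (Suc n) z - rowser (coord x) n z + of_real c * (z * rowser (coord x) (Suc n) z))"
    by (simp only:)
  from sums_unique2[OF coord_row_sums[OF assms] this] show ?thesis by (simp add: algebra_simps)
qed

lemma cmod_dilate_le: "(cmod (if \<bar>r\<bar> \<le> 1 then of_real r ^ n * w else 0))\<^sup>2 \<le> (cmod w)\<^sup>2"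
proof (rule power_mono)
  show "cmod (if \<bar>r\<bar> \<le> 1 then of_real r ^ n * w else 0) \<le> cmod w"
    using mult_right_mono[OF power_le_one[of "\<bar>r\<bar>" n], of "cmod w"] by (simp add: norm_mult norm_power)
qed simp

text \<open>Dilation in z2 only, which makes every row absolutely summable when |r| < 1. The value 0
  for |r| > 1 is there because the lifting asks for square-summability at every real r.\<close>

lift_definition dil :: "real \<Rightarrow> coeffs \<Rightarrow> coeffs" is
  "\<lambda>r x k. if \<bar>r\<bar> \<le> 1 then of_real r ^ snd k * x k else 0"
proof -
  fix r :: real and x :: "nat \<times> nat \<Rightarrow> complex"
  assume "(\<lambda>k. (cmod (x k))\<^sup>2) summable_on UNIV"
  then show "(\<lambda>k. (cmod (if \<bar>r\<bar> \<le> 1 then of_real r ^ snd k * x k else 0))\<^sup>2) summable_on UNIV"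
    by (rule summable_on_comparison_test) (rule cmod_dilate_le zero_le_power2)+
qed

lemma norm_dil_le: "norm (dil r x) \<le> norm x"
proof (rule power2_le_imp_le)
  show "(norm (dil r x))\<^sup>2 \<le> (norm x)\<^sup>2"
    unfolding norm_sq_ell2
    by (intro infsum_mono sq_summable_coord) (simp only: dil.rep_eq cmod_dilate_le)
qed simp

context
  fixes a c :: real
  assumes c_pos: "0 < c" and a_eq: "a = 1 + c"
begin

lemma denominator_gt_1:
  assumes "cmod z < 1" shows "1 < cmod (of_real a + of_real c * z)"
proof -
  have "1 = a - c * 1" using a_eq by simp
  also have "\<dots> < a - c * cmod z" using assms c_pos by (simp add: mult_strict_left_mono)
  also have "\<dots> \<le> cmod (of_real a + of_real c * z)"
    using norm_diff_ineq[of "of_real a" "of_real c * z"] c_pos a_pos[OF c_pos a_eq] by (simp add: norm_mult)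
  finally show ?thesis .
qed

text \<open>At fixed z2 the condition is a second-order recursion in n with the double root \<mu>,
  whose solutions are \<mu>^n times an affine function of n.\<close>

lemma fibre_formula:
  assumes "Rop1 a c (Rop1 a c x) = 0" "cmod z < 1"
  defines "\<mu> \<equiv> 1 / (of_real a + of_real c * z)"
  shows "rowser (coord x) n z
    = (rowser (coord x) 0 z + of_nat n * rowser (coord (Rop1 a c x)) 0 z) * \<mu> ^ n"
proof -
  let ?w = "of_real a + of_real c * z"
  have w: "?w \<noteq> 0" using denominator_gt_1[OF assms(2)] by auto
  define f where "f n = rowser (coord x) n z" for n
  define g where "g n = rowser (coord (Rop1 a c x)) n z" for n
  have "rowser (coord (0 :: coeffs)) n z = 0" for n by (simp add: rowser_def)
  then have wg: "?w * g (Suc n) = g n" for n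
    using rowser_Rop1[OF assms(2), of a c "Rop1 a c x" n] by (simp add: assms(1) g_def)
  have \<mu>w: "\<mu> * ?w = 1" using w by (simp add: \<mu>_def)
  have g: "g (Suc n) = \<mu> * g n" for n
  proof -
    have "g (Suc n) = \<mu> * ?w * g (Suc n)" by (simp only: \<mu>w mult_1_left)
    then show ?thesis by (simp only: mult.assoc wg)
  qed
  have gn: "g n = \<mu> ^ n * g 0" for n by (induction n) (simp_all add: g)
  have gf: "f n + g n = ?w * f (Suc n)" for n
    unfolding g_def f_def rowser_Rop1[OF assms(2)] by simp
  have f: "f (Suc n) = \<mu> * (f n + g n)" for n unfolding gf mult.assoc[symmetric] \<mu>w by simp
  have "f n = (f 0 + of_nat n * g 0) * \<mu> ^ n"
  proof (induction n)
    case (Suc n)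
    have "f (Suc n) = \<mu> * ((f 0 + of_nat n * g 0) * \<mu> ^ n + \<mu> ^ n * g 0)" by (simp only: f Suc gn[of n])
    then show ?case by (simp add: algebra_simps)
  qed simp
  then show ?thesis by (simp add: f_def g_def)
qed

text \<open>The Moebius map 1/(a + c z) takes the closed unit disc to the disc with diameter from
  1/(a + c) to 1/(a - c) = 1, which has centre a/(a + c) and radius c/(a + c).\<close>

lemma zero_locus_disc:
  assumes "cmod z \<le> 1"
  shows "cmod (cnj (1 / (of_real a + of_real c * z)) - of_real (a / (a + c))) \<le> c / (a + c)"
    "cmod z = 1 \<Longrightarrow> cmod (of_real a + of_real c * z) \<noteq> 0"
proof -
  let ?w = "of_real a + of_real c * z"
  have ac: "a > c" "a + c > 0" using c_pos a_eq by auto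
  have "0 < a - c * cmod z" using mult_left_mono[OF assms, of c] c_pos a_eq by linarith
  also have "\<dots> \<le> cmod ?w"
    using norm_diff_ineq[of "of_real a" "of_real c * z"] c_pos a_pos[OF c_pos a_eq] by (simp add: norm_mult)
  finally have w: "cmod ?w > 0" .
  then show "cmod ?w \<noteq> 0" by simp
  have "(cmod ?w)\<^sup>2 - (cmod (of_real c + of_real a * z))\<^sup>2 = (a\<^sup>2 - c\<^sup>2) * (1 - (cmod z)\<^sup>2)"
    unfolding cmod_power2 by (simp add: power2_eq_square algebra_simps)
  moreover have "0 \<le> (a\<^sup>2 - c\<^sup>2) * (1 - (cmod z)\<^sup>2)"
    using assms ac c_pos by (intro mult_nonneg_nonneg) (auto simp: power_mono power_le_one)
  ultimately have "(cmod (of_real c + of_real a * z))\<^sup>2 \<le> (cmod ?w)\<^sup>2" by linarith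
  then have le: "cmod (of_real c + of_real a * z) \<le> cmod ?w" by (rule power2_le_imp_le) simp
  \<comment> \<open>Relative to the centre, the map is the radius times -(c + a z)/(a + c z), of
    modulus at most 1 on the disc.\<close>
  have "1 / ?w - of_real (a / (a + c)) = - (of_real c * (of_real c + of_real a * z)) / (of_real (a + c) * ?w)"
  proof -
    have nz: "?w \<noteq> 0" "complex_of_real (a + c) \<noteq> 0"
      using w ac by (auto simp del: of_real_add)
    have "(1 / w - A / s) * (s * w) = s - A * w" if "w \<noteq> 0" "s \<noteq> 0" for w s A :: complex
      using that by (simp add: field_simps)
    from this[OF nz] have "(1 / ?w - of_real (a / (a + c))) * (of_real (a + c) * ?w) = of_real (a + c) - of_real a * ?w"
      by (simp only: of_real_divide)
    also have "\<dots> = - (of_real c * (of_real c + of_real a * z))" by (simp add: a_eq algebra_simps)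
    finally have eq: "(1 / ?w - of_real (a / (a + c))) * (of_real (a + c) * ?w) = - (of_real c * (of_real c + of_real a * z))" .
    have "of_real (a + c) * ?w \<noteq> 0" using nz by (simp only: mult_eq_0_iff simp_thms)
    from nonzero_eq_divide_eq[OF this] eq show ?thesis by blast
  qed
  then have "cmod (1 / ?w - of_real (a / (a + c))) = c / (a + c) * (cmod (of_real c + of_real a * z) / cmod ?w)"
    using c_pos ac by (simp only: norm_divide norm_mult norm_minus_cancel norm_of_real abs_of_pos times_divide_times_eq)
  also have "\<dots> \<le> c / (a + c) * 1"
    using le w c_pos ac by (intro mult_left_mono) auto
  finally have "cmod (1 / ?w - of_real (a / (a + c))) \<le> c / (a + c)" by (simp only: mult_1_right)
  moreover have "cnj (1 / ?w) - of_real (a / (a + c)) = cnj (1 / ?w - of_real (a / (a + c)))"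
    by (simp only: complex_cnj_diff complex_cnj_complex_of_real)
  ultimately show "cmod (cnj (1 / ?w) - of_real (a / (a + c))) \<le> c / (a + c)" by (simp only: complex_mod_cnj)
qed

text \<open>For \<zeta> on the unit circle, the distance to the disc of zeros.\<close>

definition gap :: "complex \<Rightarrow> real" where
  "gap \<zeta> = cmod (\<zeta> - of_real (a / (a + c))) - c / (a + c)"

lemma gap_nonneg: "cmod \<zeta> = 1 \<Longrightarrow> 0 \<le> gap \<zeta>"
proof -
  assume "cmod \<zeta> = 1"
  then have "1 - a / (a + c) \<le> cmod (\<zeta> - of_real (a / (a + c)))"
    using norm_triangle_ineq2[of \<zeta> "of_real (a / (a + c))"] c_pos a_pos[OF c_pos a_eq]
    unfolding norm_of_real by (simp del: of_real_divide)
  moreover have "1 - a / (a + c) = c / (a + c)" using c_pos a_eq by (simp add: field_simps)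
  ultimately show ?thesis by (simp add: gap_def)
qed

text \<open>Integrate \<open>fibD_lower\<close> over |z2| = r, where every zero is at distance at
  least \<open>gap\<close> from \<zeta>, and let r tend to 1.\<close>

lemma gap_le_norm:
  assumes x: "Rop1 a c (Rop1 a c x) = 0" and z: "cmod \<zeta> = 1"
  shows "gap \<zeta> * norm x \<le> norm (\<zeta> *\<^sub>C x - sh1 x)"
proof -
  define y where "y = \<zeta> *\<^sub>C x - sh1 x"
  define d where "d = gap \<zeta>"
  have d0: "0 \<le> d" using gap_nonneg[OF z] by (simp add: d_def)
  have dil: "d\<^sup>2 * (norm (dil r x))\<^sup>2 \<le> (norm y)\<^sup>2" if r: "0 \<le> r" "r < 1" for r
  proof -
    have rows: "rowser (coord (dil r v)) n w = rowser (coord v) n (of_real r * w)" for v n w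
      using r by (simp add: rowser_def dil.rep_eq power_mult_distrib mult_ac)
    have sm: "summable (\<lambda>j. cmod (coord (dil r v) (n, j)))" for v n
      using summable_norm_powser_bounded[of "\<lambda>j. coord v (n, j)" "norm v" "of_real r", OF norm_coord_le] r
      by (simp add: dil.rep_eq mult_ac)
    have pw: "ennreal (d\<^sup>2) * fibre_sq (coord (dil r x)) (cis t)
        \<le> fibre_sq (coord (dil r y)) (cis t)" for t
    proof -
      define w where "w = of_real r * cis t"
      have w: "cmod w < 1" using r by (simp add: w_def norm_mult)
      define \<mu> where "\<mu> = 1 / (of_real a + of_real c * w)"
      define \<alpha> where "\<alpha> = rowser (coord x) 0 w"
      define \<beta> where "\<beta> = rowser (coord (Rop1 a c x)) 0 w"
      have \<mu>: "cmod \<mu> < 1" 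
        using denominator_gt_1[OF w] by (simp only: \<mu>_def divide_inverse mult_1_left norm_inverse inverse_less_1_iff simp_thms)
      have fx: "rowser (coord x) n w = (\<alpha> + of_nat n * \<beta>) * \<mu> ^ n" for n
        unfolding \<alpha>_def \<beta>_def \<mu>_def by (rule fibre_formula[OF x w])
      have fy: "rowser (coord y) n w = \<zeta> * rowser (coord x) n w - prev (\<lambda>m. rowser (coord x) m w) n" for n
      proof (rule sums_unique2[OF coord_row_sums[OF w]])
        have "(\<lambda>j. coord (sh1 x) (n, j) * w ^ j) sums prev (\<lambda>m. rowser (coord x) m w) n"
          using coord_row_sums[OF w] by (cases n) simp_all
        from sums_diff[OF sums_mult[OF coord_row_sums[OF w, of x n], of \<zeta>] this]
        show "(\<lambda>j. coord y (n, j) * w ^ j) sums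
            (\<zeta> * rowser (coord x) n w - prev (\<lambda>m. rowser (coord x) m w) n)"
          by (simp add: y_def algebra_simps)
      qed
      have N: "fibre_sq (coord x) w = ennreal (fibN \<alpha> \<beta> \<mu>)"
        unfolding fx by (rule suminf_ennreal_eq[OF _ fibN_sums[OF \<mu>]]) simp
      have D: "fibre_sq (coord y) w = ennreal (fibD \<zeta> \<alpha> \<beta> \<mu>)"
        unfolding fy fx by (rule suminf_ennreal_eq[OF _ fibD_sums[OF \<mu> z]]) simp
      have N0: "0 \<le> fibN \<alpha> \<beta> \<mu>" using sums_le[OF _ sums_zero fibN_sums[OF \<mu>]] by simp
      have "d \<le> cmod (\<zeta> - cnj \<mu>)"
        using zero_locus_disc(1)[of w] w norm_triangle_ineq[of "\<zeta> - cnj \<mu>" "cnj \<mu> - of_real (a / (a + c))"]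
        by (simp add: d_def gap_def \<mu>_def)
      then have "d\<^sup>2 * fibN \<alpha> \<beta> \<mu> \<le> (cmod (\<zeta> - cnj \<mu>))\<^sup>2 * fibN \<alpha> \<beta> \<mu>"
        using d0 N0 by (intro mult_right_mono power_mono)
      also have "\<dots> \<le> fibD \<zeta> \<alpha> \<beta> \<mu>" by (rule fibD_lower[OF \<mu> z])
      finally show ?thesis
        unfolding rows w_def[symmetric] N D using N0 by (simp add: ennreal_mult'[symmetric] ennreal_leI)
    qed
    have "ennreal (d\<^sup>2) * (ennreal (2 * pi) * e2 (coord (dil r x)))
        = (\<integral>\<^sup>+t. ennreal (d\<^sup>2) * (fibre_sq (coord (dil r x)) (cis t) * indicator {0..0 + 2 * pi} t) \<partial>lborel)"
      unfolding fibre_parseval[of "coord (dil r x)" 0, OF sm, symmetric]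
      by (rule nn_integral_cmult[symmetric]) measurable
    also have "\<dots> \<le> (\<integral>\<^sup>+t. fibre_sq (coord (dil r y)) (cis t) * indicator {0..0 + 2 * pi} t \<partial>lborel)"
      by (intro nn_integral_mono) (simp only: mult.assoc[symmetric] mult_right_mono[OF pw] zero_le)
    also have "\<dots> = ennreal (2 * pi) * e2 (coord (dil r y))" 
      by (rule fibre_parseval[of "coord (dil r y)" 0, OF sm])
    finally have "ennreal (d\<^sup>2 * (2 * pi * (norm (dil r x))\<^sup>2)) \<le> ennreal (2 * pi * (norm (dil r y))\<^sup>2)"
      unfolding e2_coord by (simp add: ennreal_mult)
    then have "d\<^sup>2 * (norm (dil r x))\<^sup>2 \<le> (norm (dil r y))\<^sup>2" by (simp add: ennreal_le_iff)
    also have "\<dots> \<le> (norm y)\<^sup>2" using norm_dil_le by (intro power_mono) auto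
    finally show ?thesis .
  qed
  \<comment> \<open>The limit r to 1 is taken coordinatewise on finite index sets, the infinite sum
    afterwards.\<close>
  have fin: "d\<^sup>2 * (\<Sum>k\<in>A. (cmod (coord x k))\<^sup>2) \<le> (norm y)\<^sup>2" if A: "finite A" for A
  proof (rule LIMSEQ_le_const2)
    show "(\<lambda>m. d\<^sup>2 * (\<Sum>k\<in>A. (cmod (of_real (real m / real (Suc m)) ^ snd k * coord x k))\<^sup>2))
        \<longlonglongrightarrow> d\<^sup>2 * (\<Sum>k\<in>A. (cmod (coord x k))\<^sup>2)"
    proof (intro tendsto_intros)
      have "(\<lambda>m. complex_of_real (real m / real (Suc m)) ^ snd k * coord x k) \<longlonglongrightarrow> of_real 1 ^ snd k * coord x k" for k
        by (intro tendsto_intros LIMSEQ_n_over_Suc_n)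
      then show "(\<lambda>m. complex_of_real (real m / real (Suc m)) ^ snd k * coord x k) \<longlonglongrightarrow> coord x k" for k by simp
    qed
    have "d\<^sup>2 * (\<Sum>k\<in>A. (cmod (of_real (real m / real (Suc m)) ^ snd k * coord x k))\<^sup>2) \<le> (norm y)\<^sup>2" for m
    proof -
      define r where "r = real m / real (Suc m)"
      have r: "0 \<le> r" "r < 1" by (auto simp: r_def)
      have "(\<Sum>k\<in>A. (cmod (of_real r ^ snd k * coord x k))\<^sup>2) = (\<Sum>k\<in>A. (cmod (coord (dil r x) k))\<^sup>2)"
        using r by (simp add: dil.rep_eq)
      also have "\<dots> \<le> (norm (dil r x))\<^sup>2"
        unfolding norm_sq_ell2 by (rule finite_sum_le_infsum) (auto simp: sq_summable_coord A)
      finally have "d\<^sup>2 * (\<Sum>k\<in>A. (cmod (of_real r ^ snd k * coord x k))\<^sup>2) \<le> d\<^sup>2 * (norm (dil r x))\<^sup>2"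
        by (intro mult_left_mono) auto
      then show ?thesis using dil[OF r] by (simp add: r_def)
    qed
    then show "\<exists>N. \<forall>m\<ge>N. d\<^sup>2 * (\<Sum>k\<in>A. (cmod (of_real (real m / real (Suc m)) ^ snd k * coord x k))\<^sup>2) \<le> (norm y)\<^sup>2"
      by blast
  qed
  have "d\<^sup>2 * (norm x)\<^sup>2 = (\<Sum>\<^sub>\<infinity>k. d\<^sup>2 * (cmod (coord x k))\<^sup>2)"
    unfolding norm_sq_ell2 by (simp add: infsum_cmult_right sq_summable_coord)
  also have "\<dots> \<le> (norm y)\<^sup>2"
    by (rule infsum_le_finite_sums)
       (use fin in \<open>auto intro!: summable_on_cmult_right sq_summable_coord simp: sum_distrib_left\<close>)
  finally have "(d * norm x)\<^sup>2 \<le> (norm y)\<^sup>2" by (simp add: power_mult_distrib)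
  then show ?thesis unfolding d_def y_def by (rule power2_le_imp_le) simp
qed

end

section \<open>Test functions\<close>

text \<open>Coefficients in z of (1 + z)^4/(a + c z)^n, by repeated Cauchy products with the
  geometric series of 1/(a + c z). The weight |1 + z|^8 in the squared norms outweighs their growth
  of order |1 + z|^(-6) at z = -1.\<close>

primrec Eseq :: "real \<Rightarrow> real \<Rightarrow> nat \<Rightarrow> nat \<Rightarrow> complex" where
  "Eseq a c 0 = (\<lambda>j. of_nat (4 choose j))"
| "Eseq a c (Suc n) = (\<lambda>j. \<Sum>l\<le>j. Eseq a c n l * (1 / of_real a * (- of_real c / of_real a) ^ (j - l)))"

text \<open>Comparing coefficients in (a + c z) E(n + 1) = E(n); this makes the test functions solve
  the \<open>Rop1\<close> recursion exactly.\<close>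

lemma Eseq_rec:
  assumes "a \<noteq> 0"
  shows "of_real a * Eseq a c (Suc n) j + of_real c * (case j of 0 \<Rightarrow> 0 | Suc k \<Rightarrow> Eseq a c (Suc n) k) = Eseq a c n j"
proof (cases j)
  case 0
  then show ?thesis using assms by simp
next
  case (Suc k)
  let ?\<rho> = "- complex_of_real c / of_real a"
  have "(\<Sum>l\<le>k. Eseq a c n l * (1 / of_real a * ?\<rho> ^ (Suc k - l))) = (\<Sum>l\<le>k. ?\<rho> * (Eseq a c n l * (1 / of_real a * ?\<rho> ^ (k - l))))"
    by (intro sum.cong refl) (simp add: Suc_diff_le mult_ac)
  also have "\<dots> = ?\<rho> * Eseq a c (Suc n) k" by (simp only: sum_distrib_left Eseq.simps)
  finally have "Eseq a c (Suc n) (Suc k) = ?\<rho> * Eseq a c (Suc n) k + Eseq a c n (Suc k) * (1 / of_real a)"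
    by (simp only: Eseq.simps sum.atMost_Suc diff_self_eq_0 power_0 mult_1_right)
  moreover have "of_real a * ?\<rho> = - of_real c" using assms by simp
  ultimately show ?thesis unfolding Suc using assms by (simp only: nat.case distrib_left mult.assoc[symmetric]) simp
qed

lemma Eseq_summable:
  assumes "0 < c" "c < a"
  shows "summable (\<lambda>j. cmod (Eseq a c n j))"
proof (induction n)
  case 0
  have "(\<lambda>j. cmod (of_nat (4 choose j))) sums (\<Sum>j\<in>{..4}. cmod (of_nat (4 choose j)))"
    by (rule sums_finite) (auto simp: binomial_eq_0)
  then show ?case by (simp only: Eseq.simps sums_summable)
next
  case (Suc n)
  let ?b = "\<lambda>l. 1 / a * (c / a) ^ l"
  have "summable ?b" using assms by (intro summable_mult summable_geometric) auto
  moreover have "norm (?b l) = ?b l" for l using assms by simp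
  ultimately have b: "summable (\<lambda>l. norm (?b l))" by (simp only:)
  have s: "summable (\<lambda>j. norm (cmod (Eseq a c n j)))" using Suc by simp
  show ?case
  proof (rule summable_comparison_test')
    show "summable (\<lambda>j. \<Sum>l\<le>j. cmod (Eseq a c n l) * ?b (j - l))"
      by (rule summable_Cauchy_product[OF s b])
    show "norm (cmod (Eseq a c (Suc n) j)) \<le> (\<Sum>l\<le>j. cmod (Eseq a c n l) * ?b (j - l))" for j
    proof -
      have "cmod (Eseq a c (Suc n) j)
          \<le> (\<Sum>l\<le>j. cmod (Eseq a c n l * (1 / of_real a * (- of_real c / of_real a) ^ (j - l))))"
        by (simp only: Eseq.simps norm_sum)
      also have "\<dots> = (\<Sum>l\<le>j. cmod (Eseq a c n l) * ?b (j - l))"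
        using assms by (intro sum.cong refl) (simp add: norm_mult norm_power norm_divide)
      finally show ?thesis by simp
    qed
  qed
qed

lemma Eseq_sums:
  assumes "0 < c" "c < a" "cmod z \<le> 1"
  shows "(\<lambda>j. Eseq a c n j * z ^ j) sums ((1 + z) ^ 4 * (1 / (of_real a + of_real c * z)) ^ n)"
proof (induction n)
  case 0
  have "(\<lambda>j. of_nat (4 choose j) * z ^ j) sums (\<Sum>j\<in>{..4}. of_nat (4 choose j) * z ^ j)"
    by (rule sums_finite) (auto simp: binomial_eq_0)
  also have "(\<Sum>j\<in>{..4}. of_nat (4 choose j) * z ^ j) = (z + 1) ^ 4"
    unfolding binomial_ring by simp
  finally show ?case by (simp add: add.commute)
next
  case (Suc n)
  let ?\<rho> = "- complex_of_real c / of_real a"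
  let ?A = "\<lambda>l. Eseq a c n l * z ^ l" and ?B = "\<lambda>l. 1 / of_real a * (?\<rho> * z) ^ l"
  have a0: "a > 0" using assms by simp
  have rz: "cmod (?\<rho> * z) < 1"
  proof -
    have "cmod (?\<rho> * z) = c / a * cmod z" using assms by (simp add: norm_mult norm_divide)
    also have "\<dots> \<le> c / a * 1" using assms by (intro mult_left_mono) auto
    also have "\<dots> < 1" using assms by simp
    finally show ?thesis .
  qed
  have B: "?B sums (1 / of_real a * (1 / (1 - ?\<rho> * z)))" by (intro sums_mult geometric_sums rz)
  have nB: "summable (\<lambda>l. norm (?B l))"
    unfolding norm_mult[of "1 / complex_of_real a"] norm_power
    by (intro summable_mult summable_geometric) (simp only: rz real_norm_def abs_norm_cancel)
  have nA: "summable (\<lambda>l. norm (?A l))"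
  proof (rule summable_comparison_test'[OF Eseq_summable[OF assms(1,2), of n]])
    show "norm (norm (Eseq a c n l * z ^ l)) \<le> cmod (Eseq a c n l)" for l
      using assms(3) by (simp add: norm_mult norm_power mult_left_le power_le_one)
  qed
  have "(\<lambda>j. \<Sum>l\<le>j. ?A l * ?B (j - l)) sums ((\<Sum>l. ?A l) * (\<Sum>l. ?B l))"
    by (rule Cauchy_product_sums[OF nA nB])
  moreover have "(\<Sum>l\<le>j. ?A l * ?B (j - l)) = Eseq a c (Suc n) j * z ^ j" for j
  proof -
    have "?A l * ?B (j - l) = Eseq a c n l * (1 / of_real a * ?\<rho> ^ (j - l)) * z ^ j" if "l \<le> j" for l
    proof -
      have "z ^ j = z ^ l * z ^ (j - l)" using that by (simp add: power_add[symmetric])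
      then show ?thesis by (simp only: power_mult_distrib mult_ac)
    qed
    then show ?thesis unfolding Eseq.simps sum_distrib_right by (intro sum.cong refl) simp
  qed
  moreover have "(\<Sum>l. ?A l) = (1 + z) ^ 4 * (1 / (of_real a + of_real c * z)) ^ n"
    using Suc by (rule sums_unique[symmetric])
  moreover have "(\<Sum>l. ?B l) = 1 / (of_real a + of_real c * z)"
  proof -
    have "of_real a * (1 - ?\<rho> * z) = of_real a + of_real c * z" using a0 by (simp add: algebra_simps)
    then show ?thesis using sums_unique[OF B] by (metis mult_1 times_divide_times_eq)
  qed
  ultimately show ?case by (simp only: power_Suc2 mult.assoc)
qed

text \<open>The test functions: over z2 on the circle the fibre is (1 + z2)^4 times the sequence
  measured by \<open>fibN\<close>.\<close>

definition phi :: "real \<Rightarrow> real \<Rightarrow> complex \<Rightarrow> complex \<Rightarrow> nat \<times> nat \<Rightarrow> complex" where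
  "phi a c \<alpha> \<beta> k = (\<alpha> + of_nat (fst k) * \<beta>) * Eseq a c (fst k) (snd k)"

definition mu :: "real \<Rightarrow> real \<Rightarrow> complex \<Rightarrow> complex" where
  "mu a c z = 1 / (of_real a + of_real c * z)"

lemma phi_sums:
  assumes "0 < c" "c < a" "cmod z \<le> 1"
  shows "(\<lambda>j. phi a c \<alpha> \<beta> (n, j) * z ^ j) sums ((1 + z) ^ 4 * ((\<alpha> + of_nat n * \<beta>) * mu a c z ^ n))"
  using sums_mult[OF Eseq_sums[OF assms, of n], of "\<alpha> + of_nat n * \<beta>"]
  by (simp add: phi_def mu_def mult_ac)

lemma phi_summable:
  assumes "0 < c" "c < a"
  shows "summable (\<lambda>j. cmod (phi a c \<alpha> \<beta> (n, j)))"
  using Eseq_summable[OF assms, of n] by (simp add: phi_def norm_mult)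

section \<open>Polynomials in the second variable\<close>

text \<open>Multiplication by the polynomial \<open>u\<close> in z2, in Horner form.\<close>

definition act :: "complex poly \<Rightarrow> coeffs \<Rightarrow> coeffs" where
  "act u x = fold_coeffs (\<lambda>s y. s *\<^sub>C x + sh2 y) u 0"

lemma act_0 [simp]: "act 0 x = 0"
  by (simp add: act_def)

lemma act_pCons: "act (pCons s u) x = s *\<^sub>C x + sh2 (act u x)"
  by (cases "s = 0 \<and> u = 0") (auto simp: act_def)

lemma act_add: "act (u + v) x = act u x + act v x"
  by (induction u v rule: poly_induct2) (simp_all add: act_pCons scaleC_distrib shift_linear)

lemma act_smult: "act (smult s u) x = s *\<^sub>C act u x"
  by (induction u) (simp_all add: act_pCons scaleC_distrib shift_linear)

lemma act_mult: "act (u * v) x = act u (act v x)"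
  by (induction u) (simp_all add: act_pCons act_add act_smult)

lemma act_in_subspace:
  assumes "csubspace2 V" "\<And>y. y \<in> V \<Longrightarrow> sh2 y \<in> V" "x \<in> V"
  shows "act u x \<in> V"
  by (induction u) (auto simp: act_pCons intro!: csubspace2D[OF assms(1)] assms)

lemma act_sums:
  assumes "(\<lambda>j. coord x (n, j) * z ^ j) sums s"
  shows "(\<lambda>j. coord (act u x) (n, j) * z ^ j) sums (poly u z * s)"
proof (induction u)
  case (pCons t u)
  have "(\<lambda>j. t * (coord x (n, j) * z ^ j) + rsh2 (coord (act u x)) (n, j) * z ^ j) sums (t * s + z * (poly u z * s))"
    by (intro sums_add sums_mult assms rsh2_sums pCons)
  then show ?case by (simp add: act_pCons sh2.rep_eq algebra_simps)
qed simp

lemma act_summable: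
  assumes "summable (\<lambda>j. cmod (coord x (n, j)))"
  shows "summable (\<lambda>j. cmod (coord (act u x) (n, j)))"
proof (induction u)
  case (pCons t u)
  have "summable (\<lambda>j. cmod (rsh2 (coord (act u x)) (n, Suc j)))" using pCons by simp
  then have r: "summable (\<lambda>j. cmod (rsh2 (coord (act u x)) (n, j)))" by (subst (asm) summable_Suc_iff)
  show ?case
  proof (rule summable_comparison_test')
    show "summable (\<lambda>j. cmod t * cmod (coord x (n, j)) + cmod (rsh2 (coord (act u x)) (n, j)))"
      by (intro summable_add summable_mult assms r)
    show "norm (cmod (coord (act (pCons t u) x) (n, j)))
        \<le> cmod t * cmod (coord x (n, j)) + cmod (rsh2 (coord (act u x)) (n, j))" for j
      using norm_triangle_ineq[of "t * coord x (n, j)" "rsh2 (coord (act u x)) (n, j)"]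
      by (simp add: act_pCons sh2.rep_eq norm_mult)
  qed
qed simp

text \<open>Finitely many linear functionals have a common zero on the infinite-dimensional space of
  polynomials. Divisibility by a prescribed power is carried along so that the induction can produce
  two independent candidates.\<close>

lemma poly_common_kernel:
  fixes F :: "nat \<Rightarrow> complex poly \<Rightarrow> complex"
  assumes add: "\<And>i u v. F i (u + v) = F i u + F i v" and smult: "\<And>i s u. F i (smult s u) = s * F i u"
  shows "\<exists>g. g \<noteq> 0 \<and> monom 1 N dvd g \<and> (\<forall>i<n. F i g = 0)"
proof (induction n arbitrary: N)
  case 0
  then show ?case by (intro exI[of _ "monom 1 N"]) simp
next
  case (Suc n)
  obtain g1 where g1: "g1 \<noteq> 0" "monom 1 N dvd g1" "\<forall>i<n. F i g1 = 0" using Suc by blast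
  \<comment> \<open>\<open>M\<close> exceeds the degree of \<open>g1\<close>, so no nonzero scalar
    multiple of \<open>g1\<close> is divisible by \<open>monom 1 M\<close>; hence the combination
    \<open>g\<close> below is nonzero.\<close>
  define M where "M = Suc (N + degree g1)"
  obtain g2 where g2: "g2 \<noteq> 0" "monom 1 M dvd g2" "\<forall>i<n. F i g2 = 0" using Suc by blast
  show ?case
  proof (cases "F n g1 = 0")
    case True
    then show ?thesis using g1 less_Suc_eq by auto
  next
    case False
    define g where "g = smult (F n g1) g2 + smult (- F n g2) g1"
    have "monom 1 N dvd monom (1 :: complex) M" by (rule dvdI[of _ _ "monom 1 (M - N)"]) (simp add: mult_monom M_def)
    then have "monom 1 N dvd g"
      unfolding g_def by (intro dvd_add dvd_smult g1(2) dvd_trans[OF _ g2(2)])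
    moreover have "F i g = 0" if "i < Suc n" for i
      unfolding g_def add smult using that g1 g2 by (cases "i = n") auto
    moreover have "g \<noteq> 0"
    proof
      assume "g = 0"
      then have eq: "smult (F n g1) g2 = smult (F n g2) g1" by (simp add: g_def)
      then have "F n g2 \<noteq> 0" using False g2 by auto
      have "monom 1 M dvd smult (F n g2) g1" unfolding eq[symmetric] by (rule dvd_smult[OF g2(2)])
      then have "monom 1 M dvd g1" using \<open>F n g2 \<noteq> 0\<close> by (simp add: dvd_smult_iff)
      then have "degree (monom (1 :: complex) M) \<le> degree g1" using g1(1) by (rule dvd_imp_degree_le)
      then show False by (simp add: degree_monom_eq M_def)
    qed
    ultimately show ?thesis by blast
  qed
qed

section \<open>Growth of the fibre norms and concentration\<close>

lemma fibD_le:
  assumes "cmod \<mu> < 1" "cmod \<zeta> = 1"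
  shows "fibD \<zeta> \<alpha> \<beta> \<mu> \<le> 4 * fibN \<alpha> \<beta> \<mu>"
proof -
  define f where "f n = (\<alpha> + of_nat n * \<beta>) * \<mu> ^ n" for n
  have N: "(\<lambda>n. (cmod (f n))\<^sup>2) sums fibN \<alpha> \<beta> \<mu>" unfolding f_def by (rule fibN_sums[OF assms(1)])
  have "(\<lambda>n. (cmod (prev f n))\<^sup>2) sums fibN \<alpha> \<beta> \<mu>"
    by (rule sums_Suc_imp) (use N in simp_all)
  from sums_add[OF sums_mult[OF N, of 2] sums_mult[OF this, of 2]]
  have N2: "(\<lambda>n. 2 * (cmod (f n))\<^sup>2 + 2 * (cmod (prev f n))\<^sup>2) sums (4 * fibN \<alpha> \<beta> \<mu>)" by simp
  have D: "(\<lambda>n. (cmod (\<zeta> * f n - prev f n))\<^sup>2) sums fibD \<zeta> \<alpha> \<beta> \<mu>"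
    unfolding f_def by (rule fibD_sums[OF assms])
  have "(cmod (\<zeta> * f n - prev f n))\<^sup>2
      \<le> 2 * (cmod (f n))\<^sup>2 + 2 * (cmod (prev f n))\<^sup>2" for n
    using cmod_add_sq_le[of "\<zeta> * f n" "- prev f n"] assms(2) by (simp add: norm_mult)
  from sums_le[OF this D N2] show ?thesis .
qed

lemma fibN_nonneg: "cmod \<mu> < 1 \<Longrightarrow> 0 \<le> fibN \<alpha> \<beta> \<mu>"
  using sums_le[OF _ sums_zero fibN_sums] by simp

text \<open>All three terms are majorized by the worst power of 1/(1 - q), the third; this is the
  growth that the factor in \<open>Eseq\<close> has to absorb.\<close>

lemma fibN_bound:
  assumes "cmod \<mu> < 1"
  shows "fibN \<alpha> \<beta> \<mu> \<le> ((cmod \<alpha>)\<^sup>2 + 2 * cmod \<alpha> * cmod \<beta> + 2 * (cmod \<beta>)\<^sup>2) / (1 - (cmod \<mu>)\<^sup>2) ^ 3"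
proof -
  define q where "q = (cmod \<mu>)\<^sup>2"
  define r where "r = 1 - q"
  have "q < 1" "0 \<le> q" using assms by (auto simp: q_def power_less_one_iff abs_square_less_1)
  then have r: "0 < r" "r \<le> 1" by (auto simp: r_def)
  have r3: "r ^ 3 \<le> r" "r ^ 3 \<le> r\<^sup>2"
    using r power_decreasing[of 1 3 r] power_decreasing[of 2 3 r] by auto
  have "(cmod \<alpha>)\<^sup>2 / r \<le> (cmod \<alpha>)\<^sup>2 / r ^ 3" using r r3 by (intro divide_left_mono) auto
  moreover have "2 * Re (\<alpha> * cnj \<beta>) * (q / r\<^sup>2) \<le> 2 * cmod \<alpha> * cmod \<beta> / r ^ 3"
  proof -
    have "2 * Re (\<alpha> * cnj \<beta>) * (q / r\<^sup>2) \<le> 2 * cmod (\<alpha> * cnj \<beta>) * (q / r\<^sup>2)"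
      using complex_Re_le_cmod[of "\<alpha> * cnj \<beta>"] \<open>0 \<le> q\<close> by (intro mult_right_mono) auto
    also have "\<dots> \<le> 2 * cmod (\<alpha> * cnj \<beta>) * (1 / r ^ 3)"
      using r r3 \<open>q < 1\<close> by (intro mult_left_mono frac_le) auto
    finally show ?thesis by (simp add: norm_mult)
  qed
  moreover have "(cmod \<beta>)\<^sup>2 * (q * (1 + q) / r ^ 3) \<le> 2 * (cmod \<beta>)\<^sup>2 / r ^ 3"
  proof -
    have "q * (1 + q) \<le> 1 * 2" using \<open>q < 1\<close> \<open>0 \<le> q\<close> by (intro mult_mono) auto
    then have "(cmod \<beta>)\<^sup>2 * (q * (1 + q) / r ^ 3) \<le> (cmod \<beta>)\<^sup>2 * (2 / r ^ 3)"
      using r by (intro mult_left_mono divide_right_mono) auto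
    then show ?thesis by (simp add: mult.commute)
  qed
  moreover have "fibN \<alpha> \<beta> \<mu> = (cmod \<alpha>)\<^sup>2 / r + 2 * Re (\<alpha> * cnj \<beta>) * (q / r\<^sup>2) + (cmod \<beta>)\<^sup>2 * (q * (1 + q) / r ^ 3)"
    by (simp only: fibN_def Let_def q_def r_def)
  ultimately have "fibN \<alpha> \<beta> \<mu> \<le> (cmod \<alpha>)\<^sup>2 / r ^ 3 + 2 * cmod \<alpha> * cmod \<beta> / r ^ 3 + 2 * (cmod \<beta>)\<^sup>2 / r ^ 3" by linarith
  then show ?thesis by (simp only: add_divide_distrib r_def q_def)
qed

text \<open>The mass of \<open>((1 + cos (t - t\<^sub>0)) / 2)\<^sup>N\<close> concentrates at \<open>t\<^sub>0\<close> as \<open>N\<close> grows.\<close>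
lemma concentration:
  fixes N D :: "real \<Rightarrow> real"
  assumes meas [measurable]: "N \<in> borel_measurable borel"
    and N0: "\<And>t. 0 \<le> N t" and DM: "\<And>t. D t \<le> M" and M0: "0 \<le> M"
    and \<delta>: "0 < \<delta>" "\<delta> < pi" and s: "0 \<le> s" "s < s'"
    and near: "\<And>t. \<bar>t - t0\<bar> < \<delta> \<Longrightarrow> D t \<le> s * N t"
    and t1: "\<bar>t1 - t0\<bar> < \<delta>" "0 < N t1" "isCont N t1"
  defines "\<kappa> \<equiv> \<lambda>t. (1 + cos (t - t0)) / 2" and "J \<equiv> {t0 - pi..t0 - pi + 2 * pi}"
  shows "\<exists>n. (\<integral>\<^sup>+t. ennreal (\<kappa> t ^ n * D t) * indicator J t \<partial>lborel)
       \<le> ennreal s' * (\<integral>\<^sup>+t. ennreal (\<kappa> t ^ n * N t) * indicator J t \<partial>lborel)"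
proof -
  \<comment> \<open>\<open>t1\<close> is kept apart from \<open>t0\<close> because the polynomial
    factor in \<open>N\<close> may vanish at \<open>t0\<close> itself. Continuity keeps
    \<open>N\<close> above half of \<open>N t1\<close> on an interval inside the
    \<delta>-neighbourhood of \<open>t0\<close>.\<close>
  obtain e where e: "0 < e" "\<And>t. \<bar>t - t1\<bar> \<le> e \<Longrightarrow> N t1 / 2 \<le> N t" "\<bar>t1 - t0\<bar> + e < \<delta>"
  proof -
    have "\<forall>\<^sub>F t in at t1. N t1 / 2 < N t"
      using t1(2,3) by (intro order_tendstoD(1)[of N "N t1"]) (auto simp: isCont_def)
    then obtain d where d: "d > 0" "\<And>t. t \<noteq> t1 \<Longrightarrow> dist t t1 < d \<Longrightarrow> N t1 / 2 < N t"
      unfolding eventually_at by auto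
    define e where "e = min (d / 2) ((\<delta> - \<bar>t1 - t0\<bar>) / 2)"
    have "0 < e" "e < d" "\<bar>t1 - t0\<bar> + e < \<delta>" using d(1) t1(1) by (auto simp: e_def min_def field_simps)
    moreover have "N t1 / 2 \<le> N t" if "\<bar>t - t1\<bar> \<le> e" for t
      using d(2)[of t] that \<open>e < d\<close> t1(2) by (cases "t = t1") (auto simp: dist_real_def)
    ultimately show ?thesis using that by blast
  qed
  define \<delta>1 where "\<delta>1 = \<bar>t1 - t0\<bar> + e"
  have d1: "0 < \<delta>1" "\<delta>1 < \<delta>" using e by (auto simp: \<delta>1_def)
  \<comment> \<open>\<open>k1\<close> bounds the kernel from below near \<open>t1\<close> and
    \<open>k2\<close> from above outside the \<delta>-neighbourhood; since k2 < k1, the ratio of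
    their powers tends to 0.\<close>
  define k1 where "k1 = (1 + cos \<delta>1) / 2"
  define k2 where "k2 = (1 + cos \<delta>) / 2"
  have cos1: "0 \<le> 1 + cos t" for t :: real
    by (rule order_trans[OF _ add_left_mono[OF cos_ge_minus_one]]) simp
  then have k2: "0 \<le> k2" by (simp add: k2_def)
  have "k2 < k1" using cos_monotone_0_pi[OF _ d1(2)] d1 \<delta> by (auto simp: k1_def k2_def)
  note k = k2 this
  have \<kappa>0: "0 \<le> \<kappa> t" for t using cos1[of "t - t0"] by (simp add: \<kappa>_def)
  have \<kappa>_near: "k1 \<le> \<kappa> t" if "\<bar>t - t1\<bar> \<le> e" for t
  proof -
    have "\<bar>t - t0\<bar> \<le> \<delta>1" using that by (auto simp: \<delta>1_def)
    then have "cos \<delta>1 \<le> cos \<bar>t - t0\<bar>" using d1 \<delta> by (intro cos_monotone_0_pi_le) auto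
    then show ?thesis by (simp add: k1_def \<kappa>_def)
  qed
  have \<kappa>_far: "\<kappa> t \<le> k2" if "\<delta> \<le> \<bar>t - t0\<bar>" "t \<in> J" for t
  proof -
    have "\<bar>t - t0\<bar> \<le> pi" using that(2) by (auto simp: J_def)
    then have "cos \<bar>t - t0\<bar> \<le> cos \<delta>" using that(1) \<delta> by (intro cos_monotone_0_pi_le) auto
    then show ?thesis by (simp add: k2_def \<kappa>_def)
  qed
  \<comment> \<open>Up to powers of \<open>k1\<close> and \<open>k2\<close>, the surplus s' - s
    times the mass of \<open>N\<close> near \<open>t1\<close> has to pay for the far part, of size
    at most 2 pi M.\<close>
  define m where "m = (s' - s) * (N t1 / 2 * (2 * e))"
  have m: "0 < m" using s t1(2) e(1) by (simp add: m_def)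
  have "(\<lambda>n. (k2 / k1) ^ n * (M * (2 * pi))) \<longlonglongrightarrow> 0 * (M * (2 * pi))"
    using k by (intro tendsto_intros LIMSEQ_realpow_zero) auto
  then have "eventually (\<lambda>n. (k2 / k1) ^ n * (M * (2 * pi)) < m) sequentially"
    using m by (intro order_tendstoD(2)) auto
  then obtain n where "(k2 / k1) ^ n * (M * (2 * pi)) < m" by (auto simp: eventually_sequentially)
  then have n: "k2 ^ n * (M * (2 * pi)) \<le> k1 ^ n * m"
    using k by (simp add: power_divide divide_simps mult_ac)
  have [measurable]: "\<kappa> \<in> borel_measurable borel" unfolding \<kappa>_def by measurable
  define I where "I = (\<integral>\<^sup>+t. ennreal (\<kappa> t ^ n * N t) * indicator J t \<partial>lborel)"
  have pw: "ennreal (\<kappa> t ^ n * D t) * indicator J t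
      \<le> ennreal s * (ennreal (\<kappa> t ^ n * N t) * indicator J t) + ennreal (k2 ^ n * M) * indicator J t" for t
  proof (cases "t \<in> J")
    case True
    have "\<kappa> t ^ n * D t \<le> s * (\<kappa> t ^ n * N t) + k2 ^ n * M"
    proof (cases "\<bar>t - t0\<bar> < \<delta>")
      case True
      have "\<kappa> t ^ n * D t \<le> \<kappa> t ^ n * (s * N t)" using near[OF True] \<kappa>0 by (intro mult_left_mono) auto
      moreover have "0 \<le> k2 ^ n * M" using k M0 by simp
      ultimately show ?thesis by (simp add: mult_ac)
    next
      case False
      have "\<kappa> t ^ n * D t \<le> \<kappa> t ^ n * M" using DM \<kappa>0 by (intro mult_left_mono) auto
      also have "\<dots> \<le> k2 ^ n * M" using \<kappa>_far[of t] False \<open>t \<in> J\<close> \<kappa>0 M0 by (intro mult_right_mono power_mono) auto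
      finally show ?thesis using s N0[of t] \<kappa>0[of t] by (simp add: add_increasing)
    qed
    then have "ennreal (\<kappa> t ^ n * D t) \<le> ennreal (s * (\<kappa> t ^ n * N t) + k2 ^ n * M)" by (rule ennreal_leI)
    also have "\<dots> = ennreal s * ennreal (\<kappa> t ^ n * N t) + ennreal (k2 ^ n * M)"
      using s N0[of t] \<kappa>0[of t] k M0 by (simp add: ennreal_plus ennreal_mult)
    finally show ?thesis using True by simp
  qed simp
  have J: "emeasure lborel J = ennreal (2 * pi)" unfolding J_def by simp
  have "(\<integral>\<^sup>+t. ennreal (\<kappa> t ^ n * D t) * indicator J t \<partial>lborel)
      \<le> (\<integral>\<^sup>+t. ennreal s * (ennreal (\<kappa> t ^ n * N t) * indicator J t) + ennreal (k2 ^ n * M) * indicator J t \<partial>lborel)"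
    by (rule nn_integral_mono) (rule pw)
  also have "\<dots> = ennreal s * I + ennreal (k2 ^ n * M) * emeasure lborel J"
    unfolding I_def by (simp add: nn_integral_add nn_integral_cmult nn_integral_cmult_indicator J_def)
  also have "\<dots> = ennreal s * I + ennreal (k2 ^ n * (M * (2 * pi)))"
    unfolding J using k M0 by (simp add: ennreal_mult[symmetric] mult_ac)
  also have "\<dots> \<le> ennreal s * I + ennreal (s' - s) * I"
  proof (intro add_left_mono)
    have "ennreal (k1 ^ n * (N t1 / 2)) * indicator {t1 - e..t1 + e} t \<le> ennreal (\<kappa> t ^ n * N t) * indicator J t" for t
    proof (cases "t \<in> {t1 - e..t1 + e}")
      case True
      then have te: "\<bar>t - t1\<bar> \<le> e" by auto
      have "t \<in> J" using te e(3) \<delta> by (auto simp: J_def)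
      moreover have "k1 ^ n * (N t1 / 2) \<le> \<kappa> t ^ n * N t"
        using \<kappa>_near[OF te] e(2)[OF te] k t1(2) \<kappa>0[of t] by (intro mult_mono power_mono) auto
      ultimately show ?thesis using True by (simp add: ennreal_leI)
    qed simp
    then have "(\<integral>\<^sup>+t. ennreal (k1 ^ n * (N t1 / 2)) * indicator {t1 - e..t1 + e} t \<partial>lborel) \<le> I"
      unfolding I_def by (rule nn_integral_mono)
    moreover have "(\<integral>\<^sup>+t. ennreal (k1 ^ n * (N t1 / 2)) * indicator {t1 - e..t1 + e} t \<partial>lborel)
        = ennreal (k1 ^ n * (N t1 / 2) * (2 * e))"
      using e(1) k t1(2) by (simp add: nn_integral_cmult_indicator ennreal_mult[symmetric])
    ultimately have "ennreal (s' - s) * ennreal (k1 ^ n * (N t1 / 2) * (2 * e)) \<le> ennreal (s' - s) * I"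
      by (intro mult_left_mono) auto
    moreover have "ennreal (k2 ^ n * (M * (2 * pi))) \<le> ennreal (s' - s) * ennreal (k1 ^ n * (N t1 / 2) * (2 * e))"
      using n s k t1(2) e(1) by (simp add: ennreal_mult[symmetric] m_def mult_ac ennreal_leI)
    ultimately show "ennreal (k2 ^ n * (M * (2 * pi))) \<le> ennreal (s' - s) * I" by (rule order_trans[rotated])
  qed
  also have "\<dots> = ennreal s' * I" using s by (simp add: distrib_right[symmetric] ennreal_plus[symmetric])
  finally show ?thesis unfolding I_def by blast
qed

context
  fixes a c :: real
  assumes c_pos: "0 < c" and a_eq: "a = 1 + c"
begin

lemma c_less_a: "c < a" using a_eq by simp

text \<open>This shows that |\<mu>| < 1 on the circle away from z = -1, and at which rate |\<mu>|
  tends to 1 there.\<close>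

lemma cmod_denominator:
  assumes "cmod z = 1"
  shows "(cmod (of_real a + of_real c * z))\<^sup>2 = 1 + a * c * (cmod (1 + z))\<^sup>2"
proof -
  have "(Re z)\<^sup>2 + (Im z)\<^sup>2 = 1" using assms by (metis cmod_power2 one_power2)
  then have i: "Im z * Im z = 1 - Re z * Re z" by (simp add: power2_eq_square algebra_simps)
  show ?thesis
    unfolding cmod_power2 a_eq by (simp add: power2_eq_square algebra_simps i)
qed

lemma cmod_mu_less_1:
  assumes "cmod z = 1" "z \<noteq> -1"
  shows "cmod (mu a c z) < 1"
proof -
  have "0 < a * c * (cmod (1 + z))\<^sup>2"
    using assms(2) c_pos a_pos[OF c_pos a_eq] by (simp add: add_eq_0_iff)
  then have "1\<^sup>2 < (cmod (of_real a + of_real c * z))\<^sup>2" unfolding cmod_denominator[OF assms(1)] by simp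
  then have "1 < cmod (of_real a + of_real c * z)" by (rule power2_less_imp_less) simp
  then show ?thesis by (simp only: mu_def divide_inverse mult_1_left norm_inverse inverse_less_1_iff simp_thms)
qed

text \<open>With y = |1 + z|^2, \<open>cmod_denominator\<close> gives 1 - |\<mu>|^2 = a c y/(1 + a c
  y), so a growth of at most y^(-3) meets the weight y^4.\<close>

lemma weighted_fibN_bound:
  "\<exists>M\<ge>0. \<forall>z. cmod z = 1 \<longrightarrow> z \<noteq> -1 \<longrightarrow> cmod (1 + z) ^ 8 * fibN \<alpha> \<beta> (mu a c z) \<le> M"
proof -
  define K where "K = (cmod \<alpha>)\<^sup>2 + 2 * cmod \<alpha> * cmod \<beta> + 2 * (cmod \<beta>)\<^sup>2"
  have K: "0 \<le> K" by (simp add: K_def)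
  have ac: "0 < a * c" using c_pos a_pos[OF c_pos a_eq] by simp
  define M where "M = K * (4 * (1 + a * c * 4) ^ 3 / (a * c) ^ 3)"
  have "cmod (1 + z) ^ 8 * fibN \<alpha> \<beta> (mu a c z) \<le> M" if z: "cmod z = 1" "z \<noteq> -1" for z
  proof -
    define y where "y = (cmod (1 + z))\<^sup>2"
    have "cmod (1 + z) \<le> 2" using norm_triangle_ineq[of 1 z] z by simp
    then have "(cmod (1 + z))\<^sup>2 \<le> 2\<^sup>2" by (rule power_mono) simp
    then have y: "0 < y" "y \<le> 4" using z by (auto simp: y_def add_eq_0_iff)
    have q: "(cmod (mu a c z))\<^sup>2 = 1 / (1 + a * c * y)"
      unfolding mu_def norm_divide power_divide cmod_denominator[OF z(1)] y_def by simp
    have acy: "0 < a * c * y" using ac y by simp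
    have r: "1 - (cmod (mu a c z))\<^sup>2 = a * c * y / (1 + a * c * y)"
      unfolding q using acy by (simp add: field_simps)
    have "cmod (1 + z) ^ 8 * fibN \<alpha> \<beta> (mu a c z) \<le> y ^ 4 * (K / (a * c * y / (1 + a * c * y)) ^ 3)"
    proof (rule mult_mono)
      show "cmod (1 + z) ^ 8 \<le> y ^ 4" by (simp add: y_def power_mult[symmetric])
      show "fibN \<alpha> \<beta> (mu a c z) \<le> K / (a * c * y / (1 + a * c * y)) ^ 3"
        using fibN_bound[OF cmod_mu_less_1[OF z], of \<alpha> \<beta>] unfolding r K_def .
    qed (use fibN_nonneg[OF cmod_mu_less_1[OF z]] y in auto)
    also have "\<dots> = K * (y * (1 + a * c * y) ^ 3 / (a * c) ^ 3)"
    proof -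
      have "Y ^ 4 * (K / (A * Y / B) ^ 3) = K * (Y * B ^ 3 / A ^ 3)" if "Y > 0" "A > 0" "B > 0" for Y A B :: real
        using that by (simp add: power_divide power_mult_distrib field_simps eval_nat_numeral)
      from this[of y "a * c" "1 + a * c * y"] show ?thesis using y ac acy by simp
    qed
    also have "\<dots> \<le> M"
      unfolding M_def using K y ac acy
      by (intro mult_left_mono divide_right_mono mult_mono power_mono add_left_mono) auto
    finally show ?thesis .
  qed
  moreover have "0 \<le> M" using K ac by (simp add: M_def)
  ultimately show ?thesis by blast
qed

lemma fibre_sums_circle:
  assumes x: "\<And>n z. cmod z = 1 \<Longrightarrow> rowser x n z = v z * ((1 + z) ^ 4 * ((\<alpha> + of_nat n * \<beta>) * mu a c z ^ n))"
    and z: "cmod z = 1"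
  shows "fibre_sq x z = ennreal ((cmod (v z))\<^sup>2 * (cmod (1 + z) ^ 8 * fibN \<alpha> \<beta> (mu a c z)))" (is ?N)
    "cmod \<zeta> = 1 \<Longrightarrow> (\<Sum>n. ennreal ((cmod (\<zeta> * rowser x n z - prev (\<lambda>m. rowser x m z) n))\<^sup>2))
      = ennreal ((cmod (v z))\<^sup>2 * (cmod (1 + z) ^ 8 * fibD \<zeta> \<alpha> \<beta> (mu a c z)))"
    (is "_ \<Longrightarrow> ?D")
proof -
  have "?N \<and> (cmod \<zeta> = 1 \<longrightarrow> ?D)"
  \<comment> \<open>At z = -1 the modulus of \<open>mu\<close> is 1 and the sums behind
    \<open>fibN\<close> and \<open>fibD\<close> need not converge; the factor 1 + z makes both sides
    0.\<close>
  proof (cases "z = -1")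
    case True
    then have "rowser x n z = 0" for n using x[OF z, of n] by simp
    moreover from this have "prev (\<lambda>m. rowser x m z) n = 0" for n by (cases n) auto
    ultimately show ?thesis using True by simp
  next
    case False
    have \<mu>: "cmod (mu a c z) < 1" by (rule cmod_mu_less_1[OF z False])
    define f where "f n = (\<alpha> + of_nat n * \<beta>) * mu a c z ^ n" for n
    define w where "w = v z * (1 + z) ^ 4"
    have xf: "rowser x n z = w * f n" for n using x[OF z, of n] by (simp add: w_def f_def)
    have w2: "(cmod w)\<^sup>2 = (cmod (v z))\<^sup>2 * cmod (1 + z) ^ 8"
      by (simp add: w_def norm_mult norm_power power_mult_distrib power_mult[symmetric])
    have "(\<lambda>n. (cmod w)\<^sup>2 * (cmod (f n))\<^sup>2) sums ((cmod w)\<^sup>2 * fibN \<alpha> \<beta> (mu a c z))"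
      unfolding f_def by (rule sums_mult[OF fibN_sums[OF \<mu>]])
    then have "(\<lambda>n. (cmod (rowser x n z))\<^sup>2) sums ((cmod w)\<^sup>2 * fibN \<alpha> \<beta> (mu a c z))"
      by (simp only: xf norm_mult power_mult_distrib)
    then have ?N
      unfolding w2 mult.assoc by (intro suminf_ennreal_eq) auto
    moreover have ?D if \<zeta>: "cmod \<zeta> = 1"
    proof -
      have "\<zeta> * rowser x n z - prev (\<lambda>m. rowser x m z) n
          = w * (\<zeta> * f n - prev f n)" for n
        unfolding xf by (cases n) (simp_all add: algebra_simps)
      moreover have "(\<lambda>n. (cmod w)\<^sup>2 * (cmod (\<zeta> * f n - prev f n))\<^sup>2)
          sums ((cmod w)\<^sup>2 * fibD \<zeta> \<alpha> \<beta> (mu a c z))"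
        unfolding f_def by (rule sums_mult[OF fibD_sums[OF \<mu> \<zeta>]])
      ultimately have "(\<lambda>n. (cmod (\<zeta> * rowser x n z - prev (\<lambda>m. rowser x m z) n))\<^sup>2)
          sums ((cmod w)\<^sup>2 * fibD \<zeta> \<alpha> \<beta> (mu a c z))"
        by (simp only: norm_mult power_mult_distrib)
      then show ?thesis unfolding w2 mult.assoc by (intro suminf_ennreal_eq) auto
    qed
    ultimately show ?thesis by blast
  qed
  then show ?N and "cmod \<zeta> = 1 \<Longrightarrow> ?D" by blast+
qed

text \<open>The squared fibre norms are bounded on the circle by \<open>weighted_fibN_bound\<close>,
  and integrating them gives square-summability.\<close>

lemma phi_in_ell2:
  obtains x where "coord x = phi a c \<alpha> \<beta>" "Rop1 a c (Rop1 a c x) = 0"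
proof -
  obtain M where M: "0 \<le> M" "\<And>z. cmod z = 1 \<Longrightarrow> z \<noteq> -1 \<Longrightarrow> cmod (1 + z) ^ 8 * fibN \<alpha> \<beta> (mu a c z) \<le> M"
    using weighted_fibN_bound by blast
  have rows: "rowser (phi a c \<alpha> \<beta>) n z = 1 * ((1 + z) ^ 4 * ((\<alpha> + of_nat n * \<beta>) * mu a c z ^ n))"
    if "cmod z = 1" for n z
    unfolding rowser_def mult_1_left using that
    by (intro sums_unique[symmetric] phi_sums c_pos c_less_a) simp
  have le: "fibre_sq (phi a c \<alpha> \<beta>) (cis t) \<le> ennreal M" for t
  proof -
    have "cmod (1 + cis t) ^ 8 * fibN \<alpha> \<beta> (mu a c (cis t)) \<le> M"
      using M by (cases "cis t = -1") auto
    moreover have "fibre_sq (phi a c \<alpha> \<beta>) (cis t)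
        = ennreal ((cmod 1)\<^sup>2 * (cmod (1 + cis t) ^ 8 * fibN \<alpha> \<beta> (mu a c (cis t))))"
      by (rule fibre_sums_circle(1)[where v = "\<lambda>_. 1", OF rows]) simp_all
    ultimately show ?thesis by (simp add: ennreal_leI)
  qed
  have "ennreal (2 * pi) * e2 (phi a c \<alpha> \<beta>)
      = (\<integral>\<^sup>+t. fibre_sq (phi a c \<alpha> \<beta>) (cis t) * indicator {0..0 + 2 * pi} t \<partial>lborel)"
    by (rule fibre_parseval[symmetric, OF phi_summable[OF c_pos c_less_a]])
  also have "\<dots> \<le> (\<integral>\<^sup>+t. ennreal M * indicator {0..0 + 2 * pi} t \<partial>lborel)"
    by (intro nn_integral_mono mult_right_mono le) simp
  also have "\<dots> = ennreal (M * (2 * pi))" using M(1) by (simp add: nn_integral_cmult_indicator ennreal_mult)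
  also have "\<dots> < top" by simp
  finally have "e2 (phi a c \<alpha> \<beta>) < top"
    by (metis ennreal_mult_top ennreal_eq_0_iff linorder_not_le mult_pos_pos pi_gt_zero top.not_eq_extremum zero_less_numeral less_irrefl)
  then obtain x where x: "coord x = phi a c \<alpha> \<beta>" by (rule ell2_of_e2)
  have a0: "a \<noteq> 0" using a_pos[OF c_pos a_eq] by simp
  \<comment> \<open>The first application of \<open>Rop1\<close> takes the difference of \<alpha> +
    n \<beta> in n and leaves the slope; the second annihilates the slope.\<close>
  have R: "coord (Rop1 a c x) (n, j) = \<beta> * Eseq a c n j" for n j
  proof -
    have "coord (Rop1 a c x) (n, j) = (\<alpha> + of_nat (Suc n) * \<beta>) * (of_real a * Eseq a c (Suc n) j
        + of_real c * (case j of 0 \<Rightarrow> 0 | Suc k \<Rightarrow> Eseq a c (Suc n) k)) - (\<alpha> + of_nat n * \<beta>) * Eseq a c n j"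
      unfolding coord_Rop x phi_def by (cases j) (simp_all add: algebra_simps del: Eseq.simps of_nat_Suc)
    then show ?thesis unfolding Eseq_rec[OF a0] by (simp add: algebra_simps)
  qed
  have "coord (Rop1 a c (Rop1 a c x)) (n, j) = \<beta> * (of_real a * Eseq a c (Suc n) j
        + of_real c * (case j of 0 \<Rightarrow> 0 | Suc k \<Rightarrow> Eseq a c (Suc n) k)) - \<beta> * Eseq a c n j" for n j
    unfolding coord_Rop(1)[of a c "Rop1 a c x"] R
    by (cases j) (simp_all add: algebra_simps del: Eseq.simps)
  then have "Rop1 a c (Rop1 a c x) = 0"
    unfolding Eseq_rec[OF a0] by (intro ell2_prod_eqI) simp
  then show ?thesis using that x by blast
qed

end

section \<open>Sharpness of the lower bound\<close>

text \<open>The \<open>V1\<close>-component of \<open>act u x\<close> depends linearly on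
  \<open>u\<close> and satisfies both the \<open>Rop1\<close> and the \<open>Rop2\<close> condition,
  so four coefficients determine it, and some nonzero polynomial makes all four vanish.\<close>

lemma multiple_in_invariant_subspace:
  assumes V1: "csubspace2 V1" and V2: "csubspace2 V2"
    and orth: "\<And>f g. f \<in> V1 \<Longrightarrow> g \<in> V2 \<Longrightarrow> cinner f g = 0"
    and K: "\<And>x. Qop a c (Qop a c x) = 0 \<longleftrightarrow> (\<exists>f\<in>V1. \<exists>g\<in>V2. x = f + g)"
    and i1: "\<And>f. f \<in> V1 \<Longrightarrow> sh1 f \<in> V1" and i2: "\<And>g. g \<in> V2 \<Longrightarrow> sh2 g \<in> V2"
    and a0: "a \<noteq> 0" and x: "Rop1 a c (Rop1 a c x) = 0"
  shows "\<exists>g. g \<noteq> 0 \<and> act g x \<in> V2"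
proof -
  have V2R: "Rop1 a c (Rop1 a c g) = 0" if "g \<in> V2" for g
  proof -
    have "\<exists>f\<in>V1. \<exists>h\<in>V2. sh2 (sh2 g) = f + h"
      using i2[OF i2[OF that]] csubspace2D(1)[OF V1] by (intro bexI[of _ 0] bexI[of _ "sh2 (sh2 g)"]) auto
    then show ?thesis unfolding K[symmetric] Qop_sh .
  qed
  have V1R: "Rop2 a c (Rop2 a c f) = 0" if "f \<in> V1" for f
  proof -
    have "\<exists>g\<in>V1. \<exists>h\<in>V2. sh1 (sh1 f) = g + h"
      using i1[OF i1[OF that]] csubspace2D(1)[OF V2] by (intro bexI[of _ 0] bexI[of _ "sh1 (sh1 f)"]) auto
    then show ?thesis unfolding K[symmetric] Qop_sh .
  qed
  have ker: "csubspace2 {x. Rop1 a c (Rop1 a c x) = 0}"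
    by (simp add: csubspace2_def Rop1_linear)
  have R: "Rop1 a c (Rop1 a c (act u x)) = 0" for u
    using act_in_subspace[OF ker, of x u] x by (simp add: Rop1_sh2)
  have "\<exists>f. f \<in> V1 \<and> act u x - f \<in> V2" for u
  proof -
    have "Qop a c (Qop a c (act u x)) = 0" unfolding Qop_Qop_eq R by simp
    then obtain f g where "f \<in> V1" "g \<in> V2" "act u x = f + g" unfolding K by blast
    then show ?thesis by (intro exI[of _ f]) simp
  qed
  then obtain p1 where p1: "\<And>u. p1 u \<in> V1" "\<And>u. act u x - p1 u \<in> V2" by metis
  \<comment> \<open>Orthogonality makes the decomposition unique, and uniqueness makes the chosen
    \<open>p1\<close> linear.\<close>
  have uniq: "p1 u = f" if "f \<in> V1" "act u x - f \<in> V2" for u f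
  proof -
    have "p1 u - f \<in> V1" using p1(1) that(1) by (rule csubspace2D(4)[OF V1])
    moreover have "(act u x - f) - (act u x - p1 u) \<in> V2" using that(2) p1(2) by (rule csubspace2D(4)[OF V2])
    then have "p1 u - f \<in> V2" by simp
    ultimately have "cinner (p1 u - f) (p1 u - f) = 0" by (rule orth)
    then show ?thesis by (simp add: cinner_self_norm)
  qed
  have add: "p1 (u + v) = p1 u + p1 v" for u v
  proof (rule uniq)
    have "(act u x - p1 u) + (act v x - p1 v) \<in> V2" using p1 by (intro csubspace2D(2)[OF V2])
    then show "act (u + v) x - (p1 u + p1 v) \<in> V2" by (simp add: act_add algebra_simps)
  qed (use p1 csubspace2D(2)[OF V1] in auto)
  have smult: "p1 (smult s u) = s *\<^sub>C p1 u" for s u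
  proof (rule uniq)
    have "s *\<^sub>C (act u x - p1 u) \<in> V2" using p1 by (intro csubspace2D(3)[OF V2])
    then show "act (smult s u) x - s *\<^sub>C p1 u \<in> V2" by (simp add: act_smult scaleC_distrib)
  qed (use p1 csubspace2D(3)[OF V1] in auto)
  \<comment> \<open>\<open>i div 2\<close> and \<open>i mod 2\<close> enumerate the four positions
    with both indices below 2.\<close>
  obtain g where g: "g \<noteq> 0" "\<And>i::nat. i < 4 \<Longrightarrow> coord (p1 g) (i div 2, i mod 2) = 0"
    using poly_common_kernel[of "\<lambda>i u. coord (p1 u) (i div 2, i mod 2)" 0 4] by (auto simp: add smult)
  have "p1 g = 0"
  proof (rule low_degree_eq_0[OF a0 _ V1R[OF p1(1)]])
    have "Rop1 a c (Rop1 a c (p1 g)) = Rop1 a c (Rop1 a c (act g x)) - Rop1 a c (Rop1 a c (act g x - p1 g))"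
      by (simp add: Rop1_linear)
    then show "Rop1 a c (Rop1 a c (p1 g)) = 0" unfolding R V2R[OF p1(2)] by simp
    fix i j :: nat assume "i < 2" "j < 2"
    then show "coord (p1 g) (i, j) = 0" using g(2)[of "2 * i + j"] by simp
  qed
  then show ?thesis using g(1) p1(2)[of g] by auto
qed

lemma isCont_cis [continuous_intros]: "isCont cis t"
  unfolding cis_conv_exp by (intro continuous_intros)

lemma isCont_imp_tendsto_nhds: "isCont f t \<Longrightarrow> (f \<longlongrightarrow> f t) (nhds t)"
  unfolding isCont_def by (simp only: tendsto_at_iff_tendsto_nhds)

lemma cis_inj: "cis s = cis t \<Longrightarrow> \<bar>s - t\<bar> < 2 * pi \<Longrightarrow> s = t"
proof -
  assume eq: "cis s = cis t" and lt: "\<bar>s - t\<bar> < 2 * pi"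
  have "cis (s - t) = 1" using eq by (metis cis_divide cis_neq_zero divide_self)
  then have "cos (s - t) = 1" by (metis cis.sel(1) one_complex.sel(1))
  then obtain n :: int where n: "s - t = of_int n * 2 * pi" using cos_one_2pi_int by blast
  then have "\<bar>of_int n\<bar> * (2 * pi) < 1 * (2 * pi)" using lt by (simp add: abs_mult)
  then have "\<bar>real_of_int n\<bar> < 1" by (simp only: mult_less_cancel_right) auto
  then have "n = 0" by linarith
  then show "s = t" using n by simp
qed

lemma poly_nonzero_on_arc:
  fixes g :: "complex poly"
  assumes "g \<noteq> 0" "0 < \<delta>"
  obtains t where "\<bar>t - t0\<bar> < \<delta>" "poly g (cis t) \<noteq> 0"
proof -
  define T where "T = {t0 <..< t0 + min \<delta> 1}"
  have "infinite T" using assms(2) by (simp add: T_def infinite_Ioo)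
  moreover have "inj_on cis T"
  proof (rule inj_onI)
    fix s t assume "s \<in> T" "t \<in> T" "cis s = cis t"
    then show "s = t" using pi_gt3 by (intro cis_inj) (auto simp: T_def)
  qed
  ultimately have "infinite (cis ` T)" using finite_image_iff by blast
  then have "\<not> cis ` T \<subseteq> {z. poly g z = 0}" using poly_roots_finite[OF assms(1)] finite_subset by blast
  then obtain t where "t \<in> T" "poly g (cis t) \<noteq> 0" by blast
  then show ?thesis by (intro that[of t]) (auto simp: T_def)
qed

text \<open>Equality holds in \<open>fibD_lower\<close> when both the phases and the two terms of the underlying
  arithmetic-geometric mean inequality agree.\<close>
lemma fibD_extremal:
  assumes "cmod \<zeta> = 1" "cmod \<mu> < 1" "\<mu> \<noteq> 0"
  obtains \<alpha> where "fibD \<zeta> \<alpha> 1 \<mu> = (cmod (\<zeta> - cnj \<mu>))\<^sup>2 * fibN \<alpha> 1 \<mu>" "0 < fibN \<alpha> 1 \<mu>"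
proof -
  define q where "q = (cmod \<mu>)\<^sup>2"
  define r where "r = 1 - q"
  have q: "0 < q" "q < 1" using assms by (auto simp: q_def power_less_one_iff abs_square_less_1)
  then have r: "0 < r" by (simp add: r_def)
  \<comment> \<open>Solved from \<open>fibU\<close> = \<zeta> \<mu>/r^2: this phase makes the cross
    term of \<open>fibD_diff\<close> positive, and this modulus balances the two squares behind
    \<open>fibD_lower\<close>.\<close>
  define \<alpha> where "\<alpha> = (\<zeta> * \<mu> / of_real (r\<^sup>2) - of_real (q / r\<^sup>2)) * of_real r"
  have U: "fibU \<alpha> 1 \<mu> = \<zeta> * \<mu> / of_real (r\<^sup>2)"
    using r unfolding fibU_def Let_def q_def[symmetric] r_def[symmetric] \<alpha>_def by simp
  have "(cmod (fibU \<alpha> 1 \<mu>))\<^sup>2 = q / r ^ 4"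
    unfolding U using r assms(1) by (simp add: norm_divide norm_mult power_divide q_def norm_power)
  then have N: "fibN \<alpha> 1 \<mu> = 2 * q / r ^ 3"
    unfolding fibN_eq[OF assms(2)] q_def[symmetric] r_def[symmetric] using r
    by (simp add: field_simps eval_nat_numeral)
  have "cnj \<zeta> * cnj \<mu> * cnj 1 * fibU \<alpha> 1 \<mu> = (\<zeta> * cnj \<zeta>) * (\<mu> * cnj \<mu>) / of_real (r\<^sup>2)"
    unfolding U by simp
  also have "\<dots> = of_real (q / r\<^sup>2)"
    unfolding complex_norm_square[symmetric] assms(1) q_def by simp
  finally have Re: "Re (cnj \<zeta> * cnj \<mu> * cnj 1 * fibU \<alpha> 1 \<mu>) = q / r\<^sup>2" by (simp only: Re_complex_of_real)
  have "fibD \<zeta> \<alpha> 1 \<mu> - (cmod (\<zeta> - cnj \<mu>))\<^sup>2 * fibN \<alpha> 1 \<mu> = r * (2 * q / r ^ 3) - 2 * (q / r\<^sup>2)"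
    by (subst fibD_diff[OF assms(1)]) (simp only: Re N r_def q_def)
  also have "\<dots> = 0" using r by (simp add: eval_nat_numeral)
  finally have "fibD \<zeta> \<alpha> 1 \<mu> = (cmod (\<zeta> - cnj \<mu>))\<^sup>2 * fibN \<alpha> 1 \<mu>" by simp
  moreover have "0 < fibN \<alpha> 1 \<mu>" unfolding N using q r by simp
  ultimately show ?thesis by (rule that)
qed

context
  fixes a c :: real
  assumes c_pos: "0 < c" and a_eq: "a = 1 + c"
begin

text \<open>The zero nearest to \<zeta> lies on the ray from the centre of the disc towards \<zeta>,
  and z is its preimage on the circle. The value z = -1 belongs to the zero 1, hence to the
  direction \<zeta> = 1.\<close>

lemma circle_point_for_direction:
  assumes "cmod \<zeta> = 1" "\<zeta> \<noteq> 1"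
  obtains z where "cmod z = 1" "z \<noteq> -1" "cmod (\<zeta> - cnj (mu a c z)) = gap a c \<zeta>" "mu a c z \<noteq> 0"
proof -
  let ?A = "complex_of_real (a / (a + c))" and ?C = "complex_of_real (c / (a + c))"
  have ap: "0 < a" using a_pos[OF c_pos a_eq] .
  have ne: "\<zeta> \<noteq> ?A"
  proof
    assume "\<zeta> = ?A"
    then have "a / (a + c) = 1" using assms(1) ap c_pos by (simp only: norm_of_real) simp
    then show False using ap c_pos by simp
  qed
  define e where "e = (\<zeta> - ?A) / of_real (cmod (\<zeta> - ?A))"
  have e1: "cmod e = 1" using ne by (simp add: e_def norm_divide del: of_real_divide)
  have \<zeta>e: "\<zeta> = ?A + of_real (cmod (\<zeta> - ?A)) * e" using ne by (simp add: e_def del: of_real_divide)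
  have "e \<noteq> 1"
  proof
    assume "e = 1"
    then have "\<zeta> = of_real (a / (a + c) + cmod (\<zeta> - ?A))" using \<zeta>e by (simp only: of_real_add mult_1_right)
    moreover have "0 \<le> a / (a + c) + cmod (\<zeta> - ?A)" using ap c_pos by simp
    ultimately show False using assms by (metis abs_of_nonneg norm_of_real of_real_1)
  qed
  \<comment> \<open>w/(a + c) is the conjugate of the nearest zero; solving 1/(a + c z) = w/(a + c)
    with a^2 - c^2 = a + c gives z = -v/w.\<close>
  define w where "w = of_real a + of_real c * cnj e"
  define v where "v = of_real c + of_real a * cnj e"
  have "(cmod w)\<^sup>2 - (cmod v)\<^sup>2 = (a\<^sup>2 - c\<^sup>2) * (1 - (cmod e)\<^sup>2)"
    unfolding cmod_power2 w_def v_def by (simp add: power2_eq_square algebra_simps)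
  then have wv: "cmod w = cmod v" using e1 by simp
  have "a - c \<le> cmod w"
    using norm_diff_ineq[of "of_real a" "of_real c * cnj e"] c_pos ap e1 by (simp add: w_def norm_mult)
  then have w0: "w \<noteq> 0" using a_eq by auto
  define z where "z = - v / w"
  have z1: "cmod z = 1" using w0 unfolding z_def norm_divide norm_minus_cancel wv[symmetric] by simp
  have "z \<noteq> -1"
  proof
    assume "z = -1"
    then have "v = w" using w0 by (simp add: z_def field_simps)
    then have "(of_real a - of_real c) * (cnj e - 1) = 0" by (simp add: v_def w_def algebra_simps)
    then have "cnj e = 1" using a_eq by simp
    then show False using \<open>e \<noteq> 1\<close> by (metis complex_cnj_cnj complex_cnj_one)
  qed
  have "(of_real a + of_real c * z) * w = of_real a * w - of_real c * v" using w0 by (simp add: z_def algebra_simps)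
  also have "\<dots> = of_real (a + c)" by (simp add: v_def w_def a_eq algebra_simps)
  finally have "of_real a + of_real c * z = of_real (a + c) / w" using w0 by (simp add: eq_divide_eq del: of_real_add)
  then have mu: "mu a c z = w / of_real (a + c)" by (simp only: mu_def divide_divide_eq_right mult_1_left)
  have "cnj (mu a c z) = ?A + ?C * e"
    unfolding mu w_def by (simp add: add_divide_distrib)
  then have "\<zeta> - cnj (mu a c z) = (of_real (cmod (\<zeta> - ?A)) - ?C) * e" using \<zeta>e by (simp add: algebra_simps)
  also have "\<dots> = of_real (gap a c \<zeta>) * e" unfolding gap_def[OF c_pos a_eq] by (simp only: of_real_diff)
  finally have "cmod (\<zeta> - cnj (mu a c z)) = \<bar>gap a c \<zeta>\<bar>" by (simp only: norm_mult norm_of_real e1 mult_1_right)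
  then have "cmod (\<zeta> - cnj (mu a c z)) = gap a c \<zeta>" using gap_nonneg[OF c_pos a_eq assms(1)] by simp
  moreover have "mu a c z \<noteq> 0" unfolding mu using w0 ap c_pos by (simp del: of_real_add)
  ultimately show ?thesis using z1 \<open>z \<noteq> -1\<close> that by blast
qed

lemma rowser_shift_diff:
  assumes "\<And>n. summable (\<lambda>j. cmod (coord h (n, j)))" "cmod z = 1"
  shows "rowser (coord (\<zeta> *\<^sub>C h - sh1 h)) n z
    = \<zeta> * rowser (coord h) n z - prev (\<lambda>m. rowser (coord h) m z) n"
    "summable (\<lambda>j. cmod (coord (\<zeta> *\<^sub>C h - sh1 h) (n, j)))"
proof -
  have s: "(\<lambda>j. coord h (m, j) * z ^ j) sums rowser (coord h) m z" for m
    unfolding rowser_def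
    by (rule summable_sums[OF summable_norm_cancel]) (use assms in \<open>simp add: norm_mult norm_power\<close>)
  have "(\<lambda>j. coord (sh1 h) (n, j) * z ^ j) sums prev (\<lambda>m. rowser (coord h) m z) n"
    using s by (cases n) simp_all
  from sums_diff[OF sums_mult[OF s[of n], of \<zeta>] this]
  have "(\<lambda>j. coord (\<zeta> *\<^sub>C h - sh1 h) (n, j) * z ^ j) sums
      (\<zeta> * rowser (coord h) n z - prev (\<lambda>m. rowser (coord h) m z) n)"
    by (simp add: algebra_simps)
  then show "rowser (coord (\<zeta> *\<^sub>C h - sh1 h)) n z
    = \<zeta> * rowser (coord h) n z - prev (\<lambda>m. rowser (coord h) m z) n"
    unfolding rowser_def[of "coord (\<zeta> *\<^sub>C h - sh1 h)"] by (rule sums_unique[symmetric])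
  show "summable (\<lambda>j. cmod (coord (\<zeta> *\<^sub>C h - sh1 h) (n, j)))"
  proof (rule summable_comparison_test')
    show "summable (\<lambda>j. cmod \<zeta> * cmod (coord h (n, j)) + cmod (coord (sh1 h) (n, j)))"
      using assms(1) by (intro summable_add summable_mult) (cases n; simp)+
    show "norm (cmod (coord (\<zeta> *\<^sub>C h - sh1 h) (n, j))) \<le> cmod \<zeta> * cmod (coord h (n, j)) + cmod (coord (sh1 h) (n, j))" for j
      using norm_triangle_ineq4[of "\<zeta> * coord h (n, j)" "coord (sh1 h) (n, j)"] by (simp add: norm_mult)
  qed
qed

lemma isCont_fib:
  assumes "cis t \<noteq> -1"
  shows "isCont (\<lambda>t. fibN \<alpha> \<beta> (mu a c (cis t))) t" "isCont (\<lambda>t. fibD \<zeta> \<alpha> \<beta> (mu a c (cis t))) t"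
proof -
  have "cmod (of_real a + of_real c * cis t) \<noteq> 0"
    using zero_locus_disc(2)[OF c_pos a_eq, of "cis t"] by simp
  then have w: "of_real a + of_real c * cis t \<noteq> 0" by simp
  have \<mu>: "isCont (\<lambda>t. mu a c (cis t)) t"
    unfolding mu_def using w by (intro continuous_intros) auto
  have "(cmod (mu a c (cis t)))\<^sup>2 < 1"
    using cmod_mu_less_1[OF c_pos a_eq _ assms] by (simp add: power_less_one_iff abs_square_less_1)
  then have q: "1 - (cmod (mu a c (cis t)))\<^sup>2 \<noteq> 0" by simp
  show N: "isCont (\<lambda>t. fibN \<alpha> \<beta> (mu a c (cis t))) t"
    unfolding fibN_def Let_def using q by (intro continuous_intros \<mu>) auto
  have U: "isCont (\<lambda>t. fibU \<alpha> \<beta> (mu a c (cis t))) t"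
    unfolding fibU_def Let_def using q by (intro continuous_intros \<mu>) (auto simp del: of_real_diff)
  show "isCont (\<lambda>t. fibD \<zeta> \<alpha> \<beta> (mu a c (cis t))) t"
    using \<mu> N U unfolding fibD_def isCont_def by (intro tendsto_intros)
qed

text \<open>Take the test function that is extremal over the nearest point \<open>z0\<close>, move
  it into \<open>V\<close> by a polynomial \<open>g\<close>, and multiply by powers of a polynomial
  peaking at \<open>z0\<close>, under which \<open>V\<close> is invariant.\<close>

lemma near_optimal_generic:
  assumes V: "csubspace2 V" "\<And>g. g \<in> V \<Longrightarrow> sh2 g \<in> V"
    and mult: "\<And>x. Rop1 a c (Rop1 a c x) = 0 \<Longrightarrow> \<exists>g. g \<noteq> 0 \<and> act g x \<in> V"
    and \<zeta>: "cmod \<zeta> = 1" "\<zeta> \<noteq> 1" and \<epsilon>: "0 < \<epsilon>"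
  shows "\<exists>h\<in>V. h \<noteq> 0 \<and> norm (\<zeta> *\<^sub>C h - sh1 h) \<le> (gap a c \<zeta> + \<epsilon>) * norm h"
proof -
  obtain z0 where z0: "cmod z0 = 1" "z0 \<noteq> -1" "cmod (\<zeta> - cnj (mu a c z0)) = gap a c \<zeta>" "mu a c z0 \<noteq> 0"
    using circle_point_for_direction[OF \<zeta>] by blast
  define t0 where "t0 = Arg z0"
  have t0: "cis t0 = z0" using z0(1) cis_Arg[of z0] by (cases "z0 = 0") (auto simp: t0_def sgn_eq)
  have d0: "0 \<le> gap a c \<zeta>" by (rule gap_nonneg[OF c_pos a_eq \<zeta>(1)])
  obtain \<alpha> where \<alpha>: "fibD \<zeta> \<alpha> 1 (mu a c z0) = (gap a c \<zeta>)\<^sup>2 * fibN \<alpha> 1 (mu a c z0)" "0 < fibN \<alpha> 1 (mu a c z0)"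
    using fibD_extremal[OF \<zeta>(1) cmod_mu_less_1[OF c_pos a_eq z0(1,2)] z0(4)] unfolding z0(3) by blast
  obtain x where x: "coord x = phi a c \<alpha> 1" "Rop1 a c (Rop1 a c x) = 0"
    using phi_in_ell2[OF c_pos a_eq] by blast
  obtain g where g: "g \<noteq> 0" "act g x \<in> V" using mult[OF x(2)] by blast
  let ?N = "\<lambda>t. fibN \<alpha> 1 (mu a c (cis t))" and ?D = "\<lambda>t. fibD \<zeta> \<alpha> 1 (mu a c (cis t))"
  define N where "N t = (cmod (poly g (cis t)))\<^sup>2 * (cmod (1 + cis t) ^ 8 * ?N t)" for t
  define D where "D t = (cmod (poly g (cis t)))\<^sup>2 * (cmod (1 + cis t) ^ 8 * ?D t)" for t
  \<comment> \<open>Half of \<epsilon> is spent on continuity near \<open>t0\<close>, the other half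
    on concentration.\<close>
  define s where "s = (gap a c \<zeta> + \<epsilon> / 2)\<^sup>2"
  define s' where "s' = (gap a c \<zeta> + \<epsilon>)\<^sup>2"
  have s: "0 \<le> s" "s < s'" using d0 \<epsilon> by (auto simp: s_def s'_def intro!: power_strict_mono)
  have fibN0: "0 \<le> ?N t" if "cis t \<noteq> -1" for t
    by (rule fibN_nonneg[OF cmod_mu_less_1[OF c_pos a_eq _ that]]) simp
  have N0: "0 \<le> N t" for t using fibN0[of t] by (cases "cis t = -1") (auto simp: N_def)
  obtain B where B: "0 \<le> B" "\<And>z. cmod z = 1 \<Longrightarrow> z \<noteq> -1 \<Longrightarrow> cmod (1 + z) ^ 8 * fibN \<alpha> 1 (mu a c z) \<le> B"
    using weighted_fibN_bound[OF c_pos a_eq] by blast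
  have "compact ((\<lambda>z. (cmod (poly g z))\<^sup>2) ` sphere 0 1)"
    by (intro compact_continuous_image continuous_intros) auto
  then have "bdd_above ((\<lambda>z. (cmod (poly g z))\<^sup>2) ` sphere 0 1)"
    by (intro bounded_imp_bdd_above compact_imp_bounded)
  then obtain G where "\<forall>z\<in>sphere 0 1. (cmod (poly g z))\<^sup>2 \<le> G" unfolding bdd_above_def by auto
  then have G: "(cmod (poly g z))\<^sup>2 \<le> G" if "cmod z = 1" for z using that by simp
  have G0: "0 \<le> G" using order_trans[OF zero_le_power2 G[of 1]] by simp
  have DM: "D t \<le> G * (4 * B)" for t
  proof (cases "cis t = -1")
    case True
    then show ?thesis using G0 B(1) by (simp add: D_def)
  next
    case False
    have "cmod (1 + cis t) ^ 8 * ?D t \<le> cmod (1 + cis t) ^ 8 * (4 * ?N t)"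
      using fibD_le[OF cmod_mu_less_1[OF c_pos a_eq _ False] \<zeta>(1)] by (intro mult_left_mono) auto
    also have "\<dots> \<le> 4 * B" using B(2)[of "cis t"] False by simp
    finally have "D t \<le> (cmod (poly g (cis t)))\<^sup>2 * (4 * B)" unfolding D_def by (rule mult_left_mono) simp
    also have "\<dots> \<le> G * (4 * B)" using B(1) G by (intro mult_right_mono) auto
    finally show ?thesis .
  qed
  have ev: "\<forall>\<^sub>F t in nhds t0. ?D t - s * ?N t < 0
      \<and> 0 < ?N t \<and> 0 < cmod (1 + cis t)"
  proof (intro eventually_conj)
    have c: "cis t0 \<noteq> -1" using t0 z0 by simp
    have "isCont (\<lambda>t. ?D t - s * ?N t) t0"
      by (intro continuous_intros isCont_fib[OF c])
    then have "((\<lambda>t. ?D t - s * ?N t) \<longlongrightarrow>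
        ?D t0 - s * ?N t0) (nhds t0)"
      by (rule isCont_imp_tendsto_nhds)
    moreover have "?D t0 - s * ?N t0 < 0"
    proof -
      have "(gap a c \<zeta>)\<^sup>2 < s" unfolding s_def using d0 \<epsilon> by (intro power_strict_mono) auto
      then have "(gap a c \<zeta>)\<^sup>2 * fibN \<alpha> 1 (mu a c z0) < s * fibN \<alpha> 1 (mu a c z0)" using \<alpha>(2) by (rule mult_strict_right_mono)
      then show ?thesis by (simp add: t0 \<alpha>(1))
    qed
    ultimately show "\<forall>\<^sub>F t in nhds t0. ?D t - s * ?N t < 0"
      by (rule order_tendstoD)
    have "((\<lambda>t. ?N t) \<longlongrightarrow> ?N t0) (nhds t0)"
      by (rule isCont_imp_tendsto_nhds[OF isCont_fib(1)[OF c]])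
    then show "\<forall>\<^sub>F t in nhds t0. 0 < ?N t"
      by (rule order_tendstoD) (simp add: t0 \<alpha>(2))
    have "isCont (\<lambda>t. cmod (1 + cis t)) t0" by (intro continuous_intros)
    then have "((\<lambda>t. cmod (1 + cis t)) \<longlongrightarrow> cmod (1 + cis t0)) (nhds t0)"
      by (rule isCont_imp_tendsto_nhds)
    then show "\<forall>\<^sub>F t in nhds t0. 0 < cmod (1 + cis t)"
      by (rule order_tendstoD) (use c in \<open>simp add: add_eq_0_iff\<close>)
  qed
  then obtain \<delta>' where \<delta>': "0 < \<delta>'" "\<And>t. \<bar>t - t0\<bar> < \<delta>' \<Longrightarrow>
      ?D t - s * ?N t < 0
      \<and> 0 < ?N t \<and> 0 < cmod (1 + cis t)"
    unfolding eventually_nhds_metric dist_real_def by auto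
  define \<delta> where "\<delta> = min \<delta>' 1"
  have \<delta>: "0 < \<delta>" "\<delta> < pi" "\<delta> \<le> \<delta>'" using \<delta>'(1) pi_gt3 by (auto simp: \<delta>_def)
  have near: "D t \<le> s * N t" if "\<bar>t - t0\<bar> < \<delta>" for t
  proof -
    have "?D t \<le> s * ?N t" using \<delta>'(2)[of t] that \<delta>(3) by auto
    then have "D t \<le> (cmod (poly g (cis t)))\<^sup>2 * (cmod (1 + cis t) ^ 8 * (s * ?N t))"
      unfolding D_def by (intro mult_left_mono) auto
    then show ?thesis by (simp add: N_def mult_ac)
  qed
  obtain t1 where t1: "\<bar>t1 - t0\<bar> < \<delta>" "poly g (cis t1) \<noteq> 0" using poly_nonzero_on_arc[OF g(1) \<delta>(1)] by blast
  have P1: "0 < ?N t1" "0 < cmod (1 + cis t1)" using \<delta>'(2)[of t1] t1(1) \<delta>(3) by auto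
  then have Nt1: "0 < N t1" using t1(2) by (simp add: N_def)
  have ct1: "cis t1 \<noteq> -1" using P1(2) by auto
  have Ncont: "isCont N t1" unfolding N_def by (intro continuous_intros isCont_fib[OF ct1])
  have [measurable]: "N \<in> borel_measurable borel"
  proof -
    have [measurable]: "(\<lambda>t. poly g (cis t)) \<in> borel_measurable borel"
      by (intro borel_measurable_continuous_onI continuous_intros)
    show ?thesis unfolding N_def fibN_def mu_def Let_def by measurable
  qed
  define \<kappa> where "\<kappa> t = (1 + cos (t - t0)) / 2" for t
  define J where "J = {t0 - pi..t0 - pi + 2 * pi}"
  obtain n where n: "(\<integral>\<^sup>+t. ennreal (\<kappa> t ^ n * D t) * indicator J t \<partial>lborel)
       \<le> ennreal s' * (\<integral>\<^sup>+t. ennreal (\<kappa> t ^ n * N t) * indicator J t \<partial>lborel)"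
    using concentration[of N D "G * (4 * B)" \<delta> s s' t0 t1] N0 DM G0 B(1) \<delta> s near t1(1) Nt1 Ncont
    unfolding \<kappa>_def J_def by auto
  \<comment> \<open>On the circle (1 + cnj z0 z)/2 has squared modulus (1 + cos (t - t0))/2, the
    kernel of \<open>concentration\<close>.\<close>
  define k where "k = [:1 / 2, cnj z0 / 2:]"
  define u where "u = k ^ n * g"
  define h where "h = act u x"
  define y where "y = \<zeta> *\<^sub>C h - sh1 h"
  have hV: "h \<in> V" unfolding h_def u_def act_mult by (rule act_in_subspace[OF V g(2)])
  have sx: "summable (\<lambda>j. cmod (coord x (n, j)))" for n unfolding x by (rule phi_summable[OF c_pos c_less_a[OF c_pos a_eq]])
  have sh: "summable (\<lambda>j. cmod (coord h (n, j)))" for n unfolding h_def by (rule act_summable[OF sx])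
  have sy: "summable (\<lambda>j. cmod (coord y (n, j)))" for n
    unfolding y_def by (rule rowser_shift_diff(2)[OF sh, of 1]) simp
  have rh: "rowser (coord h) n z = poly u z * ((1 + z) ^ 4 * ((\<alpha> + of_nat n * 1) * mu a c z ^ n))" if "cmod z = 1" for n z
    unfolding rowser_def h_def
    by (intro sums_unique[symmetric] act_sums, unfold x, rule phi_sums[OF c_pos c_less_a[OF c_pos a_eq]]) (use that in simp)
  have \<kappa>: "(cmod (poly k (cis t)))\<^sup>2 = \<kappa> t" for t
  proof -
    have pk: "poly k (cis t) = (1 + cis (t - t0)) / 2"
      unfolding k_def t0[symmetric] cis_cnj by (simp add: cis_mult add_divide_distrib)
    have "(cmod (poly k (cis t)))\<^sup>2 = (cmod (1 + cis (t - t0)))\<^sup>2 / 4"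
      unfolding pk by (simp add: norm_divide power_divide)
    also have "(cmod (1 + cis (t - t0)))\<^sup>2 = 2 + 2 * cos (t - t0)"
      unfolding cmod_power2 using sin_cos_squared_add[of "t - t0"] by (simp add: power2_eq_square algebra_simps)
    finally show ?thesis by (simp add: \<kappa>_def)
  qed
  have u2: "(cmod (poly u (cis t)))\<^sup>2 = \<kappa> t ^ n * (cmod (poly g (cis t)))\<^sup>2" for t
  proof -
    have "(cmod (poly u (cis t)))\<^sup>2 = ((cmod (poly k (cis t)))\<^sup>2) ^ n * (cmod (poly g (cis t)))\<^sup>2"
      by (simp add: u_def norm_mult norm_power power_mult_distrib power_mult[symmetric] mult.commute)
    then show ?thesis unfolding \<kappa> .
  qed
  have fh: "fibre_sq (coord h) (cis t) = ennreal (\<kappa> t ^ n * N t)" for t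
    using fibre_sums_circle(1)[where x = "coord h" and v = "poly u" and z = "cis t", OF c_pos a_eq rh norm_cis]
    unfolding u2 N_def mult.assoc .
  have fy: "fibre_sq (coord y) (cis t) = ennreal (\<kappa> t ^ n * D t)" for t
    using fibre_sums_circle(2)[where x = "coord h" and v = "poly u" and z = "cis t", OF c_pos a_eq rh norm_cis \<zeta>(1)]
    unfolding u2 D_def mult.assoc y_def rowser_shift_diff(1)[OF sh norm_cis] .
  have "h \<noteq> 0"
  proof
    assume "h = 0"
    then have "ennreal (\<kappa> t1 ^ n * N t1) = 0" using fh[of t1] by (simp add: rowser_def)
    moreover have "0 < \<kappa> t1"
    proof -
      have "cos pi < cos \<bar>t1 - t0\<bar>" using t1(1) \<delta> by (intro cos_monotone_0_pi) auto
      then show ?thesis by (simp add: \<kappa>_def)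
    qed
    then have "0 < \<kappa> t1 ^ n * N t1" using Nt1 by simp
    ultimately show False by (simp add: ennreal_eq_0_iff)
  qed
  moreover have "norm y \<le> (gap a c \<zeta> + \<epsilon>) * norm h"
  proof -
    have "ennreal (2 * pi) * ennreal ((norm y)\<^sup>2) \<le> ennreal s' * (ennreal (2 * pi) * ennreal ((norm h)\<^sup>2))"
      using n unfolding fh[symmetric] fy[symmetric] J_def
        fibre_parseval[of "coord h", OF sh] fibre_parseval[of "coord y", OF sy] e2_coord .
    then have "ennreal (2 * pi * (norm y)\<^sup>2) \<le> ennreal (s' * (2 * pi * (norm h)\<^sup>2))"
      using s by (simp add: ennreal_mult)
    then have "2 * pi * (norm y)\<^sup>2 \<le> s' * (2 * pi * (norm h)\<^sup>2)"
      using s by (subst (asm) ennreal_le_iff) auto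
    then have "(norm y)\<^sup>2 \<le> s' * (norm h)\<^sup>2" by simp
    then have "(norm y)\<^sup>2 \<le> ((gap a c \<zeta> + \<epsilon>) * norm h)\<^sup>2" by (simp add: s'_def power_mult_distrib)
    then show ?thesis by (rule power2_le_imp_le) (use d0 \<epsilon> in simp)
  qed
  ultimately show ?thesis using hV unfolding y_def by blast
qed

lemma gap_lipschitz: "gap a c \<zeta> \<le> gap a c \<zeta>' + cmod (\<zeta> - \<zeta>')"
  unfolding gap_def[OF c_pos a_eq]
  using norm_triangle_ineq[of "\<zeta> - \<zeta>'" "\<zeta>' - of_real (a / (a + c))"] by simp

text \<open>For \<zeta> = 1 the nearest zero lies over z2 = -1, where the test functions vanish. A
  nearby direction \<open>cis t\<close> serves instead, at a cost of |cis t - 1| once in the norm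
  and once in \<open>gap\<close>.\<close>

lemma near_optimal:
  assumes V: "csubspace2 V" "\<And>g. g \<in> V \<Longrightarrow> sh2 g \<in> V"
    and mult: "\<And>x. Rop1 a c (Rop1 a c x) = 0 \<Longrightarrow> \<exists>g. g \<noteq> 0 \<and> act g x \<in> V"
    and \<zeta>: "cmod \<zeta> = 1" and \<epsilon>: "0 < \<epsilon>"
  shows "\<exists>h\<in>V. h \<noteq> 0 \<and> norm (\<zeta> *\<^sub>C h - sh1 h) \<le> (gap a c \<zeta> + \<epsilon>) * norm h"
proof (cases "\<zeta> = 1")
  case True
  have "isCont (\<lambda>t. cmod (cis t - 1)) 0" by (intro continuous_intros)
  then have "((\<lambda>t. cmod (cis t - 1)) \<longlongrightarrow> 0) (at 0)" by (simp add: isCont_def)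
  then have "\<forall>\<^sub>F t in at 0. cmod (cis t - 1) < \<epsilon> / 4" using \<epsilon> by (intro order_tendstoD) auto
  then obtain d where d: "0 < d" "\<And>t. t \<noteq> 0 \<Longrightarrow> \<bar>t\<bar> < d \<Longrightarrow> cmod (cis t - 1) < \<epsilon> / 4"
    unfolding eventually_at by (auto simp: dist_real_def)
  define t where "t = min (d / 2) 1"
  have t: "t \<noteq> 0" "\<bar>t\<bar> < d" "\<bar>t\<bar> \<le> 1" using d(1) by (auto simp: t_def)
  have close: "cmod (cis t - 1) < \<epsilon> / 4" using d(2) t by blast
  have "cis t \<noteq> 1" using cis_inj[of t 0] t pi_gt3 by auto
  then obtain h where h: "h \<in> V" "h \<noteq> 0" "norm (cis t *\<^sub>C h - sh1 h) \<le> (gap a c (cis t) + \<epsilon> / 4) * norm h"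
    using near_optimal_generic[OF V mult _ _, of "cis t" "\<epsilon> / 4"] \<epsilon> by auto
  have "h - sh1 h = (cis t *\<^sub>C h - sh1 h) - (cis t - 1) *\<^sub>C h" by (rule ell2_eqI) (simp add: algebra_simps)
  then have "norm (h - sh1 h) \<le> norm (cis t *\<^sub>C h - sh1 h) + norm ((cis t - 1) *\<^sub>C h)"
    by (metis norm_triangle_ineq4)
  also have "\<dots> \<le> (gap a c (cis t) + \<epsilon> / 4) * norm h + \<epsilon> / 4 * norm h"
    by (intro add_mono h(3)) (simp only: norm_scaleC mult_right_mono[OF less_imp_le[OF close] norm_ge_zero])
  also have "\<dots> = (gap a c (cis t) + \<epsilon> / 2) * norm h" by (simp add: algebra_simps)
  also have "\<dots> \<le> (gap a c 1 + \<epsilon>) * norm h"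
    using gap_lipschitz[of "cis t" 1] close \<epsilon> by (intro mult_right_mono) auto
  finally show ?thesis using h True by auto
next
  case False
  then show ?thesis using near_optimal_generic[OF V mult \<zeta> _ \<epsilon>] by blast
qed

end

section \<open>Convexity of the numerical range\<close>

text \<open>An affine change gives a form with \<open>B x x = 0\<close> and
  \<open>B y y = 1\<close>. After a rotation of \<open>x\<close> the form is real on the segment
  from \<open>x\<close> to \<open>y\<close>, and the intermediate value theorem reaches p.\<close>

lemma convex_numerical_range:
  fixes T :: "'a ell2 \<Rightarrow> 'a ell2"
  assumes V: "csubspace2 V" and add: "\<And>x y. T (x + y) = T x + T y" and scale: "\<And>s x. T (s *\<^sub>C x) = s *\<^sub>C T x"
  shows "convex {cinner (T h) h |h. h \<in> V \<and> norm h = 1}"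
proof (rule convexI)
  fix w1 w2 :: complex and p' p :: real
  assume "w1 \<in> {cinner (T h) h |h. h \<in> V \<and> norm h = 1}" "w2 \<in> {cinner (T h) h |h. h \<in> V \<and> norm h = 1}"
    and p: "0 \<le> p'" "0 \<le> p" "p' + p = 1"
  then obtain x y where x: "x \<in> V" "norm x = 1" "w1 = cinner (T x) x"
    and y: "y \<in> V" "norm y = 1" "w2 = cinner (T y) y" by auto
  have p': "p' = 1 - p" "p \<le> 1" using p by auto
  show "p' *\<^sub>R w1 + p *\<^sub>R w2 \<in> {cinner (T h) h |h. h \<in> V \<and> norm h = 1}"
  proof (cases "w1 = w2")
    case True
    then have "p' *\<^sub>R w1 + p *\<^sub>R w2 = w1" using p(3) by (simp add: scaleR_left_distrib[symmetric])
    then show ?thesis using x by auto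
  next
    case False
    define B where "B f g = (cinner (T f) g - w1 * cinner f g) / (w2 - w1)" for f g
    have d: "w2 - w1 \<noteq> 0" using False by simp
    have B_add: "B (f + f') g = B f g + B f' g" "B g (f + f') = B g f + B g f'" for f f' g
      by (simp_all add: B_def add cinner_simps distrib_left add_divide_distrib diff_divide_distrib)
    have B_scale: "B (s *\<^sub>C f) g = s * B f g" "B g (s *\<^sub>C f) = cnj s * B g f" for s f g
      by (simp_all add: B_def scale cinner_simps right_diff_distrib mult_ac)
    have B_eq: "cinner (T f) f = w1 * of_real ((norm f)\<^sup>2) + (w2 - w1) * B f f" for f
      using d by (simp add: B_def cinner_self_norm)
    have Bx: "B x x = 0" and By: "B y y = 1"
      using d x y by (simp_all add: B_def cinner_self_norm)
    \<comment> \<open>The imaginary part of the mixed terms is that of \<theta> k, and \<theta>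
      rotates \<open>k\<close> onto the nonnegative axis.\<close>
    define k where "k = B x y - cnj (B y x)"
    define \<theta> where "\<theta> = (if k = 0 then 1 else cnj k / of_real (cmod k))"
    have \<theta>: "cmod \<theta> = 1" by (simp add: \<theta>_def norm_divide)
    have "Im (\<theta> * k) = 0"
    proof (cases "k = 0")
      case False
      have "\<theta> * k = k * cnj k / of_real (cmod k)" using False by (simp add: \<theta>_def)
      also have "\<dots> = of_real ((cmod k)\<^sup>2 / cmod k)" unfolding complex_norm_square[symmetric] by simp
      finally show ?thesis by (simp only: Im_complex_of_real)
    qed simp
    define m where "m = Re (\<theta> * B x y + cnj \<theta> * B y x)"
    have m: "\<theta> * B x y + cnj \<theta> * B y x = of_real m"
    proof (rule complex_eqI)
      have "Im (\<theta> * B x y + cnj \<theta> * B y x) = Im (\<theta> * k)" by (simp add: k_def algebra_simps)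
      then show "Im (\<theta> * B x y + cnj \<theta> * B y x) = Im (of_real m)" using \<open>Im (\<theta> * k) = 0\<close> by simp
    qed (simp add: m_def)
    define z where "z t = of_real (1 - t) *\<^sub>C \<theta> *\<^sub>C x + of_real t *\<^sub>C y" for t :: real
    have zV: "z t \<in> V" for t unfolding z_def using x y by (intro csubspace2D[OF V])
    have Bz: "B (z t) (z t) = of_real (t\<^sup>2 + t * (1 - t) * m)" for t
    proof -
      have "B (z t) (z t) = of_real ((1 - t)\<^sup>2) * (\<theta> * cnj \<theta>) * B x x
          + of_real (t * (1 - t)) * (\<theta> * B x y + cnj \<theta> * B y x) + of_real (t\<^sup>2) * B y y"
        by (simp add: z_def B_add B_scale power2_eq_square algebra_simps)
      then show ?thesis unfolding m Bx By by simp
    qed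
    \<comment> \<open>If the segment met 0, then \<open>y\<close> would be a multiple of
      \<open>x\<close>, against \<open>B y y = 1\<close>.\<close>
    have z0: "z t \<noteq> 0" if "t \<in> {0..1}" for t
    proof
      assume "z t = 0"
      then have eq: "of_real (1 - t) *\<^sub>C \<theta> *\<^sub>C x = - (of_real t *\<^sub>C y)" by (simp add: z_def eq_neg_iff_add_eq_0)
      then have "norm (of_real (1 - t) *\<^sub>C \<theta> *\<^sub>C x) = norm (of_real t *\<^sub>C y)" by simp
      then have "\<bar>1 - t\<bar> = \<bar>t\<bar>" unfolding norm_scaleC norm_of_real using x y \<theta> by simp
      then have t: "t = 1 / 2" using that by auto
      have "y = (- \<theta>) *\<^sub>C x"
      proof (rule ell2_eqI)
        fix k
        have "of_real (1 - t) * (\<theta> * coord x k) = - (of_real t * coord y k)"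
          using arg_cong[OF eq, of "\<lambda>v. coord v k"] by (simp add: mult.assoc)
        then show "coord y k = coord (- \<theta> *\<^sub>C x) k" by (simp add: t)
      qed
      then have "B y y = 0" by (simp add: B_scale Bx)
      then show False using By by simp
    qed
    have "continuous_on {0..1} (\<lambda>t. (t\<^sup>2 + t * (1 - t) * m) / (norm (z t))\<^sup>2)"
    proof -
      have nz: "z = (\<lambda>t. (1 - t) *\<^sub>R (\<theta> *\<^sub>C x) + t *\<^sub>R y)" by (simp add: z_def scaleR_eq_scaleC fun_eq_iff)
      have "continuous_on {0..1} z" unfolding nz by (intro continuous_intros)
      then show ?thesis by (intro continuous_intros) (auto simp: z0)
    qed
    moreover have "norm (z 0) = 1" "norm (z 1) = 1" using x y \<theta> by (simp_all add: z_def)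
    ultimately obtain t where t: "t \<in> {0..1}" "(t\<^sup>2 + t * (1 - t) * m) / (norm (z t))\<^sup>2 = p"
      using IVT'[of "\<lambda>t. (t\<^sup>2 + t * (1 - t) * m) / (norm (z t))\<^sup>2" 0 p 1] p p' by auto
    define h where "h = of_real (1 / norm (z t)) *\<^sub>C z t"
    have nz: "norm (z t) > 0" using z0[OF t(1)] by simp
    have h: "h \<in> V" "norm h = 1"
      using nz zV by (auto simp: h_def norm_divide intro!: csubspace2D(3)[OF V] simp del: of_real_divide)
    have "B h h = of_real p"
    proof -
      have "B h h = of_real (1 / (norm (z t))\<^sup>2) * B (z t) (z t)"
        unfolding h_def B_scale complex_cnj_complex_of_real by (simp add: power2_eq_square)
      also have "\<dots> = of_real (1 / (norm (z t))\<^sup>2 * (t\<^sup>2 + t * (1 - t) * m))" unfolding Bz by (simp only: of_real_mult)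
      also have "\<dots> = of_real p" unfolding t(2)[symmetric] by simp
      finally show ?thesis .
    qed
    then have "cinner (T h) h = p' *\<^sub>R w1 + p *\<^sub>R w2"
      using B_eq[of h] h by (simp add: p' scaleR_conv_of_real algebra_simps)
    then show ?thesis using h by force
  qed
qed

section \<open>Support functions\<close>

definition supported :: "(complex \<Rightarrow> real) \<Rightarrow> complex set" where
  "supported H = {w. \<forall>\<zeta>. cmod \<zeta> = 1 \<longrightarrow> Re (cnj \<zeta> * w) \<le> H \<zeta>}"

lemma closed_supported: "closed (supported H)"
  unfolding supported_def
  by (intro closed_Collect_all closed_Collect_imp open_Collect_const closed_Collect_le continuous_intros)

text \<open>A point outside the closure is strictly separated from it; along the normalized normal,
  the approximation of H by points of W contradicts the separation.\<close>

lemma closure_eq_supported: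
  assumes "convex W" and upper: "\<And>w \<zeta>. w \<in> W \<Longrightarrow> cmod \<zeta> = 1 \<Longrightarrow> Re (cnj \<zeta> * w) \<le> H \<zeta>"
    and approx: "\<And>\<zeta> \<epsilon>. cmod \<zeta> = 1 \<Longrightarrow> 0 < \<epsilon> \<Longrightarrow> \<exists>w\<in>W. H \<zeta> - \<epsilon> \<le> Re (cnj \<zeta> * w)"
  shows "closure W = supported H"
proof
  have "W \<subseteq> supported H" using upper by (auto simp: supported_def)
  then show "closure W \<subseteq> supported H" by (intro closure_minimal closed_supported)
  show "supported H \<subseteq> closure W"
  proof
    fix w assume w: "w \<in> supported H"
    show "w \<in> closure W"
    proof (rule ccontr)
      assume "w \<notin> closure W"
      then obtain v b where v: "inner v w < b" "\<forall>x\<in>closure W. inner v x > b"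
        using separating_hyperplane_closed_point[of "closure W" w] assms(1) convex_closure by blast
      obtain w0 where "w0 \<in> W" using approx[of 1 1] by auto
      then have "v \<noteq> 0" using v closure_subset by fastforce
      define \<zeta> where "\<zeta> = - v / of_real (cmod v)"
      have \<zeta>: "cmod \<zeta> = 1" using \<open>v \<noteq> 0\<close> by (simp add: \<zeta>_def norm_divide)
      have Re: "Re (cnj \<zeta> * x) = - inner v x / cmod v" for x
        using \<open>v \<noteq> 0\<close> by (simp add: \<zeta>_def inner_complex_def field_simps)
      have "- b / cmod v < H \<zeta>"
      proof -
        have "- b / cmod v < Re (cnj \<zeta> * w)" unfolding Re using v(1) \<open>v \<noteq> 0\<close> by (intro divide_strict_right_mono) auto
        then show ?thesis using w \<zeta> by (auto simp: supported_def)
      qed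
      then obtain x where x: "x \<in> W" "H \<zeta> - (H \<zeta> - (- b / cmod v)) \<le> Re (cnj \<zeta> * x)"
        using approx[OF \<zeta>, of "H \<zeta> - (- b / cmod v)"] by auto
      have "- inner v x / cmod v < - b / cmod v"
        using v(2) x(1) closure_subset \<open>v \<noteq> 0\<close> by (intro divide_strict_right_mono) auto
      then show False using x(2) unfolding Re by simp
    qed
  qed
qed

text \<open>On the compact circle a slack that is never 0 has a positive minimum, which is the
  radius of a ball inside the set; a point with slack 0 in direction \<zeta> leaves the set along
  \<zeta>.\<close>

lemma frontier_supported:
  assumes cont: "continuous_on (sphere 0 1) H"
  shows "frontier (supported H) = {w \<in> supported H. \<exists>\<zeta>. cmod \<zeta> = 1 \<and> Re (cnj \<zeta> * w) = H \<zeta>}"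
proof -
  have int: "w \<in> interior (supported H)"
    if w: "w \<in> supported H" "\<And>\<zeta>. cmod \<zeta> = 1 \<Longrightarrow> Re (cnj \<zeta> * w) \<noteq> H \<zeta>" for w
  proof -
    have "continuous_on (sphere 0 1) (\<lambda>\<zeta>. H \<zeta> - Re (cnj \<zeta> * w))" by (intro continuous_intros cont)
    then obtain \<zeta>0 where \<zeta>0: "\<zeta>0 \<in> sphere 0 1" "\<And>\<zeta>. \<zeta> \<in> sphere 0 1 \<Longrightarrow> H \<zeta>0 - Re (cnj \<zeta>0 * w) \<le> H \<zeta> - Re (cnj \<zeta> * w)"
      using continuous_attains_inf[of "sphere 0 1" "\<lambda>\<zeta>. H \<zeta> - Re (cnj \<zeta> * w)"] by auto
    define m where "m = H \<zeta>0 - Re (cnj \<zeta>0 * w)"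
    have "Re (cnj \<zeta>0 * w) \<le> H \<zeta>0" "Re (cnj \<zeta>0 * w) \<noteq> H \<zeta>0"
      using w(1) w(2)[of \<zeta>0] \<zeta>0(1) unfolding supported_def by auto
    then have m: "0 < m" by (simp add: m_def)
    have "ball w m \<subseteq> supported H"
    proof
      fix x assume x: "x \<in> ball w m"
      show "x \<in> supported H"
        unfolding supported_def
      proof (intro CollectI allI impI)
        fix \<zeta> :: complex assume \<zeta>: "cmod \<zeta> = 1"
        have "Re (cnj \<zeta> * x) = Re (cnj \<zeta> * w) + Re (cnj \<zeta> * (x - w))" by (simp add: algebra_simps)
        also have "Re (cnj \<zeta> * (x - w)) \<le> cmod (x - w)"
          using complex_Re_le_cmod[of "cnj \<zeta> * (x - w)"] \<zeta> by (simp add: norm_mult)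
        also have "cmod (x - w) \<le> m" using x by (simp add: dist_norm norm_minus_commute less_imp_le)
        also have "m \<le> H \<zeta> - Re (cnj \<zeta> * w)" using \<zeta>0(2)[of \<zeta>] \<zeta> by (simp add: m_def)
        finally show "Re (cnj \<zeta> * x) \<le> H \<zeta>" by simp
      qed
    qed
    then show ?thesis using m by (meson centre_in_ball mem_interior)
  qed
  have not_int: "w \<notin> interior (supported H)" if \<zeta>: "cmod \<zeta> = 1" "Re (cnj \<zeta> * w) = H \<zeta>" for w \<zeta>
  proof
    assume "w \<in> interior (supported H)"
    then obtain e where e: "0 < e" "ball w e \<subseteq> supported H" by (meson mem_interior)
    have "w + of_real (e / 2) * \<zeta> \<in> ball w e" using e(1) \<zeta>(1) by (simp add: dist_norm norm_mult)
    then have "Re (cnj \<zeta> * (w + of_real (e / 2) * \<zeta>)) \<le> H \<zeta>" using e(2) \<zeta>(1) by (auto simp: supported_def)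
    moreover have "cnj \<zeta> * (w + of_real (e / 2) * \<zeta>) = cnj \<zeta> * w + of_real (e / 2) * (\<zeta> * cnj \<zeta>)"
      by (simp add: algebra_simps)
    moreover have "\<zeta> * cnj \<zeta> = 1" using \<zeta>(1) complex_norm_square[of \<zeta>] by simp
    ultimately have "H \<zeta> + e / 2 \<le> H \<zeta>" by (simp only: mult_1_right plus_complex.sel Re_complex_of_real \<zeta>(2))
    then show False using e(1) by simp
  qed
  show ?thesis unfolding frontier_def closure_closed[OF closed_supported] using int not_int by blast
qed

text \<open>The slack H(cis s) - Re (cnj (cis s) w) has its minimum 0 at s = t. Its vanishing
  derivative prescribes the tangential component of w, and the contact equation the normal
  one.\<close>

lemma supporting_point_unique:
  assumes deriv: "((\<lambda>s. H (cis s)) has_real_derivative d) (at t)"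
    and w: "w \<in> supported H" "Re (cnj (cis t) * w) = H (cis t)"
    and v: "v \<in> supported H" "Re (cnj (cis t) * v) = H (cis t)"
  shows "w = v"
proof -
  have der: "- sin t * Re x + cos t * Im x = d" if x: "x \<in> supported H" "Re (cnj (cis t) * x) = H (cis t)" for x
  proof -
    define F where "F s = H (cis s) - (cos s * Re x + sin s * Im x)" for s
    have Re: "Re (cnj (cis s) * x) = cos s * Re x + sin s * Im x" for s by simp
    have F: "(F has_real_derivative (d - (- sin t * Re x + cos t * Im x))) (at t)"
      unfolding F_def by (auto intro!: derivative_eq_intros deriv)
    have "F t = 0" using x(2) unfolding Re F_def by simp
    moreover have "0 \<le> F s" for s
    proof -
      have "Re (cnj (cis s) * x) \<le> H (cis s)" using x(1) norm_cis unfolding supported_def by blast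
      then show ?thesis unfolding F_def Re by simp
    qed
    ultimately have "\<forall>s. \<bar>t - s\<bar> < 1 \<longrightarrow> F t \<le> F s" by simp
    then have "d - (- sin t * Re x + cos t * Im x) = 0" using DERIV_local_min[OF F, of 1] by simp
    then show ?thesis by simp
  qed
  define u where "u = w - v"
  have 1: "- sin t * Re u + cos t * Im u = 0" using der[OF w] der[OF v] by (simp add: u_def algebra_simps)
  have 2: "cos t * Re u + sin t * Im u = 0" using w(2) v(2) by (simp add: u_def algebra_simps)
  have "Re u = (cos t * cos t + sin t * sin t) * Re u" unfolding sin_cos_squared_add3 by simp
  also have "\<dots> = cos t * (cos t * Re u + sin t * Im u) - sin t * (- sin t * Re u + cos t * Im u)" by algebra
  also have "\<dots> = 0" unfolding 1 2 by simp
  finally have re: "Re u = 0" .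
  have "Im u = (cos t * cos t + sin t * sin t) * Im u" unfolding sin_cos_squared_add3 by simp
  also have "\<dots> = sin t * (cos t * Re u + sin t * Im u) + cos t * (- sin t * Re u + cos t * Im u)" by algebra
  also have "\<dots> = 0" unfolding 1 2 by simp
  finally have "u = 0" using re by (simp add: complex_eq_iff)
  then show ?thesis by (simp add: u_def)
qed

section \<open>The envelope\<close>

lemma cmod_affine_cis: "(cmod (of_real x + of_real y * cis t))\<^sup>2 = x\<^sup>2 + y\<^sup>2 + 2 * x * y * cos t"
  unfolding cmod_power2 by (simp add: power2_sum power_mult_distrib sin_squared_eq algebra_simps)

context
  fixes a c :: real
  assumes c_pos: "0 < c" and a_eq: "a = 1 + c"
begin

text \<open>The bound on Re (cnj \<zeta> w) that follows from 2 - 2 Re (cnj \<zeta> w) being at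
  least the square of \<open>gap\<close>.\<close>

definition suppH :: "complex \<Rightarrow> real" where
  "suppH \<zeta> = 1 - (gap a c \<zeta>)\<^sup>2 / 2"

lemma AC: "0 < a / (a + c)" "a / (a + c) < 1" "c / (a + c) = 1 - a / (a + c)"
  using c_pos a_eq by (auto simp: field_simps)

lemma continuous_suppH: "continuous_on S suppH"
  unfolding suppH_def gap_def[OF c_pos a_eq] by (intro continuous_intros) simp

text \<open>Only the square root in |\<zeta> - A| could fail to be differentiable, and 0 < A < 1
  keeps it away from 0 on the circle.\<close>

lemma suppH_differentiable: "\<exists>d. ((\<lambda>s. suppH (cis s)) has_real_derivative d) (at t)"
proof -
  define A where "A = a / (a + c)"
  have A: "0 < A" "A < 1" using AC by (auto simp: A_def)
  have sq: "(cmod (cis s - of_real A))\<^sup>2 = 1 + A\<^sup>2 - 2 * A * cos s" for s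
    unfolding cmod_power2 using sin_cos_squared_add[of s] by (simp add: power2_eq_square algebra_simps)
  have eq: "suppH (cis s) = 1 - (sqrt (1 + A\<^sup>2 - 2 * A * cos s) - c / (a + c))\<^sup>2 / 2" for s
    unfolding suppH_def gap_def[OF c_pos a_eq] A_def[symmetric] sq[symmetric] by simp
  have "2 * A * cos t \<le> 2 * A * 1" using A by (intro mult_left_mono) auto
  moreover have "0 < (1 - A)\<^sup>2" using A by simp
  ultimately have "0 < 1 + A\<^sup>2 - 2 * A * cos t" by (simp add: power2_eq_square algebra_simps)
  note pos = this
  have "((\<lambda>s. 1 + A\<^sup>2 - 2 * A * cos s) has_real_derivative (2 * A * sin t)) (at t)"
    by (auto intro!: derivative_eq_intros)
  from DERIV_chain2[OF DERIV_real_sqrt[OF pos] this]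
  have "((\<lambda>s. sqrt (1 + A\<^sup>2 - 2 * A * cos s)) has_real_derivative
      (inverse (sqrt (1 + A\<^sup>2 - 2 * A * cos t)) / 2 * (2 * A * sin t))) (at t)" .
  from DERIV_diff[OF DERIV_const DERIV_cdivide[OF DERIV_power[where n = 2, OF DERIV_diff[OF this DERIV_const]]]]
  show ?thesis unfolding eq by blast
qed

text \<open>Argument of the point where the ray from A = a/(a + c) in direction \<open>cis t\<close>
  meets the unit circle; the arcsine is the law of sines in the triangle formed by 0, A and that
  point.\<close>

definition normal_angle :: "real \<Rightarrow> real" where
  "normal_angle t = t - arcsin (a / (a + c) * sin t)"

lemma normal_direction:
  "\<exists>k>0. cis (normal_angle t) = of_real (a / (a + c)) + of_real k * cis t"
proof -
  define A where "A = a / (a + c)"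
  have A: "0 < A" "A < 1" using AC by (auto simp: A_def)
  define \<omega> where "\<omega> = arcsin (A * sin t)"
  have As: "\<bar>A * sin t\<bar> \<le> 1"
  proof -
    have "\<bar>A * sin t\<bar> = A * \<bar>sin t\<bar>" using A by (simp add: abs_mult)
    also have "\<dots> \<le> 1 * 1" using A by (intro mult_mono) auto
    finally show ?thesis by simp
  qed
  have s: "sin \<omega> = A * sin t" unfolding \<omega>_def using As by (intro sin_arcsin) auto
  have co: "cos \<omega> = sqrt (1 - (A * sin t)\<^sup>2)" unfolding \<omega>_def using As by (intro cos_arcsin) auto
  \<comment> \<open>Length of the ray from A to the circle; positive because A lies inside the
    disc.\<close>
  define k where "k = cos \<omega> - A * cos t"
  have "(A * cos t)\<^sup>2 < 1 - (A * sin t)\<^sup>2"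
  proof -
    have "(A * cos t)\<^sup>2 + (A * sin t)\<^sup>2 = A\<^sup>2" unfolding power_mult_distrib distrib_left[symmetric] by simp
    moreover have "A\<^sup>2 < 1" using A by (simp add: power_less_one_iff abs_square_less_1)
    ultimately show ?thesis by linarith
  qed
  then have "A * cos t < cos \<omega>" unfolding co by (rule real_less_rsqrt)
  then have k: "0 < k" by (simp add: k_def)
  have "cis (- \<omega>) = of_real A * cis (- t) + of_real k"
    by (rule complex_eqI) (simp_all add: k_def s)
  then have "cis t * cis (- \<omega>) = cis t * (of_real A * cis (- t) + of_real k)" by simp
  then have "cis (t - \<omega>) = of_real A + of_real k * cis t"
    by (simp add: cis_mult distrib_left mult.left_commute[of "cis t"] mult.commute)
  then show ?thesis using k by (auto simp: normal_angle_def A_def \<omega>_def)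
qed

text \<open>\<open>E t\<close> lies on the circle about \<open>lam\<close> of radius
  \<open>r\<close> = (1 - |lam|^2)/2, with \<open>lam\<close> on the boundary of the disc of zeros.
  The support function of the disc that it bounds is 1 - |\<zeta> - lam|^2/2, at most
  \<open>suppH\<close>, with equality when \<open>lam\<close> is the zero nearest to
  \<zeta>.\<close>

lemma curve_point:
  defines "E \<equiv> \<lambda>t. Complex (xE a c t) (yE a c t)"
  shows "E t \<in> supported suppH" "Re (cnj (cis (normal_angle t)) * E t) = suppH (cis (normal_angle t))"
proof -
  define A where "A = a / (a + c)"
  define C where "C = c / (a + c)"
  have AC1: "A + C = 1" using AC(3) by (simp add: A_def C_def)
  have A0: "0 < A" "0 < C" using AC by (auto simp: A_def C_def)
  define lam where "lam = of_real A + of_real C * cis t"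
  define r where "r = A * C * (1 - cos t)"
  have E: "E t = lam + of_real r * cis (normal_angle t)"
    by (rule complex_eqI)
       (simp_all add: E_def xE_def yE_def lam_def r_def A_def C_def normal_angle_def add_divide_distrib power2_eq_square)
  have r0: "0 \<le> r" using A0 by (simp add: r_def)
  have "(cmod lam)\<^sup>2 = A\<^sup>2 + C\<^sup>2 + 2 * A * C * cos t"
    unfolding lam_def by (rule cmod_affine_cis)
  also have "\<dots> = (A + C)\<^sup>2 - 2 * r" unfolding r_def by (simp add: power2_eq_square algebra_simps)
  finally have r: "(cmod lam)\<^sup>2 = 1 - 2 * r" using AC1 by simp
  have key: "Re (cnj \<zeta> * lam) + r = 1 - (cmod (\<zeta> - lam))\<^sup>2 / 2" if "cmod \<zeta> = 1" for \<zeta>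
  proof -
    have "(cmod (\<zeta> - lam))\<^sup>2 = (cmod \<zeta>)\<^sup>2 + (cmod lam)\<^sup>2 - 2 * Re (cnj \<zeta> * lam)"
      unfolding cmod_power2 by (simp add: power2_eq_square algebra_simps)
    then show ?thesis using r that by (simp add: field_simps)
  qed
  have ReE: "Re (cnj \<zeta> * E t) = Re (cnj \<zeta> * lam) + r * Re (cnj \<zeta> * cis (normal_angle t))" for \<zeta>
    unfolding E by (simp add: algebra_simps)
  show "E t \<in> supported suppH"
    unfolding supported_def
  proof (intro CollectI allI impI)
    fix \<zeta> :: complex assume \<zeta>: "cmod \<zeta> = 1"
    have "Re (cnj \<zeta> * cis (normal_angle t)) \<le> 1"
      using complex_Re_le_cmod[of "cnj \<zeta> * cis (normal_angle t)"] \<zeta> by (simp add: norm_mult)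
    then have "Re (cnj \<zeta> * E t) \<le> Re (cnj \<zeta> * lam) + r"
      unfolding ReE using r0 mult_left_mono[of "Re (cnj \<zeta> * cis (normal_angle t))" 1 r] by simp
    also have "\<dots> = 1 - (cmod (\<zeta> - lam))\<^sup>2 / 2" by (rule key[OF \<zeta>])
    also have "\<dots> \<le> suppH \<zeta>"
    proof -
      have "cmod (\<zeta> - of_real A) \<le> cmod (\<zeta> - lam) + C"
        using norm_triangle_ineq[of "\<zeta> - lam" "lam - of_real A"] A0 by (simp add: lam_def norm_mult)
      then have "gap a c \<zeta> \<le> cmod (\<zeta> - lam)" unfolding gap_def[OF c_pos a_eq] A_def[symmetric] C_def[symmetric] by simp
      then have "(gap a c \<zeta>)\<^sup>2 \<le> (cmod (\<zeta> - lam))\<^sup>2" using gap_nonneg[OF c_pos a_eq \<zeta>] by (rule power_mono)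
      then show ?thesis by (simp add: suppH_def)
    qed
    finally show "Re (cnj \<zeta> * E t) \<le> suppH \<zeta>" .
  qed
  define \<zeta> where "\<zeta> = cis (normal_angle t)"
  obtain k where k: "0 < k" "\<zeta> = of_real A + of_real k * cis t"
    using normal_direction[of t] by (auto simp: \<zeta>_def A_def)
  have "cnj \<zeta> * cis (normal_angle t) = 1" unfolding \<zeta>_def cis_cnj cis_mult by simp
  then have "Re (cnj \<zeta> * E t) = Re (cnj \<zeta> * lam) + r"
    unfolding ReE by (simp only: one_complex.sel mult_1_right)
  also have "\<dots> = 1 - (cmod (\<zeta> - lam))\<^sup>2 / 2" by (rule key) (simp add: \<zeta>_def)
  \<comment> \<open>A, \<open>lam\<close> and \<zeta> lie on one ray, so the distance is |k - C|,
    and k - C is \<open>gap\<close>.\<close>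
  also have "(cmod (\<zeta> - lam))\<^sup>2 = (k - C)\<^sup>2"
  proof -
    have "\<zeta> - lam = of_real (k - C) * cis t" unfolding k(2) lam_def by (simp add: algebra_simps)
    then show ?thesis by (simp add: norm_mult del: of_real_diff)
  qed
  also have "k - C = gap a c \<zeta>"
    unfolding gap_def[OF c_pos a_eq] A_def[symmetric] C_def[symmetric] using k by (simp add: norm_mult)
  finally show "Re (cnj (cis (normal_angle t)) * E t) = suppH (cis (normal_angle t))"
    by (simp only: \<zeta>_def suppH_def)
qed

text \<open>\<open>t\<close> is the argument of \<zeta> - A. Both |\<zeta> - A| and the length from
  \<open>normal_direction\<close> are positive roots of x^2 + 2 A x cos t + A^2 - 1, whose roots
  have negative product, so they agree.\<close>

lemma exists_angle:
  assumes \<zeta>: "cmod \<zeta> = 1"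
  obtains t where "t \<in> {0..<2 * pi}" "cis (normal_angle t) = \<zeta>"
proof -
  define A where "A = a / (a + c)"
  have A: "0 < A" "A < 1" using AC by (auto simp: A_def)
  define l where "l = cmod (\<zeta> - of_real A)"
  define t where "t = Arg2pi (\<zeta> - of_real A)"
  have t: "t \<in> {0..<2 * pi}" using Arg2pi[of "\<zeta> - of_real A"] by (simp add: t_def)
  have "\<zeta> - of_real A = of_real l * cis t"
    using Arg2pi[of "\<zeta> - of_real A"] unfolding t_def l_def cis_conv_exp is_Arg_def by (elim conjE)
  then have \<zeta>eq: "\<zeta> = of_real A + of_real l * cis t" by (simp add: algebra_simps)
  have "\<zeta> \<noteq> of_real A" using \<zeta> A by auto
  then have l: "0 < l" by (simp add: l_def)
  obtain k where k: "0 < k" "cis (normal_angle t) = of_real A + of_real k * cis t"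
    using normal_direction[of t] by (auto simp: A_def)
  have q: "A\<^sup>2 + 2 * A * x * cos t + x\<^sup>2 = 1" if "cmod (of_real A + of_real x * cis t) = 1" for x
    using cmod_affine_cis[of A x t] that by simp
  have ql: "A\<^sup>2 + 2 * A * l * cos t + l\<^sup>2 = 1" using q[of l] \<zeta> unfolding \<zeta>eq[symmetric] by simp
  have qk: "A\<^sup>2 + 2 * A * k * cos t + k\<^sup>2 = 1" using q[of k] unfolding k(2)[symmetric] by simp
  have "A\<^sup>2 < 1" using A by (simp add: power_less_one_iff abs_square_less_1)
  then have "0 < k * (k + 2 * A * cos t)" using qk by (simp add: power2_eq_square algebra_simps)
  then have "0 < k + 2 * A * cos t" using k(1) by (simp add: zero_less_mult_iff)
  moreover have "(k - l) * (k + 2 * A * cos t + l) = 0" using ql qk by (simp add: power2_eq_square algebra_simps)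
  ultimately have "k = l" using l by simp
  then show ?thesis using that[OF t] k(2) \<zeta>eq by simp
qed

text \<open>Each supporting line touches in a single point by differentiability, and every normal
  direction occurs on the curve.\<close>

lemma frontier_supported_suppH: "frontier (supported suppH) = curveE a c"
proof -
  have "w \<in> curveE a c" if w: "w \<in> supported suppH" "cmod \<zeta> = 1" "Re (cnj \<zeta> * w) = suppH \<zeta>" for w \<zeta>
  proof -
    obtain t where t: "t \<in> {0..<2 * pi}" "cis (normal_angle t) = \<zeta>" using exists_angle[OF w(2)] .
    obtain d where d: "((\<lambda>s. suppH (cis s)) has_real_derivative d) (at (normal_angle t))"
      using suppH_differentiable by blast
    have "w = Complex (xE a c t) (yE a c t)"
      by (rule supporting_point_unique[OF d w(1) _ curve_point]) (simp only: t(2) w(3))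
    then show ?thesis using t(1) by (auto simp: curveE_def)
  qed
  moreover have "\<exists>\<zeta>. cmod \<zeta> = 1 \<and> Re (cnj \<zeta> * Complex (xE a c t) (yE a c t)) = suppH \<zeta>" for t
    by (intro exI[of _ "cis (normal_angle t)"] conjI norm_cis curve_point(2))
  ultimately show ?thesis
    unfolding frontier_supported[OF continuous_suppH] using curve_point(1) by (auto simp: curveE_def)
qed

section \<open>From norm bounds to the numerical range\<close>

lemma norm_diff_shift_sq:
  assumes "norm h = 1" "cmod \<zeta> = 1"
  shows "(norm (\<zeta> *\<^sub>C h - sh1 h))\<^sup>2 = 2 - 2 * Re (cnj \<zeta> * cinner (sh1 h) h)"
proof -
  have "(norm (\<zeta> *\<^sub>C h - sh1 h))\<^sup>2 = (norm (\<zeta> *\<^sub>C h))\<^sup>2 + (norm (sh1 h))\<^sup>2 - 2 * inner (sh1 h) (\<zeta> *\<^sub>C h)"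
    unfolding power2_norm_eq_inner by (simp only: inner_diff_left inner_diff_right inner_commute[of "\<zeta> *\<^sub>C h" "sh1 h"])
  then show ?thesis using assms unfolding inner_eq_Re_cinner cinner_scaleC_right norm_scaleC norm_sh by simp
qed

lemma frontier_shift_compression:
  assumes V1: "csubspace2 V1" and V2: "csubspace2 V2"
    and orth: "\<And>f g. f \<in> V1 \<Longrightarrow> g \<in> V2 \<Longrightarrow> cinner f g = 0"
    and K: "\<And>x. Qop a c (Qop a c x) = 0 \<longleftrightarrow> (\<exists>f\<in>V1. \<exists>g\<in>V2. x = f + g)"
    and i1: "\<And>f. f \<in> V1 \<Longrightarrow> sh1 f \<in> V1" and i2: "\<And>g. g \<in> V2 \<Longrightarrow> sh2 g \<in> V2"
  shows "frontier {cinner (sh1 h) h |h. h \<in> V2 \<and> norm h = 1} = curveE a c"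
proof -
  define W where "W = {cinner (sh1 h) h |h. h \<in> V2 \<and> norm h = 1}"
  have W: "convex W" unfolding W_def by (rule convex_numerical_range[OF V2]) (simp_all add: shift_linear)
  have "closure W = supported suppH"
  proof (rule closure_eq_supported[OF W])
    fix w \<zeta> assume "w \<in> W" and \<zeta>: "cmod \<zeta> = 1"
    then obtain h where h: "h \<in> V2" "norm h = 1" "w = cinner (sh1 h) h" by (auto simp: W_def)
    have "\<exists>f\<in>V1. \<exists>g\<in>V2. sh2 (sh2 h) = f + g"
      using i2[OF i2[OF h(1)]] csubspace2D(1)[OF V1] by (intro bexI[of _ 0] bexI[of _ "sh2 (sh2 h)"]) auto
    then have "Rop1 a c (Rop1 a c h) = 0" unfolding K[symmetric] Qop_sh .
    from gap_le_norm[OF c_pos a_eq this \<zeta>] have "gap a c \<zeta> \<le> norm (\<zeta> *\<^sub>C h - sh1 h)" by (simp add: h)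
    then have "(gap a c \<zeta>)\<^sup>2 \<le> (norm (\<zeta> *\<^sub>C h - sh1 h))\<^sup>2" using gap_nonneg[OF c_pos a_eq \<zeta>] by (rule power_mono)
    then show "Re (cnj \<zeta> * w) \<le> suppH \<zeta>"
      unfolding norm_diff_shift_sq[OF h(2) \<zeta>] h(3)[symmetric] suppH_def by simp
  next
    fix \<zeta> :: complex and \<epsilon> :: real assume \<zeta>: "cmod \<zeta> = 1" and \<epsilon>: "0 < \<epsilon>"
    define d where "d = gap a c \<zeta>"
    have d0: "0 \<le> d" unfolding d_def by (rule gap_nonneg[OF c_pos a_eq \<zeta>])
    \<comment> \<open>Small enough that (d + e)^2 is at most d^2 + 2 \<epsilon>, which costs
      \<epsilon> in the support function.\<close>
    define e where "e = min 1 (\<epsilon> / (d + 1))"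
    have e: "0 < e" "e \<le> 1" "e \<le> \<epsilon> / (d + 1)" using \<epsilon> d0 by (auto simp: e_def)
    have a0: "a \<noteq> 0" using a_pos[OF c_pos a_eq] by simp
    obtain g where g: "g \<in> V2" "g \<noteq> 0" "norm (\<zeta> *\<^sub>C g - sh1 g) \<le> (d + e) * norm g"
      using near_optimal[OF c_pos a_eq V2 i2 multiple_in_invariant_subspace[OF V1 V2 orth K i1 i2 a0] \<zeta> e(1)]
      unfolding d_def by blast
    define h where "h = of_real (1 / norm g) *\<^sub>C g"
    have h: "h \<in> V2" "norm h = 1"
      using g by (auto simp: h_def norm_divide intro!: csubspace2D(3)[OF V2] simp del: of_real_divide)
    have "\<zeta> *\<^sub>C h - sh1 h = of_real (1 / norm g) *\<^sub>C (\<zeta> *\<^sub>C g - sh1 g)"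
      by (simp add: h_def shift_linear scaleC_distrib mult.commute)
    then have "norm (\<zeta> *\<^sub>C h - sh1 h) = norm (\<zeta> *\<^sub>C g - sh1 g) / norm g"
      by (simp add: norm_divide)
    also have "\<dots> \<le> d + e" using g by (simp add: divide_le_eq)
    finally have "(norm (\<zeta> *\<^sub>C h - sh1 h))\<^sup>2 \<le> (d + e)\<^sup>2" by (rule power_mono) simp
    then have "2 - 2 * Re (cnj \<zeta> * cinner (sh1 h) h) \<le> (d + e)\<^sup>2" unfolding norm_diff_shift_sq[OF h(2) \<zeta>] .
    moreover have "(d + e)\<^sup>2 \<le> d\<^sup>2 + 2 * \<epsilon>"
    proof -
      have "e * e \<le> e * 1" using e by (intro mult_left_mono) auto
      moreover have "e * (d + 1) \<le> \<epsilon>" using e(3) d0 by (simp add: le_divide_eq)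
      moreover have "(d + e)\<^sup>2 = d\<^sup>2 + 2 * (e * (d + 1)) - 2 * e + e * e" by (simp add: power2_eq_square algebra_simps)
      ultimately show ?thesis using e(1) by linarith
    qed
    ultimately have "suppH \<zeta> - \<epsilon> \<le> Re (cnj \<zeta> * cinner (sh1 h) h)" unfolding suppH_def d_def[symmetric] by linarith
    then show "\<exists>w\<in>W. suppH \<zeta> - \<epsilon> \<le> Re (cnj \<zeta> * w)" using h unfolding W_def by blast
  qed
  \<comment> \<open>The numerical range is not known to be closed; by convexity it has the same
    interior as its closure, hence the same frontier.\<close>
  then have "frontier W = frontier (supported suppH)"
    using convex_interior_closure[OF W] by (metis closure_closure frontier_def)
  then show ?thesis unfolding W_def frontier_supported_suppH .
qed

end

text \<open>A zero on the torus gives a \<le> 1 + c by the triangle inequality, and for a < 1 + c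
  the point (r, -r) with r = a/(1 + c) would be a zero in the bidisk.\<close>

lemma a_eq_1_plus_c:
  assumes "a > 0" "c > 0" "\<forall>z\<in>bidisk. p_poly a c z \<noteq> 0"
    and "\<exists>z1 z2. cmod z1 = 1 \<and> cmod z2 = 1 \<and> p_poly a c (z1, z2) = 0"
  shows "a = 1 + c"
proof (rule antisym)
  obtain z1 z2 where z: "cmod z1 = 1" "cmod z2 = 1" "p_poly a c (z1, z2) = 0" using assms(4) by blast
  then have "of_real a = z1 - of_real c * z2" by (simp add: p_poly_def algebra_simps)
  then have "cmod (of_real a) \<le> cmod z1 + cmod (of_real c * z2)" by (metis norm_triangle_ineq4)
  then show "a \<le> 1 + c" using z assms by (simp add: norm_mult)
  show "1 + c \<le> a"
  proof (rule ccontr)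
    assume "\<not> 1 + c \<le> a"
    define r where "r = a / (1 + c)"
    have r: "0 < r" "r < 1" "r * (1 + c) = a" using assms \<open>\<not> 1 + c \<le> a\<close> by (auto simp: r_def field_simps)
    have "(of_real r, - of_real r) \<in> bidisk" using r by (simp add: bidisk_def)
    moreover have "p_poly a c (of_real r, - of_real r) = 0"
      unfolding r(3)[symmetric] by (simp add: p_poly_def algebra_simps)
    ultimately show False using assms(3) by blast
  qed
qed

theorem theorem6p3:
  fixes a c :: real
    and S1 S2 :: "(complex \<times> complex \<Rightarrow> complex) set"
  assumes "a > 0" and "c > 0"
    and "\<forall>z\<in>bidisk. p_poly a c z \<noteq> 0"
    and "\<exists>z1 z2. cmod z1 = 1 \<and> cmod z2 = 1 \<and> p_poly a c (z1, z2) = 0"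
    and "closed_subspace_H2 S1" and "closed_subspace_H2 S2"
    and "\<forall>f\<in>S1. \<forall>g\<in>S2. H2_inner f g = 0"
    and "model_space (Theta a c) = {(\<lambda>z. f z + g z) | f g. f \<in> S1 \<and> g \<in> S2}"
    and "\<forall>f\<in>S1. Mz1 f \<in> S1"
    and "\<forall>g\<in>S2. Mz2 g \<in> S2"
  shows "frontier (numerical_range S2 (\<lambda>h. orth_proj S2 (Mz1 h))) = curveE a c"
proof -
  have c: "0 < c" and a: "a = 1 + c" using a_eq_1_plus_c[OF assms(1-4)] assms(2) by auto
  obtain V1 where V1: "S1 = fn_of ` V1" "closed V1" "csubspace2 V1" using closed_subspace_H2D[OF assms(5)] .
  obtain V2 where V2: "S2 = fn_of ` V2" "closed V2" "csubspace2 V2" using closed_subspace_H2D[OF assms(6)] .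
  \<comment> \<open>The decomposition of the model space becomes one of the kernel of
    \<open>Qop\<close> squared.\<close>
  have K: "Qop a c (Qop a c x) = 0 \<longleftrightarrow> (\<exists>f\<in>V1. \<exists>g\<in>V2. x = f + g)" for x
  proof -
    have "Qop a c (Qop a c x) = 0 \<longleftrightarrow> (\<exists>f g. fn_of x = (\<lambda>z. f z + g z) \<and> f \<in> S1 \<and> g \<in> S2)"
      unfolding model_space_iff[OF c a, symmetric] assms(8) by simp
    also have "\<dots> \<longleftrightarrow> (\<exists>f\<in>V1. \<exists>g\<in>V2. fn_of x = fn_of (f + g))"
      unfolding fn_of_add V1(1) V2(1) image_iff by metis
    finally show ?thesis unfolding fn_of_inject .
  qed
  have val: "H2_inner (orth_proj S2 (Mz1 (fn_of h))) (fn_of h) = cinner (sh1 h) h" if "h \<in> V2" for h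
    unfolding V2(1) fn_of_sh1[symmetric] by (rule H2_inner_orth_proj[OF V2(2,3) that])
  have "numerical_range S2 (\<lambda>h. orth_proj S2 (Mz1 h))
      = {H2_inner (orth_proj S2 (Mz1 (fn_of h))) (fn_of h) |h. h \<in> V2 \<and> norm h = 1}"
  proof -
    have "h \<in> S2 \<and> H2_norm h = 1 \<longleftrightarrow> (\<exists>v. h = fn_of v \<and> v \<in> V2 \<and> norm v = 1)" for h
      unfolding V2(1) by (auto simp only: image_iff H2_norm_fn_of)
    then show ?thesis unfolding numerical_range_def by (simp only:) blast
  qed
  also have "\<dots> = {cinner (sh1 h) h |h. h \<in> V2 \<and> norm h = 1}"
    by (intro Collect_cong ex_cong1) (auto simp only: val)
  also have "frontier \<dots> = curveE a c"
  proof (rule frontier_shift_compression[OF c a V1(3) V2(3) _ K])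
    show "cinner f g = 0" if "f \<in> V1" "g \<in> V2" for f g
      using assms(7) that H2_inner_fn_of[of f g] unfolding V1(1) V2(1) by (metis imageI)
    show "sh1 f \<in> V1" if "f \<in> V1" for f
    proof -
      have "fn_of (sh1 f) \<in> fn_of ` V1" using assms(9) that unfolding V1(1) fn_of_sh1 by blast
      then show ?thesis by (simp only: image_iff fn_of_inject) simp
    qed
    show "sh2 g \<in> V2" if "g \<in> V2" for g
    proof -
      have "fn_of (sh2 g) \<in> fn_of ` V2" using assms(10) that unfolding V2(1) fn_of_sh2 by blast
      then show ?thesis by (simp only: image_iff fn_of_inject) simp
    qed
  qed
  finally show ?thesis .
qed

end
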